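(* Let $d,k$ be integers with $k > d \ge 3$. The outer Rokhlin Pinsker factor of $(X,m_X,T)$ is trivial, so $(X,m_X,T)$ has completely positive Rokhlin entropy.
   Context: $\Gamma=\Gamma_{d,k}=\langle s_1,\dots,s_d : s_1^k=\dots=s_d^k=e\rangle$ is the free product of $d$ copies of $\mathbb{Z}_k=\mathbb{Z}/k\mathbb{Z}$. $X\le \mathbb{Z}_2^\Gamma$ is the closed subgroup $$X=\Big\{x\in\mathbb{Z}_2^\Gamma : \sum_{j=0}^{k-1}x_{gs_i^j}=0 \ \ \forall g\in\Gamma,\ i=1,\dots,d\Big\},$$ $m_X$ is its Haar probability measure, and $T$ is the shift action $(T^gx)_h=x_{g^{-1}h}$ of $\Gamma$. For a countable measurable partition $\mathcal{P}$ of $(Y,\nu)$ its Shannon entropy is $H_\nu(\mathcal{P})=-\sum_{P\in\mathcal{P}}\nu(P)\log\nu(P)$. The Rokhlin entropy of a $\Gamma$-system $(Y,\nu,S)$ is the infimum of $H_\nu(\mathcal{P})$ over all generating countable partitions $\mathcal{P}$, i.e. those for which the smallest $S$-invariant $\sigma$-algebra containing $\mathcal{P}$ is the full $\sigma$-algebra of measurable sets modulo null sets. The outer Rokhlin entropy of a factor of $(Y,\nu,S)$, corresponding to an invariant sub-$\sigma$-algebra $\mathcal{F}$, is the infimum of $H_\nu(\mathcal{P})$ over all countable measurable partitions $\mathcal{P}$ of $Y$ such that the smallest $S$-invariant $\sigma$-algebra containing $\mathcal{P}$ contains $\mathcal{F}$ modulo null sets. The outer Rokhlin Pinsker factor is the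 largest factor whose outer Rokhlin entropy is zero. A factor is trivial if its measure is a point mass. A system has completely positive Rokhlin entropy if every nontrivial factor of it has positive Rokhlin entropy. *)

theory Defs
  imports
    "HOL-Probability.Probability"
    "HOL-Algebra.Group"
    "HOL-Library.Z2"
begin

section \<open>Groups given by generators and relators\<close>

text \<open>
  A word is a list of letters \<open>(a, True)\<close>, standing for the generator \<open>a\<close>, and
  \<open>(a, False)\<close>, standing for its inverse.
\<close>

type_synonym 'a word = "('a \<times> bool) list"

definition words :: "'a set \<Rightarrow> 'a word set" where
  "words S = lists (S \<times> UNIV)"

inductive_set pres_rel :: "'a set \<Rightarrow> 'a word set \<Rightarrow> ('a word \<times> 'a word) set"
  for S :: "'a set" and R :: "'a word set" where
  refl: "u \<in> words S \<Longrightarrow> (u, u) \<in> pres_rel S R"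
| sym: "(u, v) \<in> pres_rel S R \<Longrightarrow> (v, u) \<in> pres_rel S R"
| trans: "(u, v) \<in> pres_rel S R \<Longrightarrow> (v, w) \<in> pres_rel S R \<Longrightarrow> (u, w) \<in> pres_rel S R"
| cancel: "u \<in> words S \<Longrightarrow> v \<in> words S \<Longrightarrow> a \<in> S \<Longrightarrow>
    (u @ [(a, b), (a, \<not> b)] @ v, u @ v) \<in> pres_rel S R"
| relator: "u \<in> words S \<Longrightarrow> v \<in> words S \<Longrightarrow> r \<in> R \<Longrightarrow> r \<in> words S \<Longrightarrow>
    (u @ r @ v, u @ v) \<in> pres_rel S R"

definition presented_group :: "'a set \<Rightarrow> 'a word set \<Rightarrow> 'a word set monoid" where
  "presented_group S R =
    \<lparr> carrier = words S // pres_rel S R,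
      mult = (\<lambda>A B. \<Union>u\<in>A. \<Union>v\<in>B. pres_rel S R `` {u @ v}),
      one = pres_rel S R `` {[]} \<rparr>"

lemma words_append [simp]: "u @ v \<in> words S \<longleftrightarrow> u \<in> words S \<and> v \<in> words S"
  by (auto simp: words_def)

lemma words_Nil [simp]: "[] \<in> words S"
  by (simp add: words_def)

lemma words_Cons [simp]: "x # u \<in> words S \<longleftrightarrow> fst x \<in> S \<and> u \<in> words S"
  by (cases x) (auto simp: words_def)

lemma pres_rel_words: "(u, v) \<in> pres_rel S R \<Longrightarrow> u \<in> words S \<and> v \<in> words S"
  by (induction rule: pres_rel.induct) auto

lemma equiv_pres_rel: "equiv (words S) (pres_rel S R)"
  by (intro equivI refl_onI symI transI)
     (auto dest: pres_rel_words intro: pres_rel.refl pres_rel.sym pres_rel.trans)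

lemma pres_rel_append_left:
  assumes "(u, v) \<in> pres_rel S R" "w \<in> words S"
  shows "(w @ u, w @ v) \<in> pres_rel S R"
  using assms
proof (induction rule: pres_rel.induct)
  case (cancel u v a b)
  then show ?case using pres_rel.cancel[of "w @ u" S v a b R] by simp
next
  case (relator u v r)
  then show ?case using pres_rel.relator[of "w @ u" S v r R] by simp
qed (auto intro: pres_rel.refl pres_rel.sym pres_rel.trans)

lemma pres_rel_append_right:
  assumes "(u, v) \<in> pres_rel S R" "w \<in> words S"
  shows "(u @ w, v @ w) \<in> pres_rel S R"
  using assms
proof (induction rule: pres_rel.induct)
  case (cancel u v a b)
  then show ?case using pres_rel.cancel[of u S "v @ w" a b R] by simp
next
  case (relator u v r)
  then show ?case using pres_rel.relator[of u S "v @ w" r R] by simp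
qed (auto intro: pres_rel.refl pres_rel.sym pres_rel.trans)

lemma congruent2_pres_rel:
  "(\<lambda>u v. pres_rel S R `` {u @ v}) respects2 pres_rel S R"
proof (rule congruent2I')
  fix u u' v v'
  assume *: "(u, u') \<in> pres_rel S R" "(v, v') \<in> pres_rel S R"
  then have "(u @ v, u' @ v') \<in> pres_rel S R"
    by (meson pres_rel.trans pres_rel_append_left pres_rel_append_right pres_rel_words)
  then show "pres_rel S R `` {u @ v} = pres_rel S R `` {u' @ v'}"
    by (rule equiv_class_eq[OF equiv_pres_rel])
qed

lemma presented_group_mult:
  assumes "u \<in> words S" "v \<in> words S"
  shows "pres_rel S R `` {u} \<otimes>\<^bsub>presented_group S R\<^esub> pres_rel S R `` {v} = pres_rel S R `` {u @ v}"
  using UN_equiv_class2[OF equiv_pres_rel equiv_pres_rel congruent2_pres_rel assms]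
  by (simp add: presented_group_def)

lemma pres_rel_inverse:
  "u \<in> words S \<Longrightarrow> (rev (map (map_prod id Not) u) @ u, []) \<in> pres_rel S R"
proof (induction u)
  case Nil
  then show ?case by (simp add: pres_rel.refl)
next
  case (Cons x u)
  obtain a b where x: "x = (a, b)" by fastforce
  let ?v = "rev (map (map_prod id Not) u)"
  have "?v \<in> words S" using Cons.prems by (force simp: words_def)
  then have "(?v @ [(a, \<not> b), (a, \<not> \<not> b)] @ u, ?v @ u) \<in> pres_rel S R"
    using Cons.prems x by (intro pres_rel.cancel) auto
  with Cons show ?case by (auto simp: x id_def intro: pres_rel.trans)
qed

lemma group_presented_group: "group (presented_group S R)"
proof (rule groupI)
  let ?G = "presented_group S R"
  have carrier: "carrier ?G = words S // pres_rel S R" and one: "\<one>\<^bsub>?G\<^esub> = pres_rel S R `` {[]}"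
    by (simp_all add: presented_group_def)
  note [simp] = carrier one presented_group_mult
  show "x \<otimes>\<^bsub>?G\<^esub> y \<in> carrier ?G" if "x \<in> carrier ?G" "y \<in> carrier ?G" for x y
    using that by (auto elim!: quotientE intro!: quotientI)
  show "\<one>\<^bsub>?G\<^esub> \<in> carrier ?G"
    by (auto intro!: quotientI)
  show "x \<otimes>\<^bsub>?G\<^esub> y \<otimes>\<^bsub>?G\<^esub> z = x \<otimes>\<^bsub>?G\<^esub> (y \<otimes>\<^bsub>?G\<^esub> z)"
    if "x \<in> carrier ?G" "y \<in> carrier ?G" "z \<in> carrier ?G" for x y z
    using that by (auto elim!: quotientE)
  show "\<one>\<^bsub>?G\<^esub> \<otimes>\<^bsub>?G\<^esub> x = x" if "x \<in> carrier ?G" for x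
    using that by (auto elim!: quotientE)
  show "\<exists>y\<in>carrier ?G. y \<otimes>\<^bsub>?G\<^esub> x = \<one>\<^bsub>?G\<^esub>" if "x \<in> carrier ?G" for x
  proof -
    from that obtain u where u: "u \<in> words S" "x = pres_rel S R `` {u}"
      by (auto elim: quotientE)
    let ?v = "rev (map (map_prod id Not) u)"
    have v: "?v \<in> words S" using u(1) by (force simp: words_def)
    have "pres_rel S R `` {?v} \<otimes>\<^bsub>?G\<^esub> x = \<one>\<^bsub>?G\<^esub>"
      using u v equiv_class_eq[OF equiv_pres_rel pres_rel_inverse[OF u(1)]] by simp
    with v show ?thesis by (auto intro!: quotientI)
  qed
qed


section \<open>Entropy of group actions\<close>

text \<open>
  A system is given by a group \<open>G\<close>, a probability space \<open>M\<close> and a map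
  \<open>S :: 'g \<Rightarrow> 'y \<Rightarrow> 'y\<close> with \<open>S g\<close> the transformation of \<open>space M\<close> by \<open>g\<close>.  Its factors are
  represented by the invariant sub-\<open>\<sigma>\<close>-algebras of \<open>sets M\<close>, compared up to null sets.
\<close>

definition invariant_subalgebra ::
  "('g, 'b) monoid_scheme \<Rightarrow> 'y measure \<Rightarrow> ('g \<Rightarrow> 'y \<Rightarrow> 'y) \<Rightarrow> 'y set set \<Rightarrow> bool" where
  "invariant_subalgebra G M S F \<longleftrightarrow>
     sigma_algebra (space M) F \<and> F \<subseteq> sets M \<and>
     (\<forall>g\<in>carrier G. \<forall>A\<in>F. S g -` A \<inter> space M \<in> F)"

definition generated_subalgebra ::
  "('g, 'b) monoid_scheme \<Rightarrow> 'y measure \<Rightarrow> ('g \<Rightarrow> 'y \<Rightarrow> 'y) \<Rightarrow> 'y set set \<Rightarrow> 'y set set" where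
  "generated_subalgebra G M S P = \<Inter>{F. invariant_subalgebra G M S F \<and> P \<subseteq> F}"

definition subset_mod_null :: "'y measure \<Rightarrow> 'y set set \<Rightarrow> 'y set set \<Rightarrow> bool" where
  "subset_mod_null M F F' \<longleftrightarrow> (\<forall>A\<in>F. \<exists>B\<in>F'. sym_diff A B \<in> null_sets M)"

definition countable_partition :: "'y measure \<Rightarrow> 'y set set \<Rightarrow> bool" where
  "countable_partition M P \<longleftrightarrow> countable P \<and> P \<subseteq> sets M \<and> partition_on (space M) P"

text \<open>All terms are nonnegative for a probability measure; the value may be \<open>\<infinity>\<close>.\<close>

definition shannon_entropy :: "'y measure \<Rightarrow> 'y set set \<Rightarrow> ennreal" where
  "shannon_entropy M P = (\<Sum>\<^sub>\<infinity>A\<in>P. ennreal (- (measure M A * ln (measure M A))))"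

definition rokhlin_entropy ::
  "('g, 'b) monoid_scheme \<Rightarrow> 'y measure \<Rightarrow> ('g \<Rightarrow> 'y \<Rightarrow> 'y) \<Rightarrow> ennreal" where
  "rokhlin_entropy G M S =
     Inf {shannon_entropy M P | P. countable_partition M P \<and>
            subset_mod_null M (sets M) (generated_subalgebra G M S P)}"

definition outer_rokhlin_entropy ::
  "('g, 'b) monoid_scheme \<Rightarrow> 'y measure \<Rightarrow> ('g \<Rightarrow> 'y \<Rightarrow> 'y) \<Rightarrow> 'y set set \<Rightarrow> ennreal" where
  "outer_rokhlin_entropy G M S F =
     Inf {shannon_entropy M P | P. countable_partition M P \<and>
            subset_mod_null M F (generated_subalgebra G M S P)}"

text \<open>
  The outer Rokhlin Pinsker factor is determined only up to null sets, hence a predicate.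
\<close>

definition outer_rokhlin_pinsker ::
  "('g, 'b) monoid_scheme \<Rightarrow> 'y measure \<Rightarrow> ('g \<Rightarrow> 'y \<Rightarrow> 'y) \<Rightarrow> 'y set set \<Rightarrow> bool" where
  "outer_rokhlin_pinsker G M S F \<longleftrightarrow>
     invariant_subalgebra G M S F \<and> outer_rokhlin_entropy G M S F = 0 \<and>
     (\<forall>F'. invariant_subalgebra G M S F' \<and> outer_rokhlin_entropy G M S F' = 0 \<longrightarrow>
           subset_mod_null M F' F)"

text \<open>
  A probability measure on a standard Borel space is a point mass iff it takes only the
  values 0 and 1, so this says that the factor corresponding to \<open>F\<close> is a point mass.
\<close>

definition trivial_factor :: "'y measure \<Rightarrow> 'y set set \<Rightarrow> bool" where
  "trivial_factor M F \<longleftrightarrow> (\<forall>A\<in>F. emeasure M A = 0 \<or> emeasure M A = 1)"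

definition factor_measure :: "'y measure \<Rightarrow> 'y set set \<Rightarrow> 'y measure" where
  "factor_measure M F = measure_of (space M) F (emeasure M)"

lemma factor_measure:
  assumes "invariant_subalgebra G M S F"
  shows space_factor_measure: "space (factor_measure M F) = space M"
    and sets_factor_measure: "sets (factor_measure M F) = F"
    and emeasure_factor_measure: "A \<in> F \<Longrightarrow> emeasure (factor_measure M F) A = emeasure M A"
proof -
  interpret sigma_algebra "space M" F
    using assms by (simp add: invariant_subalgebra_def)
  have F: "F \<subseteq> sets M"
    using assms by (simp add: invariant_subalgebra_def)
  show "space (factor_measure M F) = space M"
    unfolding factor_measure_def by (simp add: space_measure_of_conv)
  show sets: "sets (factor_measure M F) = F"
    unfolding factor_measure_def by (simp add: space_closed sigma_sets_eq sets_measure_of)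
  have "countably_additive F (emeasure M)"
    using F by (auto simp: countably_additive_def intro!: suminf_emeasure)
  then show "emeasure (factor_measure M F) A = emeasure M A" if "A \<in> F"
    using that sets unfolding factor_measure_def
    by (intro emeasure_measure_of_sigma) (auto simp: positive_def sigma_algebra_axioms)
qed

definition completely_positive_rokhlin_entropy ::
  "('g, 'b) monoid_scheme \<Rightarrow> 'y measure \<Rightarrow> ('g \<Rightarrow> 'y \<Rightarrow> 'y) \<Rightarrow> bool" where
  "completely_positive_rokhlin_entropy G M S \<longleftrightarrow>
     (\<forall>F. invariant_subalgebra G M S F \<and> \<not> trivial_factor M F \<longrightarrow>
          0 < rokhlin_entropy G (factor_measure M F) S)"


section \<open>The system\<close>

definition Gam :: "nat \<Rightarrow> nat \<Rightarrow> nat word set monoid" where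
  "Gam d k = presented_group {1..d} {replicate k (i, True) | i. i \<in> {1..d}}"

definition gen :: "nat \<Rightarrow> nat \<Rightarrow> nat \<Rightarrow> nat word set" where
  "gen d k i = pres_rel {1..d} {replicate k (i, True) | i. i \<in> {1..d}} `` {[(i, True)]}"

text \<open>
  Functions on the group are extensional: they are \<open>undefined\<close> off the carrier.
\<close>

definition Xset :: "nat \<Rightarrow> nat \<Rightarrow> (nat word set \<Rightarrow> bit) set" where
  "Xset d k = {x \<in> carrier (Gam d k) \<rightarrow>\<^sub>E UNIV. \<forall>g\<in>carrier (Gam d k). \<forall>i\<in>{1..d}.
     (\<Sum>j=0..k-1. x (g \<otimes>\<^bsub>Gam d k\<^esub> (gen d k i [^]\<^bsub>Gam d k\<^esub> j))) = 0}"

definition shift_action ::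
  "nat \<Rightarrow> nat \<Rightarrow> nat word set \<Rightarrow> (nat word set \<Rightarrow> bit) \<Rightarrow> (nat word set \<Rightarrow> bit)" where
  "shift_action d k g x = (\<lambda>h\<in>carrier (Gam d k). x (inv\<^bsub>Gam d k\<^esub> g \<otimes>\<^bsub>Gam d k\<^esub> h))"

text \<open>
  As the group is countable and \<open>bit\<close> is finite, the product \<open>\<sigma>\<close>-algebra is the Borel
  \<open>\<sigma>\<close>-algebra of the product topology.  Haar measure on the compact group \<open>Xset d k\<close> (under
  pointwise addition) is its unique translation-invariant Borel probability measure.
\<close>

definition haar_prob_measure :: "nat \<Rightarrow> nat \<Rightarrow> (nat word set \<Rightarrow> bit) measure \<Rightarrow> bool" where
  "haar_prob_measure d k m \<longleftrightarrow>
     prob_space m \<and>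
     sets m = sets (restrict_space (Pi\<^sub>M (carrier (Gam d k)) (\<lambda>_. count_space UNIV)) (Xset d k)) \<and>
     (\<forall>y\<in>Xset d k. distr m m (\<lambda>x. \<lambda>g\<in>carrier (Gam d k). y g + x g) = m)"

end

theory Submission
  imports
    Defs
    "HOL-Real_Asymp.Real_Asymp"
begin

text \<open>
  The system is a fixed code on the Cayley hypertree of \<open>\<Gamma>\<close>, with \<open>d < k\<close> parity checks of size
  \<open>k\<close> through every vertex.  The proof is a Shannon entropy count on a finite sofic model carrying
  almost all parity checks, on which distant windows are exactly independent.

  The model is \<open>V0 \<times> (\<int>/L)\<^bsup>V0 \<times> I\<^esup>\<close>, where \<open>V0\<close> is a finite \<open>\<Gamma>\<close>-set of large girth and the
  second component carries one counter for each incidence of a vertex of \<open>V0\<close> with a hyperedge: the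
  points of a hyperedge of the model share a base, and the point over the vertex \<open>v\<close> has the
  counter of \<open>v\<close> increased by one.  If \<open>U \<subseteq> V0\<close> is a union of separated balls, then a hyperedge
  not inside \<open>U\<close> has at least \<open>k - 1 \<ge> d\<close> vertices outside \<open>U\<close>, so Hall's theorem yields an
  injective choice of a vertex outside \<open>U\<close> on each such hyperedge.  The sum of the counters
  at the chosen incidences is a height function that makes the parity checks a triangular system with
  the chosen vertices as pivots; only the checks whose counters wrap around have to be dropped.  Hence
  any pattern on \<open>U\<close> that is locally in the code extends to the model, and a uniformly random
  codeword has independent restrictions to separated balls, each with the law given by Haar measure.

  Let \<open>0 < m A < 1\<close> and approximate \<open>A\<close> by a cylinder event \<open>F\<close> of radius \<open>r\<close>.  On a separated set
  of positive density \<open>c(r)\<close> the values of \<open>F\<close> are independent, so they carry entropy at least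
  \<open>c(r)\<close> times a positive constant per vertex.  If \<open>A\<close> is measurable with respect to the
  \<open>\<sigma>\<close>-algebra generated by \<open>P\<close>, these values are a function of the local \<open>P\<close>-pattern, whose entropy
  is about \<open>H(P)\<close> per vertex, and of the errors, whose entropy is negligible compared to the
  constant.  As \<open>r\<close> depends on \<open>A\<close> only, \<open>H(P)\<close> is bounded below uniformly in \<open>P\<close>.
\<close>

section \<open>Normal forms in the free product\<close>

locale cyclic_product =
  fixes d k :: nat
  assumes d_ge: "3 \<le> d" and d_less_k: "d < k"
begin

abbreviation "G \<equiv> Gam d k"
abbreviation "s \<equiv> gen d k"
definition "I = {1..d}"
definition "relators = {replicate k (i, True) | i. i \<in> {1..d}}"
definition "cls w = pres_rel I relators `` {w}"

lemma k_gt: "3 < k" using d_ge d_less_k by simp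

sublocale group G
  unfolding Gam_def by (rule group_presented_group)

lemma carrier_G: "carrier G = words I // pres_rel I relators"
  by (simp add: Gam_def presented_group_def I_def relators_def)

lemma one_G: "\<one>\<^bsub>G\<^esub> = cls []"
  by (simp add: Gam_def presented_group_def I_def relators_def cls_def)

lemma cls_carrier [simp]: "w \<in> words I \<Longrightarrow> cls w \<in> carrier G"
  by (simp add: carrier_G cls_def quotientI)

lemma carrierE:
  assumes "g \<in> carrier G"
  obtains w where "w \<in> words I" "g = cls w"
  using assms by (auto simp: carrier_G cls_def elim: quotientE)

lemma cls_mult: "u \<in> words I \<Longrightarrow> v \<in> words I \<Longrightarrow> cls u \<otimes>\<^bsub>G\<^esub> cls v = cls (u @ v)"
  unfolding Gam_def cls_def I_def relators_def by (rule presented_group_mult)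

lemma cls_eqI: "(u, v) \<in> pres_rel I relators \<Longrightarrow> cls u = cls v"
  unfolding cls_def by (rule equiv_class_eq[OF equiv_pres_rel])

lemma gen_cls: "s i = cls [(i, True)]"
  by (simp add: gen_def cls_def I_def relators_def)

lemma gen_carrier [simp]: "i \<in> I \<Longrightarrow> s i \<in> carrier G"
  by (simp add: gen_cls)

lemma gen_pow: "i \<in> I \<Longrightarrow> s i [^]\<^bsub>G\<^esub> (n::nat) = cls (replicate n (i, True))"
proof (induction n)
  case (Suc n)
  have "replicate n (i, True) \<in> words I" using Suc.prems by (auto simp: words_def)
  then show ?case using Suc
    by (simp add: gen_cls cls_mult del: replicate_Suc add: replicate_append_same flip: replicate_Suc)
qed (simp add: one_G)

lemma gen_pow_k: "i \<in> I \<Longrightarrow> s i [^]\<^bsub>G\<^esub> k = \<one>\<^bsub>G\<^esub>"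
proof -
  assume i: "i \<in> I"
  have "replicate k (i, True) \<in> words I" using i by (auto simp: words_def)
  then have "([] @ replicate k (i, True) @ [], [] @ []) \<in> pres_rel I relators"
    using i by (intro pres_rel.relator) (auto simp: relators_def I_def)
  then show ?thesis using cls_eqI i by (simp add: gen_pow one_G)
qed

lemma gen_inv: "i \<in> I \<Longrightarrow> cls [(i, False)] = s i [^]\<^bsub>G\<^esub> (k - 1)"
proof -
  assume i: "i \<in> I"
  have "([] @ [(i, True), (i, \<not> True)] @ [], [] @ []) \<in> pres_rel I relators"
    using i by (intro pres_rel.cancel) auto
  then have 1: "s i \<otimes>\<^bsub>G\<^esub> cls [(i, False)] = \<one>\<^bsub>G\<^esub>"
    using i cls_eqI by (simp add: gen_cls cls_mult one_G)
  have "s i \<otimes>\<^bsub>G\<^esub> s i [^]\<^bsub>G\<^esub> (k - 1) = s i [^]\<^bsub>G\<^esub> (Suc (k - 1))"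
    using i by (simp only: nat_pow_Suc2 gen_carrier)
  also have "\<dots> = \<one>\<^bsub>G\<^esub>" using i k_gt gen_pow_k by simp
  finally have 2: "s i \<otimes>\<^bsub>G\<^esub> s i [^]\<^bsub>G\<^esub> (k - 1) = \<one>\<^bsub>G\<^esub>" .
  show ?thesis
    using 1 2 i Units_l_cancel[of "s i" "cls [(i, False)]" "s i [^]\<^bsub>G\<^esub> (k - 1)"] by (simp add: Units_eq)
qed

text \<open>The inverse of a generator is its power \<open>k - 1\<close>, so right multiplications
  by generators alone reach every element. An inverse letter is handled by \<open>k - 1\<close> such
  steps.\<close>

lemma group_induct [consumes 1, case_names one step]:
  assumes "g \<in> carrier G" "P \<one>\<^bsub>G\<^esub>"
    and step: "\<And>g i. g \<in> carrier G \<Longrightarrow> i \<in> I \<Longrightarrow> P g \<Longrightarrow> P (g \<otimes>\<^bsub>G\<^esub> s i)"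
  shows "P g"
proof -
  have pow: "P (g \<otimes>\<^bsub>G\<^esub> s i [^]\<^bsub>G\<^esub> n)" if "g \<in> carrier G" "i \<in> I" "P g" for g i and n :: nat
  proof (induction n)
    case (Suc n)
    then show ?case using step[of "g \<otimes>\<^bsub>G\<^esub> s i [^]\<^bsub>G\<^esub> n" i] that by (simp add: m_assoc)
  qed (use that in simp)
  obtain w where w: "w \<in> words I" "g = cls w" using assms(1) by (rule carrierE)
  have "P (cls w)" using w(1)
  proof (induction w rule: rev_induct)
    case (snoc x w)
    obtain i b where x: "x = (i, b)" by fastforce
    have i: "i \<in> I" and w: "w \<in> words I" using snoc.prems x by auto
    have eq: "cls (w @ [x]) = cls w \<otimes>\<^bsub>G\<^esub> cls [x]" using i w x by (simp add: cls_mult)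
    show ?case
    proof (cases b)
      case True
      then show ?thesis using step[OF _ i, of "cls w"] snoc.IH w x eq by (simp add: gen_cls)
    next
      case False
      then show ?thesis using pow[OF _ i, of "cls w" "k - 1"] snoc.IH w x eq i gen_inv by simp
    qed
  qed (use assms(2) one_G in simp)
  then show ?thesis using w by simp
qed

section \<open>Actions of \<Gamma> given on its generators\<close>

text \<open>By the presentation, an action of \<Gamma> on \<open>V\<close> amounts to one map per
  generator whose \<open>k\<close>-th power is the identity; nothing is required off
  \<open>V\<close>.\<close>

definition is_act :: "(nat \<Rightarrow> 'v \<Rightarrow> 'v) \<Rightarrow> 'v set \<Rightarrow> bool" where
  "is_act p V \<longleftrightarrow> (\<forall>i\<in>I. \<forall>v\<in>V. p i v \<in> V \<and> (p i ^^ k) v = v)"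

text \<open>Inverse letters act by the power \<open>k - 1\<close>, so no inverse map has to be
  chosen. Letters are applied from left to right, which makes this a right action.\<close>

definition wact :: "(nat \<Rightarrow> 'v \<Rightarrow> 'v) \<Rightarrow> nat word \<Rightarrow> 'v \<Rightarrow> 'v" where
  "wact p w v = fold (\<lambda>(i, b). if b then p i else p i ^^ (k - 1)) w v"

definition gact :: "(nat \<Rightarrow> 'v \<Rightarrow> 'v) \<Rightarrow> nat word set \<Rightarrow> 'v \<Rightarrow> 'v" where
  "gact p g v = wact p (SOME w. w \<in> g) v"

lemma is_actD: "is_act p V \<Longrightarrow> i \<in> I \<Longrightarrow> v \<in> V \<Longrightarrow> p i v \<in> V"
  "is_act p V \<Longrightarrow> i \<in> I \<Longrightarrow> v \<in> V \<Longrightarrow> (p i ^^ k) v = v"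
  by (auto simp: is_act_def)

lemma is_act_pow: "is_act p V \<Longrightarrow> i \<in> I \<Longrightarrow> v \<in> V \<Longrightarrow> (p i ^^ n) v \<in> V"
  by (induction n) (auto simp: is_act_def)

lemma wact_append: "wact p (u @ w) v = wact p w (wact p u v)"
  by (simp add: wact_def)

lemma wact_closed: "is_act p V \<Longrightarrow> w \<in> words I \<Longrightarrow> v \<in> V \<Longrightarrow> wact p w v \<in> V"
proof (induction w arbitrary: v)
  case (Cons x w)
  then show ?case by (cases x) (auto simp: wact_def is_actD is_act_pow)
qed (simp add: wact_def)

text \<open>The universal property of the presentation: a cancelling pair and a relator both amount
  to \<open>k\<close> applications of one generator map. This makes the choice of a word in
  \<open>gact\<close> harmless.\<close>

lemma wact_pres_rel:
  assumes "is_act p V" "(u, w) \<in> pres_rel I relators"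
  shows "\<forall>v\<in>V. wact p u v = wact p w v"
  using assms(2)
proof (induction rule: pres_rel.induct)
  case (cancel u w a b)
  have "wact p [(a, b), (a, \<not> b)] v = v" if "v \<in> V" for v
  proof -
    have "(p a ^^ Suc (k - 1)) v = v" using assms(1) cancel(3) that k_gt by (simp add: is_actD)
    then show ?thesis by (cases b) (simp_all add: wact_def funpow_swap1)
  qed
  then show ?case using wact_closed[OF assms(1) cancel(1)] by (metis wact_append)
next
  case (relator u w r)
  then obtain i where r: "r = replicate k (i, True)" "i \<in> I" by (auto simp: relators_def I_def)
  have rep: "wact p (replicate n (i, True)) v = (p i ^^ n) v" for n v
    by (induction n arbitrary: v) (simp_all add: wact_def funpow_swap1)
  have "wact p r v = v" if "v \<in> V" for v
    using r that assms(1) by (simp add: rep is_actD)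
  then show ?case using wact_closed[OF assms(1) relator(1)] by (metis wact_append)
qed auto

lemma gact_cls:
  assumes "is_act p V" "w \<in> words I" "v \<in> V"
  shows "gact p (cls w) v = wact p w v"
proof -
  have "w \<in> cls w" using assms by (auto simp: cls_def intro: pres_rel.refl)
  then have "(SOME u. u \<in> cls w) \<in> cls w" by (rule someI)
  then show ?thesis using wact_pres_rel[OF assms(1)] assms(3) by (auto simp: gact_def cls_def)
qed

context
  fixes p :: "nat \<Rightarrow> 'v \<Rightarrow> 'v" and V :: "'v set"
  assumes act: "is_act p V"
begin

lemma gact_closed: "g \<in> carrier G \<Longrightarrow> v \<in> V \<Longrightarrow> gact p g v \<in> V"
  by (auto elim!: carrierE simp: gact_cls[OF act] wact_closed[OF act])

lemma gact_one: "v \<in> V \<Longrightarrow> gact p \<one>\<^bsub>G\<^esub> v = v"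
  by (simp add: one_G gact_cls[OF act]) (simp add: wact_def)

lemma gact_gen: "v \<in> V \<Longrightarrow> i \<in> I \<Longrightarrow> gact p (s i) v = p i v"
  by (simp add: gen_cls gact_cls[OF act]) (simp add: wact_def)

lemma gact_mult:
  "g \<in> carrier G \<Longrightarrow> h \<in> carrier G \<Longrightarrow> v \<in> V \<Longrightarrow> gact p (g \<otimes>\<^bsub>G\<^esub> h) v = gact p h (gact p g v)"
  by (auto elim!: carrierE simp: cls_mult gact_cls[OF act] wact_closed[OF act] wact_append)

lemma gact_pow: "v \<in> V \<Longrightarrow> i \<in> I \<Longrightarrow> gact p (s i [^]\<^bsub>G\<^esub> (n::nat)) v = (p i ^^ n) v"
  by (induction n) (simp_all add: gact_one gact_mult gact_gen is_act_pow[OF act])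

lemma gact_inv: "g \<in> carrier G \<Longrightarrow> v \<in> V \<Longrightarrow> gact p (inv\<^bsub>G\<^esub> g) (gact p g v) = v"
  "g \<in> carrier G \<Longrightarrow> v \<in> V \<Longrightarrow> gact p g (gact p (inv\<^bsub>G\<^esub> g) v) = v"
  using gact_mult[of g "inv\<^bsub>G\<^esub> g" v] gact_mult[of "inv\<^bsub>G\<^esub> g" g v]
  by (simp_all add: gact_one)

lemma gact_bij: "g \<in> carrier G \<Longrightarrow> bij_betw (gact p g) V V"
  by (rule bij_betwI[where g = "gact p (inv\<^bsub>G\<^esub> g)"]) (auto simp: gact_closed gact_inv)

end

text \<open>Reduced words are stored with the last syllable at the head, so right multiplication
  by a generator acts at the head.\<close>

fun step :: "nat \<Rightarrow> (nat \<times> nat) list \<Rightarrow> (nat \<times> nat) list" where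
  "step i [] = [(i, 1)]"
| "step i ((i', j) # u) =
    (if i' = i then (if Suc j < k then (i, Suc j) # u else u) else (i, 1) # (i', j) # u)"

fun reduced :: "(nat \<times> nat) list \<Rightarrow> bool" where
  "reduced [] \<longleftrightarrow> True"
| "reduced ((i, j) # u) \<longleftrightarrow> i \<in> I \<and> 0 < j \<and> j < k \<and> (u = [] \<or> fst (hd u) \<noteq> i) \<and> reduced u"

abbreviation "RW \<equiv> {w. reduced w}"
abbreviation "fresh i u \<equiv> u = [] \<or> fst (hd u) \<noteq> i"

lemma step_fresh: "fresh i u \<Longrightarrow> step i u = (i, 1) # u"
  by (cases u) auto

lemma reduced_cases:
  assumes "reduced w" "i \<in> I"
  obtains u a where "reduced u" "fresh i u" "a < k" "w = (if a = 0 then u else (i, a) # u)"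
proof (cases "fresh i w")
  case True
  then show ?thesis using that[of w 0] assms k_gt by simp
next
  case False
  then obtain j u where "w = (i, j) # u" by (cases w) auto
  then show ?thesis using that[of u j] assms by simp
qed

lemma step_pow_fresh:
  assumes "fresh i u" "a < k"
  shows "(step i ^^ a) u = (if a = 0 then u else (i, a) # u)"
  using assms(2)
proof (induction a)
  case (Suc a)
  then show ?case using assms(1) by (auto simp: step_fresh)
qed simp

lemma step_pow_k_fresh:
  assumes "fresh i u"
  shows "(step i ^^ k) u = u"
proof -
  have "(step i ^^ Suc (k - 1)) u = step i ((step i ^^ (k - 1)) u)" by (simp only: funpow.simps comp_apply)
  also have "\<dots> = u" using step_pow_fresh[OF assms, of "k - 1"] k_gt by simp
  finally have "(step i ^^ Suc (k - 1)) u = u" .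
  moreover have "Suc (k - 1) = k" using k_gt by simp
  ultimately show ?thesis by simp
qed

text \<open>The orbit of a word under \<open>step i\<close> is a cycle of length \<open>k\<close>
  through a word \<open>u\<close> whose last syllable is not of type \<open>i\<close>: the exponent
  runs from 1 to \<open>k - 1\<close> and then the syllable vanishes.\<close>

lemma step_act: "is_act step RW"
  unfolding is_act_def
proof (intro ballI conjI)
  fix i w assume i: "i \<in> I" and w: "w \<in> RW"
  then obtain u a where u: "reduced u" "fresh i u" "a < k" "w = (if a = 0 then u else (i, a) # u)"
    using reduced_cases by blast
  show "step i w \<in> RW" using u i k_gt by (auto simp: step_fresh)
  have "(step i ^^ k) ((step i ^^ a) u) = (step i ^^ a) ((step i ^^ k) u)"
    by (simp flip: funpow_add comp_apply[of "step i ^^ _"] add: add.commute)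
  then show "(step i ^^ k) w = w" using step_pow_fresh[OF u(2,3)] step_pow_k_fresh[OF u(2)] u(4) by simp
qed

text \<open>Van der Waerden's device: \<Gamma> acts on reduced words, and the orbit of the empty
  word yields normal forms. Their uniqueness needs no confluence argument.\<close>

definition nf :: "nat word set \<Rightarrow> (nat \<times> nat) list" where
  "nf g = gact step g []"

primrec word_prod :: "(nat \<times> nat) list \<Rightarrow> nat word set" where
  "word_prod [] = \<one>\<^bsub>G\<^esub>"
| "word_prod (x # u) = word_prod u \<otimes>\<^bsub>G\<^esub> s (fst x) [^]\<^bsub>G\<^esub> snd x"

lemma word_prod_carrier [simp]: "reduced w \<Longrightarrow> word_prod w \<in> carrier G"
  by (induction w rule: reduced.induct) auto

lemma word_prod_step: "reduced w \<Longrightarrow> i \<in> I \<Longrightarrow> word_prod (step i w) = word_prod w \<otimes>\<^bsub>G\<^esub> s i"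
proof -
  assume w: "reduced w" and i: "i \<in> I"
  obtain u a where u: "reduced u" "fresh i u" "a < k" "w = (if a = 0 then u else (i, a) # u)"
    using reduced_cases[OF w i] by blast
  show ?thesis
  proof (cases "Suc a < k")
    case True
    then show ?thesis using u i by (auto simp: step_fresh m_assoc)
  next
    case False
    \<comment> \<open>The last syllable has exponent \<open>k - 1\<close>, so \<open>step\<close>
      deletes it; on the group side this is the relation \<open>gen_pow_k\<close>.\<close>
    then have a: "k = Suc a" using u by simp
    have "s i [^]\<^bsub>G\<^esub> a \<otimes>\<^bsub>G\<^esub> s i = s i [^]\<^bsub>G\<^esub> Suc a" by simp
    then have "s i [^]\<^bsub>G\<^esub> a \<otimes>\<^bsub>G\<^esub> s i = \<one>\<^bsub>G\<^esub>" using gen_pow_k[OF i] a by metis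
    moreover have "w = (i, a) # u" using u(4) a k_gt by simp
    ultimately show ?thesis using u(1-3) i False by (simp add: m_assoc)
  qed
qed

lemma nf_reduced [simp]: "g \<in> carrier G \<Longrightarrow> reduced (nf g)"
  using gact_closed[OF step_act, of g "[]"] by (simp add: nf_def)

lemma nf_one [simp]: "nf \<one>\<^bsub>G\<^esub> = []"
  by (simp add: nf_def gact_one[OF step_act])

lemma nf_mult_gen: "g \<in> carrier G \<Longrightarrow> i \<in> I \<Longrightarrow> nf (g \<otimes>\<^bsub>G\<^esub> s i) = step i (nf g)"
  using gact_closed[OF step_act, of g "[]"]
  by (simp add: nf_def gact_mult[OF step_act] gact_gen[OF step_act])

lemma nf_mult_pow:
  "g \<in> carrier G \<Longrightarrow> i \<in> I \<Longrightarrow> nf (g \<otimes>\<^bsub>G\<^esub> s i [^]\<^bsub>G\<^esub> (n::nat)) = (step i ^^ n) (nf g)"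
  using gact_closed[OF step_act, of g "[]"]
  by (simp add: nf_def gact_mult[OF step_act] gact_pow[OF step_act])

lemma word_prod_nf [simp]: "g \<in> carrier G \<Longrightarrow> word_prod (nf g) = g"
  by (induction rule: group_induct) (simp_all add: nf_mult_gen word_prod_step)

lemma nf_word_prod [simp]: "reduced w \<Longrightarrow> nf (word_prod w) = w"
proof (induction w rule: reduced.induct)
  case (2 i j u)
  then show ?case by (simp add: nf_mult_pow step_pow_fresh)
qed simp

lemma nf_inj: "g \<in> carrier G \<Longrightarrow> h \<in> carrier G \<Longrightarrow> nf g = nf h \<Longrightarrow> g = h"
  by (metis word_prod_nf)

section \<open>Balls and hyperedges in the Cayley hypertree\<close>

text \<open>Length counts syllables, not letters: it is the distance in the hypertree, where all
  points of a coset of the cyclic group generated by \<open>s i\<close> are mutual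
  neighbours.\<close>

definition ball :: "nat \<Rightarrow> nat word set set" where
  "ball r = {g \<in> carrier G. length (nf g) \<le> r}"

lemma ball_carrier: "g \<in> ball r \<Longrightarrow> g \<in> carrier G"
  by (simp add: ball_def)

lemma ball_mono: "r \<le> r' \<Longrightarrow> ball r \<subseteq> ball r'"
  by (auto simp: ball_def)

lemma one_ball [simp]: "\<one>\<^bsub>G\<^esub> \<in> ball r"
  by (simp add: ball_def)

lemma finite_ball: "finite (ball r)"
proof (rule finite_imageD)
  have "set w \<subseteq> I \<times> {..<k}" if "reduced w" for w
    using that by (induction w rule: reduced.induct) auto
  from this[OF nf_reduced] have "nf ` ball r \<subseteq> {w. set w \<subseteq> I \<times> {..<k} \<and> length w \<le> r}"
    by (auto simp: ball_def)
  then show "finite (nf ` ball r)"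
    by (rule finite_subset) (simp add: finite_lists_length_le I_def)
  show "inj_on nf (ball r)"
    unfolding inj_on_def ball_def using nf_inj by blast
qed

lemma finite_subset_ball:
  assumes "finite A" "A \<subseteq> carrier G"
  obtains r where "A \<subseteq> ball r"
proof -
  have "A \<subseteq> ball (Max ((\<lambda>g. length (nf g)) ` A))"
    using assms by (auto simp: ball_def)
  then show ?thesis by (rule that)
qed

text \<open>The base \<open>h\<close> is the point of the hyperedge nearest to the identity; by
  \<open>nf_coset\<close> the other \<open>k - 1\<close> points are exactly one syllable
  longer.\<close>

lemma coset_base:
  assumes "g \<in> carrier G" "i \<in> I"
  obtains h a where "h \<in> carrier G" "a < k" "g = h \<otimes>\<^bsub>G\<^esub> s i [^]\<^bsub>G\<^esub> (a::nat)" "fresh i (nf h)"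
proof -
  obtain u a where u: "reduced u" "fresh i u" "a < k" "nf g = (if a = 0 then u else (i, a) # u)"
    using reduced_cases[of "nf g" i] assms by auto
  have "word_prod (nf g) = word_prod u \<otimes>\<^bsub>G\<^esub> s i [^]\<^bsub>G\<^esub> a" using u assms by (auto simp: u(4))
  then have "g = word_prod u \<otimes>\<^bsub>G\<^esub> s i [^]\<^bsub>G\<^esub> a" using assms by simp
  then show ?thesis using that[of "word_prod u" a] u by simp
qed

lemma gen_pow_mod: "i \<in> I \<Longrightarrow> s i [^]\<^bsub>G\<^esub> (n mod k) = s i [^]\<^bsub>G\<^esub> n"
proof -
  assume i: "i \<in> I"
  have "s i [^]\<^bsub>G\<^esub> n = s i [^]\<^bsub>G\<^esub> (k * (n div k) + n mod k)" by simp
  also have "\<dots> = (s i [^]\<^bsub>G\<^esub> k) [^]\<^bsub>G\<^esub> (n div k) \<otimes>\<^bsub>G\<^esub> s i [^]\<^bsub>G\<^esub> (n mod k)"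
    using i by (simp only: nat_pow_mult[symmetric] nat_pow_pow gen_carrier)
  finally show ?thesis using i by (simp add: gen_pow_k)
qed

lemma coset_shift:
  assumes "h \<in> carrier G" "i \<in> I"
  shows "h \<otimes>\<^bsub>G\<^esub> s i [^]\<^bsub>G\<^esub> (a::nat) \<otimes>\<^bsub>G\<^esub> s i [^]\<^bsub>G\<^esub> (j::nat) = h \<otimes>\<^bsub>G\<^esub> s i [^]\<^bsub>G\<^esub> ((a + j) mod k)"
  using assms by (simp add: m_assoc nat_pow_mult gen_pow_mod)

lemma nf_coset:
  assumes "h \<in> carrier G" "i \<in> I" "fresh i (nf h)" "j < k"
  shows "nf (h \<otimes>\<^bsub>G\<^esub> s i [^]\<^bsub>G\<^esub> j) = (if j = 0 then nf h else (i, j) # nf h)"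
  using assms by (simp only: nf_mult_pow step_pow_fresh)

lemma coset_inj:
  assumes "g \<in> carrier G" "i \<in> I" "j < k" "l < k"
    and "g \<otimes>\<^bsub>G\<^esub> s i [^]\<^bsub>G\<^esub> j = g \<otimes>\<^bsub>G\<^esub> s i [^]\<^bsub>G\<^esub> l"
  shows "j = l"
proof -
  have "s i [^]\<^bsub>G\<^esub> j = s i [^]\<^bsub>G\<^esub> l" using assms by simp
  moreover have "nf (s i [^]\<^bsub>G\<^esub> b) = (if b = 0 then [] else [(i, b)])" if "b < k" for b :: nat
    using nf_coset[of "\<one>\<^bsub>G\<^esub>" i b] that assms by simp
  ultimately show ?thesis using assms by (metis list.inject prod.inject list.distinct(1))
qed

text \<open>Of two distinct points of a hyperedge at least one is not the base, so it has the
  maximal length on the hyperedge. Hence a ball contains at most one point of a hyperedge or all of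
  it.\<close>

lemma coset_in_ball:
  assumes "g \<in> ball r" "i \<in> I" "g \<otimes>\<^bsub>G\<^esub> s i [^]\<^bsub>G\<^esub> j \<in> ball r" "0 < j" "j < k"
  shows "g \<otimes>\<^bsub>G\<^esub> s i [^]\<^bsub>G\<^esub> (l::nat) \<in> ball r"
proof -
  obtain h a where h: "h \<in> carrier G" "a < k" "g = h \<otimes>\<^bsub>G\<^esub> s i [^]\<^bsub>G\<^esub> (a::nat)" "fresh i (nf h)"
    using coset_base[of g i] assms by (auto simp: ball_def)
  have len: "length (nf (h \<otimes>\<^bsub>G\<^esub> s i [^]\<^bsub>G\<^esub> b)) = (if b = 0 then length (nf h) else Suc (length (nf h)))" if "b < k" for b :: nat
    using nf_coset[OF h(1) assms(2) h(4) that] by simp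
  have neq: "(a + j) mod k \<noteq> 0 \<or> a \<noteq> 0"
    using assms(4,5) by auto
  have "Suc (length (nf h)) \<le> r"
    using assms(1,3) neq len[of a] len[of "(a + j) mod k"] h k_gt
    by (auto simp: h(3) coset_shift assms(2) ball_def split: if_splits)
  then show ?thesis
    using len[of "(a + l) mod k"] h k_gt assms(2)
    by (auto simp: h(3) coset_shift ball_def split: if_splits)
qed

lemma coset_in_ball_Suc:
  assumes "g \<in> ball r" "i \<in> I"
  shows "g \<otimes>\<^bsub>G\<^esub> s i [^]\<^bsub>G\<^esub> (l::nat) \<in> ball (Suc r)"
proof -
  obtain h a where h: "h \<in> carrier G" "a < k" "g = h \<otimes>\<^bsub>G\<^esub> s i [^]\<^bsub>G\<^esub> (a::nat)" "fresh i (nf h)"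
    using coset_base[of g i] assms by (auto simp: ball_def)
  show ?thesis
    using nf_coset[OF h(1) assms(2) h(4) h(2)] nf_coset[OF h(1) assms(2) h(4), of "(a + l) mod k"] assms h k_gt
    by (auto simp: h(3) coset_shift ball_def split: if_splits)
qed

lemma sum_periodic:
  fixes F :: "nat \<Rightarrow> 'a :: comm_monoid_add"
  shows "(\<Sum>j<k. F ((a + j) mod k)) = (\<Sum>j<k. F j)"
proof (rule sum.reindex_bij_betw)
  have inj: "inj_on (\<lambda>j. (a + j) mod k) {..<k}"
  proof (rule inj_onI)
    fix x y assume xy: "x \<in> {..<k}" "y \<in> {..<k}" and eq: "(a + x) mod k = (a + y) mod k"
    then have "x mod k = y mod k" 
      by (metis add_diff_cancel_left mod_eq_dvd_iff_nat nat_add_left_cancel_le nat_le_linear)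
    then show "x = y" using xy by simp
  qed
  have "(\<lambda>j. (a + j) mod k) ` {..<k} \<subseteq> {..<k}" using k_gt by auto
  then show "bij_betw (\<lambda>j. (a + j) mod k) {..<k} {..<k}"
    using inj by (simp add: bij_betw_def endo_inj_surj)
qed

lemma coset_sum:
  fixes F :: "nat word set \<Rightarrow> 'a :: comm_monoid_add"
  assumes "h \<in> carrier G" "i \<in> I"
  shows "(\<Sum>j<k. F (h \<otimes>\<^bsub>G\<^esub> s i [^]\<^bsub>G\<^esub> (a::nat) \<otimes>\<^bsub>G\<^esub> s i [^]\<^bsub>G\<^esub> j)) = (\<Sum>j<k. F (h \<otimes>\<^bsub>G\<^esub> s i [^]\<^bsub>G\<^esub> j))"
  using sum_periodic[of "\<lambda>j. F (h \<otimes>\<^bsub>G\<^esub> s i [^]\<^bsub>G\<^esub> j)" a] assms by (simp add: coset_shift)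

section \<open>Locally admissible patterns and their extension\<close>

text \<open>Only hyperedges lying entirely inside the ball are tested. By
  \<open>restrict_Xset\<close> and \<open>balls_code_extend\<close> these are exactly the patterns
  that points of \<open>Xset d k\<close> show on the ball.\<close>

definition balls_code :: "nat \<Rightarrow> (nat word set \<Rightarrow> bit) set" where
  "balls_code r = {a \<in> ball r \<rightarrow>\<^sub>E UNIV. \<forall>g\<in>ball r. \<forall>i\<in>I.
     (\<forall>j<k. g \<otimes>\<^bsub>G\<^esub> s i [^]\<^bsub>G\<^esub> j \<in> ball r) \<longrightarrow> (\<Sum>j<k. a (g \<otimes>\<^bsub>G\<^esub> s i [^]\<^bsub>G\<^esub> j)) = 0}"

lemma Xset_alt:
  "Xset d k = {x \<in> carrier G \<rightarrow>\<^sub>E UNIV. \<forall>g\<in>carrier G. \<forall>i\<in>I. (\<Sum>j<k. x (g \<otimes>\<^bsub>G\<^esub> s i [^]\<^bsub>G\<^esub> j)) = 0}"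
proof -
  have "{0..k-1} = {..<k}" using k_gt by auto
  then show ?thesis unfolding Xset_def I_def by simp
qed

lemma restrict_Xset:
  assumes "x \<in> Xset d k"
  shows "restrict x (ball r) \<in> balls_code r"
  using assms by (auto simp: balls_code_def Xset_alt ball_carrier)

context
  fixes a :: "nat word set \<Rightarrow> bit" and r :: nat
begin

primrec extend_word :: "(nat \<times> nat) list \<Rightarrow> bit" where
  "extend_word [] = a \<one>\<^bsub>G\<^esub>"
| "extend_word (y # u) =
    (if length u < r then a (word_prod (y # u)) else if snd y = 1 then extend_word u else 0)"

end

text \<open>In a hypertree the extension can proceed outwards: a hyperedge leaving the ball has only
  its base already determined. \<open>extend_word\<close> copies the base value to the point with
  exponent 1 and puts 0 on the remaining ones.\<close>

lemma balls_code_extend: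
  assumes a: "a \<in> balls_code r"
  obtains x where "x \<in> Xset d k" "restrict x (ball r) = a"
proof
  define x where "x = (\<lambda>g\<in>carrier G. extend_word a r (nf g))"
  have short: "extend_word a r w = a (word_prod w)" if "length w \<le> r" for w
    using that by (cases w) auto
  have "restrict x (ball r) g = a g" for g
    using a short by (cases "g \<in> ball r") (auto simp: x_def ball_def balls_code_def)
  then show "restrict x (ball r) = a" by blast
  have "(\<Sum>j<k. x (g \<otimes>\<^bsub>G\<^esub> s i [^]\<^bsub>G\<^esub> j)) = 0" if g: "g \<in> carrier G" and i: "i \<in> I" for g i
  proof -
    obtain h b where h: "h \<in> carrier G" "b < k" "g = h \<otimes>\<^bsub>G\<^esub> s i [^]\<^bsub>G\<^esub> (b::nat)" "fresh i (nf h)"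
      using coset_base[OF g i] by blast
    let ?u = "nf h"
    have "(\<Sum>j<k. x (g \<otimes>\<^bsub>G\<^esub> s i [^]\<^bsub>G\<^esub> j)) = (\<Sum>j<k. x (h \<otimes>\<^bsub>G\<^esub> s i [^]\<^bsub>G\<^esub> j))"
      unfolding h(3) by (rule coset_sum[OF h(1) i])
    also have "\<dots> = 0"
    proof (cases "length ?u < r")
      case True
      have mem: "h \<otimes>\<^bsub>G\<^esub> s i [^]\<^bsub>G\<^esub> j \<in> ball r" if "j < k" for j
        using nf_coset[OF h(1) i h(4) that] True h(1) i by (auto simp: ball_def)
      have "(\<Sum>j<k. x (h \<otimes>\<^bsub>G\<^esub> s i [^]\<^bsub>G\<^esub> j)) = (\<Sum>j<k. a (h \<otimes>\<^bsub>G\<^esub> s i [^]\<^bsub>G\<^esub> j))"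
        using mem short by (intro sum.cong) (auto simp: x_def ball_def)
      moreover have "h \<in> ball r" using True h(1) by (simp add: ball_def)
      ultimately show ?thesis using a mem i by (auto simp: balls_code_def)
    next
      case False
      \<comment> \<open>Here the base lies at distance at least \<open>r\<close>; the two equal
        values at exponents 0 and 1 cancel in characteristic 2.\<close>
      have val: "x (h \<otimes>\<^bsub>G\<^esub> s i [^]\<^bsub>G\<^esub> j) = (if j \<le> 1 then extend_word a r ?u else 0)" if "j < k" for j
        using nf_coset[OF h(1) i h(4) that] False h(1) i by (auto simp: x_def)
      have "{..<k} = insert 0 (insert 1 {2..<k})" using k_gt by auto
      then have "(\<Sum>j<k. x (h \<otimes>\<^bsub>G\<^esub> s i [^]\<^bsub>G\<^esub> j)) =
         x (h \<otimes>\<^bsub>G\<^esub> s i [^]\<^bsub>G\<^esub> (0::nat)) + (x (h \<otimes>\<^bsub>G\<^esub> s i [^]\<^bsub>G\<^esub> (1::nat)) + (\<Sum>j=2..<k. x (h \<otimes>\<^bsub>G\<^esub> s i [^]\<^bsub>G\<^esub> j)))"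
        by simp
      also have "\<dots> = extend_word a r ?u + extend_word a r ?u"
        using val[of 0] val[of 1] val k_gt by simp
      finally show ?thesis by (metis add.right_neutral bit_2_eq_0 mult_2 mult_zero_left)
    qed
    finally show ?thesis .
  qed
  then show "x \<in> Xset d k" by (auto simp: Xset_alt x_def)
qed

end

section \<open>Finite actions that are free on a ball\<close>

context cyclic_product begin

text \<open>A hyperedge that would leave the tree truncated at \<open>R\<close> syllables is
  collapsed to a fixed point, which keeps every \<open>k\<close>-th power equal to the
  identity.\<close>

definition trunc_step :: "nat \<Rightarrow> nat \<Rightarrow> (nat \<times> nat) list \<Rightarrow> (nat \<times> nat) list" where
  "trunc_step R i w = (if length w = R \<and> fresh i w then w else step i w)"

definition trunc_words :: "nat \<Rightarrow> (nat \<times> nat) list set" where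
  "trunc_words R = {w. reduced w \<and> length w \<le> R}"

lemma finite_trunc_words: "finite (trunc_words R)"
proof -
  have "nf (word_prod w) \<in> nf ` ball R" if "w \<in> trunc_words R" for w
    using that by (intro imageI) (simp add: trunc_words_def ball_def)
  then have "trunc_words R \<subseteq> nf ` ball R" by (auto simp: trunc_words_def)
  then show ?thesis using finite_ball finite_subset by blast
qed

lemma trunc_step_pow:
  assumes "fresh i u" "length u < R"
  shows "(trunc_step R i ^^ n) u = (step i ^^ n) u"
proof -
  \<comment> \<open>\<open>C\<close> contains the hyperedge with base \<open>u\<close>; on it the
    truncation never takes effect, because \<open>u\<close> is too short and the other words end in
    a syllable of type \<open>i\<close>.\<close>
  define C where "C = insert u {(i, b) # u | b. True}"
  have C: "trunc_step R i x = step i x \<and> step i x \<in> C" if "x \<in> C" for x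
    using that assms by (auto simp: C_def trunc_step_def step_fresh)
  have "(trunc_step R i ^^ n) u = (step i ^^ n) u \<and> (step i ^^ n) u \<in> C"
    by (induction n) (use C in \<open>auto simp: C_def\<close>)
  then show ?thesis ..
qed

lemma trunc_step_act: "is_act (trunc_step R) (trunc_words R)"
  unfolding is_act_def
proof (intro ballI)
  fix i w assume i: "i \<in> I" and w: "w \<in> trunc_words R"
  show "trunc_step R i w \<in> trunc_words R \<and> (trunc_step R i ^^ k) w = w"
  proof (cases "length w = R \<and> fresh i w")
    case True
    then have "trunc_step R i w = w" by (simp add: trunc_step_def)
    moreover from this have "(trunc_step R i ^^ n) w = w" for n by (induction n) auto
    ultimately show ?thesis using w by simp
  next
    case False
    obtain u a where u: "reduced u" "fresh i u" "a < k" "w = (if a = 0 then u else (i, a) # u)"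
      using reduced_cases[OF _ i, of w] w unfolding trunc_words_def by blast
    have len: "length u < R" using u w False by (auto simp: trunc_words_def split: if_splits)
    have w': "w = (step i ^^ a) u" using u step_pow_fresh by metis
    have "(trunc_step R i ^^ k) w = (trunc_step R i ^^ (k + a)) u"
      by (simp add: w' trunc_step_pow[OF u(2) len] funpow_add flip: trunc_step_pow[OF u(2) len])
    also have "\<dots> = (step i ^^ (k + a)) u" by (rule trunc_step_pow[OF u(2) len])
    also have "\<dots> = (step i ^^ k) w" by (simp add: funpow_add w')
    also have "\<dots> = w" using is_actD(2)[OF step_act i] w by (simp add: trunc_words_def)
    finally have 1: "(trunc_step R i ^^ k) w = w" .
    have "step i w \<in> trunc_words R"
      using u len i k_gt by (auto simp: trunc_words_def step_fresh)
    moreover have "trunc_step R i w = step i w" using False unfolding trunc_step_def by (rule if_not_P)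
    ultimately show ?thesis using 1 by simp
  qed
qed

lemma gact_trunc_step:
  "reduced w \<Longrightarrow> length w \<le> R \<Longrightarrow> gact (trunc_step R) (word_prod w) [] = w"
proof (induction w rule: reduced.induct)
  case 1
  then show ?case using gact_one[OF trunc_step_act, of "[]" R] by (simp add: trunc_words_def)
next
  case (2 i j u)
  have Nil: "[] \<in> trunc_words R" and u: "u \<in> trunc_words R" using 2 by (auto simp: trunc_words_def)
  have "gact (trunc_step R) (word_prod ((i, j) # u)) [] = (trunc_step R i ^^ j) u"
    using 2 gact_mult[OF trunc_step_act _ _ Nil, of "word_prod u" "s i [^]\<^bsub>G\<^esub> j"]
      gact_pow[OF trunc_step_act u] by simp
  also have "\<dots> = (i, j) # u" using 2 by (simp add: trunc_step_pow step_pow_fresh)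
  finally show ?case .
qed

text \<open>On the truncated tree only the root is guaranteed an injective orbit map on the ball.  The
  action by composition on the self-surjections of the truncated tree has this property everywhere.\<close>

lemma free_model_exists:
  obtains V0 :: "((nat \<times> nat) list \<Rightarrow> (nat \<times> nat) list) set" and p
  where "finite V0" "V0 \<noteq> {}" "is_act p V0" "\<And>v. v \<in> V0 \<Longrightarrow> inj_on (\<lambda>g. gact p g v) (ball R)"
proof
  define B where "B = trunc_words R"
  define q where "q = trunc_step R"
  \<comment> \<open>Surjectivity is preserved by composition with \<open>q i\<close>, and it
    guarantees that every \<open>f\<close> takes the value \<open>[]\<close> somewhere.\<close>
  define V0 where "V0 = {f \<in> B \<rightarrow>\<^sub>E B. f ` B = B}"
  define p where "p i f = restrict (q i \<circ> f) B" for i and f :: "(nat \<times> nat) list \<Rightarrow> (nat \<times> nat) list"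
  have q: "is_act q B" unfolding q_def B_def by (rule trunc_step_act)
  have Nil: "[] \<in> B" by (simp add: B_def trunc_words_def)
  show "finite V0" unfolding V0_def B_def
    by (rule finite_subset[of _ "trunc_words R \<rightarrow>\<^sub>E trunc_words R"]) (auto intro: finite_PiE finite_trunc_words)
  have "restrict id B \<in> V0" by (auto simp: V0_def)
  then show "V0 \<noteq> {}" by blast
  have surj: "q i ` B = B" if "i \<in> I" for i
  proof -
    have "v \<in> q i ` B" if "v \<in> B" for v
    proof -
      have "Suc (k - 1) = k" using k_gt by simp
      then have "q i ((q i ^^ (k - 1)) v) = v"
        using is_actD(2)[OF q \<open>i \<in> I\<close> \<open>v \<in> B\<close>] by (metis comp_apply funpow.simps(2))
      then show ?thesis using is_act_pow[OF q \<open>i \<in> I\<close> \<open>v \<in> B\<close>] by (metis imageI)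
    qed
    then show ?thesis using is_actD(1)[OF q that] by auto
  qed
  have p_V0: "p i f \<in> V0" if "i \<in> I" "f \<in> V0" for i f
  proof -
    have "p i f ` B = q i ` (f ` B)" by (auto simp: p_def)
    then show ?thesis using that surj by (auto simp: V0_def p_def is_actD(1)[OF q])
  qed
  have p_pow: "(p i ^^ n) f = restrict ((q i ^^ n) \<circ> f) B" if "i \<in> I" "f \<in> V0" for i f n
  proof (induction n)
    case 0
    then show ?case using that by (auto simp: V0_def restrict_def extensional_def fun_eq_iff PiE_def)
  qed (auto simp: p_def fun_eq_iff)
  show act: "is_act p V0"
    unfolding is_act_def
  proof (intro ballI conjI)
    fix i f assume i: "i \<in> I" and f: "f \<in> V0"
    show "p i f \<in> V0" using i f by (rule p_V0)
    have "(q i ^^ k) (f w) = f w" if "w \<in> B" for w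
      using is_actD(2)[OF q i] that f by (auto simp: V0_def)
    then show "(p i ^^ k) f = f"
      using f unfolding p_pow[OF i f] by (auto simp: V0_def fun_eq_iff PiE_def extensional_def)
  qed
  have gact_p: "gact p g f w = gact q g (f w)" if "g \<in> carrier G" "f \<in> V0" "w \<in> B" for g f w
    using that(1)
  proof (induction rule: group_induct)
    case one
    have "f w \<in> B" using that by (auto simp: V0_def)
    then show ?case using gact_one[OF act that(2)] gact_one[OF q] by simp
  next
    case (step g i)
    have fw: "f w \<in> B" using that by (auto simp: V0_def)
    have "gact p (g \<otimes>\<^bsub>G\<^esub> s i) f w = p i (gact p g f) w"
      using step that by (simp add: gact_mult[OF act] gact_gen[OF act] gact_closed[OF act])
    also have "\<dots> = q i (gact p g f w)" using that by (simp add: p_def)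
    also have "\<dots> = gact q (g \<otimes>\<^bsub>G\<^esub> s i) (f w)"
      using step fw by (simp add: gact_mult[OF q] gact_gen[OF q] gact_closed[OF q])
    finally show ?case .
  qed
  show "inj_on (\<lambda>g. gact p g f) (ball R)" if "f \<in> V0" for f
  proof (rule inj_onI)
    fix g h assume gh: "g \<in> ball R" "h \<in> ball R" "gact p g f = gact p h f"
    \<comment> \<open>Evaluating at a preimage \<open>w\<close> of the root turns
      \<open>gact p g f\<close> into the normal form of \<open>g\<close>, which separates the
      elements of the ball.\<close>
    have "[] \<in> f ` B" using that Nil unfolding V0_def by blast
    then obtain w where w: "w \<in> B" "f w = []" by force
    have nf: "gact q g' [] = nf g'" if "g' \<in> ball R" for g'
      using gact_trunc_step[of "nf g'" R] that by (simp add: q_def ball_def)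
    have "gact q g [] = gact q h []"
      using gh gact_p[OF ball_carrier that w(1)] w(2) by metis
    then show "g = h" using nf gh nf_inj ball_carrier by metis
  qed
qed

end

section \<open>Hall matchings and triangular systems\<close>

text \<open>Hall's marriage theorem, by the induction of Halmos and Vaughan on the number of
  indices.\<close>

lemma hall:
  assumes "finite J" "\<And>i. i \<in> J \<Longrightarrow> finite (A i)"
    and "\<And>K. K \<subseteq> J \<Longrightarrow> card K \<le> card (\<Union>(A ` K))"
  shows "\<exists>f. inj_on f J \<and> (\<forall>i\<in>J. f i \<in> A i)"
  using assms
proof (induction "card J" arbitrary: J A rule: less_induct)
  case less
  note fin = less.prems(1) and finA = less.prems(2) and cond = less.prems(3)
  show ?case
  proof (cases "J = {}")
    case False
    then obtain i where i: "i \<in> J" by blast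
    show ?thesis
    \<comment> \<open>A critical set \<open>K\<close> is matched first and uses up all of
      \<open>U\<close>; the remaining indices still satisfy the condition once \<open>U\<close> is
      removed, because \<open>K\<close> leaves no surplus.\<close>
    proof (cases "\<exists>K. K \<subset> J \<and> K \<noteq> {} \<and> card (\<Union>(A ` K)) = card K")
      case True
      then obtain K where K: "K \<subset> J" "K \<noteq> {}" "card (\<Union>(A ` K)) = card K" by blast
      have finK: "finite K" using K fin finite_subset by blast
      have "\<exists>f. inj_on f K \<and> (\<forall>i\<in>K. f i \<in> A i)"
        by (rule less.hyps[OF psubset_card_mono[OF fin K(1)] finK]) (use finA cond K(1) in blast)+
      then obtain f where f: "inj_on f K" "\<forall>i\<in>K. f i \<in> A i" by blast
      define U where "U = \<Union>(A ` K)"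
      have finU: "finite U" using finK finA K by (auto simp: U_def)
      have c1: "card L \<le> card (\<Union>((\<lambda>i. A i - U) ` L))" if L: "L \<subseteq> J - K" for L
      proof -
        have finL: "finite L" using L fin finite_subset by blast
        have "card K + card L = card (K \<union> L)"
          using finK finL L by (subst card_Un_disjoint) auto
        also have "\<dots> \<le> card (\<Union>(A ` (K \<union> L)))" using cond[of "K \<union> L"] K L by blast
        also have "\<Union>(A ` (K \<union> L)) = U \<union> \<Union>((\<lambda>i. A i - U) ` L)" by (auto simp: U_def)
        also have "card \<dots> \<le> card U + card (\<Union>((\<lambda>i. A i - U) ` L))" by (rule card_Un_le)
        finally show ?thesis using K by (simp add: U_def)
      qed
      have c2: "card (J - K) < card J"
        using K fin finK by (intro psubset_card_mono) auto
      have "\<exists>g. inj_on g (J - K) \<and> (\<forall>i\<in>J-K. g i \<in> A i - U)"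
        by (rule less.hyps[OF c2 _ _ c1]) (use fin finA in blast)+
      then obtain g where g: "inj_on g (J - K)" "\<forall>i\<in>J-K. g i \<in> A i - U" by blast
      have "inj_on (\<lambda>i. if i \<in> K then f i else g i) J"
      proof -
        have "f ` K \<subseteq> U" "g ` (J - K) \<subseteq> - U" using f(2) g(2) by (auto simp: U_def)
        then have "f ` K \<inter> g ` (J - K) = {}" by blast
        then have "inj_on (\<lambda>i. if i \<in> K then f i else g i) (K \<union> (J - K))"
          using f(1) g(1) by (intro inj_on_disjoint_Un)
        moreover have "K \<union> (J - K) = J" using K by blast
        ultimately show ?thesis by simp
      qed
      moreover have "\<forall>i\<in>J. (if i \<in> K then f i else g i) \<in> A i" using f(2) g(2) by simp
      ultimately show ?thesis by (intro exI[of _ "\<lambda>i. if i \<in> K then f i else g i"] conjI)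
    next
      case False
      have "card {i} \<le> card (\<Union>(A ` {i}))" using cond[of "{i}"] i by blast
      then obtain x where x: "x \<in> A i" by fastforce
      \<comment> \<open>Without a critical set every nonempty proper subset has a surplus of at
        least one, so any value \<open>x\<close> may be given to \<open>i\<close>.\<close>
      have c1: "card L \<le> card (\<Union>((\<lambda>i. A i - {x}) ` L))" if L: "L \<subseteq> J - {i}" for L
      proof (cases "L = {}")
        case nonempty: False
        have "L \<subset> J" using L i by blast
        then have "card L < card (\<Union>(A ` L))"
          using False nonempty cond[of L] by (metis le_neq_implies_less less_imp_le psubset_imp_subset)
        moreover have eq: "\<Union>((\<lambda>i. A i - {x}) ` L) = \<Union>(A ` L) - {x}" by blast
        moreover have "card (\<Union>(A ` L)) - 1 \<le> card (\<Union>(A ` L) - {x})" by (simp add: card_Diff_singleton_if)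
        ultimately show ?thesis unfolding eq by linarith
      next
        case True
        then show ?thesis by simp
      qed
      have c2: "card (J - {i}) < card J" by (rule card_Diff1_less[OF fin i])
      have "\<exists>g. inj_on g (J - {i}) \<and> (\<forall>j\<in>J-{i}. g j \<in> A j - {x})"
        by (rule less.hyps[OF c2 _ _ c1]) (use fin finA in blast)+
      then obtain g where g: "inj_on g (J - {i})" "\<forall>j\<in>J-{i}. g j \<in> A j - {x}" by blast
      have "inj_on (g(i := x)) (insert i (J - {i}))"
        using g by (subst inj_on_insert) (auto intro: inj_on_fun_updI)
      then have "inj_on (g(i := x)) J" using i by (simp add: insert_absorb)
      moreover have "\<forall>j\<in>J. (g(i := x)) j \<in> A j" using g(2) x by simp
      ultimately show ?thesis by (intro exI[of _ "g(i := x)"] conjI)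
    qed
  next
    case True
    then show ?thesis by simp
  qed
qed

text \<open>Double counting of incidences between \<open>K\<close> and the union of its sets: there
  are at least \<open>n * card K\<close> of them and at most \<open>n\<close> for each element of
  the union.\<close>

lemma hall_degree:
  assumes "finite J" "\<And>i. i \<in> J \<Longrightarrow> finite (A i)" "0 < n"
    and "\<And>i. i \<in> J \<Longrightarrow> n \<le> card (A i)"
    and "\<And>x. card {i \<in> J. x \<in> A i} \<le> n"
  shows "\<exists>f. inj_on f J \<and> (\<forall>i\<in>J. f i \<in> A i)"
proof (rule hall[OF assms(1,2)])
  fix K assume K: "K \<subseteq> J"
  have finK: "finite K" using K assms(1) finite_subset by blast
  let ?U = "\<Union>(A ` K)"
  have finU: "finite ?U" using finK assms(2) K by auto
  have "n * card K \<le> (\<Sum>i\<in>K. card (A i))"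
    using sum_mono[of K "\<lambda>_. n" "\<lambda>i. card (A i)"] assms(4) K by (auto simp: mult.commute)
  also have "\<dots> = (\<Sum>i\<in>K. \<Sum>x\<in>?U. if x \<in> A i then 1 else 0)"
  proof (rule sum.cong)
    fix i assume "i \<in> K"
    then have "?U \<inter> A i = A i" by auto
    then show "card (A i) = (\<Sum>x\<in>?U. if x \<in> A i then 1 else 0)"
      using sum.inter_restrict[OF finU, of "\<lambda>_. 1::nat" "A i"] by simp
  qed simp
  also have "\<dots> = (\<Sum>x\<in>?U. card {i \<in> K. x \<in> A i})"
    using finK by (subst sum.swap) (simp flip: sum.inter_filter)
  also have "\<dots> \<le> (\<Sum>x\<in>?U. n)"
  proof (rule sum_mono)
    fix x
    have "card {i \<in> K. x \<in> A i} \<le> card {i \<in> J. x \<in> A i}"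
      using K assms(1) by (intro card_mono) auto
    then show "card {i \<in> K. x \<in> A i} \<le> n" using assms(5)[of x] by linarith
  qed
  finally show "card K \<le> card ?U" using assms(3) by (simp add: mult.commute)
qed

text \<open>Each equation determines its pivot from strictly lower coordinates, so the system is
  solved by recursion on \<open>ht\<close>, with the other coordinates prescribed freely.\<close>

lemma triangular_system:
  fixes mem :: "'e \<Rightarrow> 'v set" and x0 :: "'v \<Rightarrow> bit" and ht :: "'v \<Rightarrow> nat" and piv :: "'e \<Rightarrow> 'v"
  assumes fin: "\<And>e. e \<in> E \<Longrightarrow> finite (mem e)"
    and piv: "\<And>e. e \<in> E \<Longrightarrow> piv e \<in> mem e"
    and ht: "\<And>e v. e \<in> E \<Longrightarrow> v \<in> mem e \<Longrightarrow> v \<noteq> piv e \<Longrightarrow> ht v < ht (piv e)"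
    and inj: "inj_on piv E"
  obtains x where "\<And>v. v \<notin> piv ` E \<Longrightarrow> x v = x0 v" "\<And>e. e \<in> E \<Longrightarrow> (\<Sum>v\<in>mem e. x v) = 0"
proof
  \<comment> \<open>The pivot receives the sum of the other members of its equation; in
    characteristic 2 this makes the whole sum vanish. Injectivity of \<open>piv\<close> identifies
    the equation belonging to a pivot.\<close>
  define F where "F = (\<lambda>f v. if v \<in> piv ` E
    then \<Sum>w\<in>mem (the_inv_into E piv v) - {v}. f w else x0 v)"
  define x where "x = wfrec (Wellfounded.measure ht) F"
  have x: "x v = F (cut x (Wellfounded.measure ht) v) v" for v
    by (rule def_wfrec[OF x_def[THEN eq_reflection]]) simp
  show "x v = x0 v" if "v \<notin> piv ` E" for v
    using that by (subst x) (simp add: F_def)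
  show "(\<Sum>v\<in>mem e. x v) = 0" if e: "e \<in> E" for e
  proof -
    have "x (piv e) = (\<Sum>w\<in>mem e - {piv e}. cut x (Wellfounded.measure ht) (piv e) w)"
      using e by (subst x) (simp add: F_def the_inv_into_f_f[OF inj])
    also have "\<dots> = (\<Sum>w\<in>mem e - {piv e}. x w)"
      using ht[OF e] by (intro sum.cong) (auto simp: cut_apply)
    finally have "(\<Sum>v\<in>mem e. x v) = x (piv e) + x (piv e)"
      using fin[OF e] piv[OF e] by (simp add: sum.remove)
    then show ?thesis by (metis bit_2_eq_0 mult_2 mult_zero_left)
  qed
qed

section \<open>The finite model\<close>

text \<open>Freeness is demanded one step beyond \<open>R\<close>, since hyperedges through a ball
  of radius \<open>R\<close> can reach radius \<open>Suc R\<close>.\<close>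

locale finite_model = cyclic_product d k for d k +
  fixes V0 :: "'v set" and p :: "nat \<Rightarrow> 'v \<Rightarrow> 'v" and L R :: nat
  assumes finite_V0: "finite V0" and V0_nonempty: "V0 \<noteq> {}" and p_act: "is_act p V0"
    and p_free: "\<And>v. v \<in> V0 \<Longrightarrow> inj_on (\<lambda>g. gact p g v) (ball (Suc R))"
    and L_pos: "0 < L"
begin

definition T :: "('v \<times> nat \<Rightarrow> nat) set" where
  "T = V0 \<times> I \<rightarrow>\<^sub>E {..<L}"

definition inc :: "'v \<times> nat \<Rightarrow> ('v \<times> nat \<Rightarrow> nat) \<Rightarrow> 'v \<times> nat \<Rightarrow> nat" where
  "inc a t = t(a := Suc (t a) mod L)"

definition dec :: "'v \<times> nat \<Rightarrow> ('v \<times> nat \<Rightarrow> nat) \<Rightarrow> 'v \<times> nat \<Rightarrow> nat" where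
  "dec a t = t(a := (t a + (L - 1)) mod L)"

definition V :: "('v \<times> ('v \<times> nat \<Rightarrow> nat)) set" where
  "V = V0 \<times> T"

text \<open>Decrementing at the old incidence recovers the base of the hyperedge, and incrementing
  at the new one gives the point over the next vertex. Thus \<open>q\<close> covers
  \<open>p\<close>, and the base is constant along an orbit of \<open>q i\<close>.\<close>

definition q :: "nat \<Rightarrow> 'v \<times> ('v \<times> nat \<Rightarrow> nat) \<Rightarrow> 'v \<times> ('v \<times> nat \<Rightarrow> nat)" where
  "q i u = (p i (fst u), inc (p i (fst u), i) (dec (fst u, i) (snd u)))"

lemma inc_T: "a \<in> V0 \<times> I \<Longrightarrow> t \<in> T \<Longrightarrow> inc a t \<in> T"
  using L_pos by (auto simp: T_def inc_def PiE_def extensional_def)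

lemma dec_T: "a \<in> V0 \<times> I \<Longrightarrow> t \<in> T \<Longrightarrow> dec a t \<in> T"
  using L_pos by (auto simp: T_def dec_def PiE_def extensional_def)

lemma T_less: "t \<in> T \<Longrightarrow> a \<in> V0 \<times> I \<Longrightarrow> t a < L"
  by (auto simp: T_def)

lemma dec_inc: "a \<in> V0 \<times> I \<Longrightarrow> t \<in> T \<Longrightarrow> dec a (inc a t) = t"
  using T_less[of t a] L_pos by (auto simp: dec_def inc_def fun_eq_iff mod_Suc)

lemma inc_dec: "a \<in> V0 \<times> I \<Longrightarrow> t \<in> T \<Longrightarrow> inc a (dec a t) = t"
  using T_less[of t a] L_pos by (cases "t a") (auto simp: dec_def inc_def fun_eq_iff mod_Suc)

lemma q_pow:
  assumes "u \<in> V" "i \<in> I"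
  shows "(q i ^^ j) u = ((p i ^^ j) (fst u), inc ((p i ^^ j) (fst u), i) (dec (fst u, i) (snd u)))"
proof (induction j)
  case 0
  then show ?case using assms by (auto simp: V_def inc_dec)
next
  case (Suc j)
  have "(p i ^^ j) (fst u) \<in> V0" "fst u \<in> V0" "snd u \<in> T"
    using assms is_act_pow[OF p_act] by (auto simp: V_def)
  then show ?case using Suc assms by (simp add: q_def dec_inc dec_T)
qed

lemma q_act: "is_act q V"
  unfolding is_act_def
proof (intro ballI conjI)
  fix i u assume *: "i \<in> I" "u \<in> V"
  show "q i u \<in> V" using * is_actD(1)[OF p_act]
    by (auto simp: q_def V_def intro!: inc_T dec_T)
  show "(q i ^^ k) u = u" using * is_actD(2)[OF p_act]
    by (auto simp: q_pow) (auto simp: V_def inc_dec)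
qed

lemma fst_q: "fst (q i u) = p i (fst u)"
  by (simp add: q_def)

lemma fst_gact:
  assumes "g \<in> carrier G" "u \<in> V"
  shows "fst (gact q g u) = gact p g (fst u)"
  using assms(1)
proof (induction rule: group_induct)
  case one
  then show ?case using assms by (auto simp: gact_one[OF q_act] gact_one[OF p_act] V_def)
next
  case (step g i)
  have "fst u \<in> V0" using assms by (auto simp: V_def)
  then show ?case using step assms
    by (simp add: gact_mult[OF q_act] gact_mult[OF p_act] gact_gen[OF q_act] gact_gen[OF p_act]
        gact_closed[OF q_act] gact_closed[OF p_act] fst_q)
qed

text \<open>\<open>dec (v, i) t\<close> is the common base of the hyperedge of type \<open>i\<close> through \<open>(v, t)\<close>, and the check
  is imposed only if none of the counters wraps around.\<close>

definition intact :: "nat \<Rightarrow> 'v \<times> ('v \<times> nat \<Rightarrow> nat) \<Rightarrow> bool" where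
  "intact i u \<longleftrightarrow> (\<forall>a\<in>V0 \<times> I. Suc (dec (fst u, i) (snd u) a) < L)"

definition code :: "('v \<times> ('v \<times> nat \<Rightarrow> nat) \<Rightarrow> bit) set" where
  "code = {x \<in> V \<rightarrow>\<^sub>E UNIV. \<forall>u\<in>V. \<forall>i\<in>I. intact i u \<longrightarrow> (\<Sum>j<k. x ((q i ^^ j) u)) = 0}"

text \<open>Every hyperedge meeting the ball about \<open>u\<close> carries its check, so codewords
  look admissible from \<open>u\<close>; see \<open>pull_code\<close>.\<close>

definition good :: "nat \<Rightarrow> 'v \<times> ('v \<times> nat \<Rightarrow> nat) \<Rightarrow> bool" where
  "good r u \<longleftrightarrow> (\<forall>g\<in>ball r. \<forall>i\<in>I. intact i (gact q g u))"

definition pull :: "('v \<times> ('v \<times> nat \<Rightarrow> nat) \<Rightarrow> bit) \<Rightarrow> 'v \<times> ('v \<times> nat \<Rightarrow> nat) \<Rightarrow> nat word set \<Rightarrow> bit" where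
  "pull x u = (\<lambda>g\<in>carrier G. x (gact q g u))"

lemma pull_code:
  assumes "x \<in> code" "u \<in> V" "good r u"
  shows "restrict (pull x u) (ball r) \<in> balls_code r"
proof -
  have "(\<Sum>j<k. restrict (pull x u) (ball r) (g \<otimes>\<^bsub>G\<^esub> s i [^]\<^bsub>G\<^esub> j)) = 0"
    if "g \<in> ball r" "i \<in> I" "\<forall>j<k. g \<otimes>\<^bsub>G\<^esub> s i [^]\<^bsub>G\<^esub> j \<in> ball r" for g i
  proof -
    have g: "g \<in> carrier G" using that ball_carrier by blast
    have gu: "gact q g u \<in> V" using gact_closed[OF q_act g assms(2)] .
    have "(\<Sum>j<k. restrict (pull x u) (ball r) (g \<otimes>\<^bsub>G\<^esub> s i [^]\<^bsub>G\<^esub> j)) = (\<Sum>j<k. x ((q i ^^ j) (gact q g u)))"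
      using that g gu assms(2)
      by (intro sum.cong) (auto simp: pull_def gact_mult[OF q_act] gact_pow[OF q_act])
    then show ?thesis using assms that gu by (auto simp: code_def good_def)
  qed
  then show ?thesis by (auto simp: balls_code_def)
qed

section \<open>Separated sets and the hyperedges of the base\<close>

text \<open>The factor with exponent \<open>j\<close> forbids a single hyperedge to meet the balls
  about two distinct points; \<open>j = 0\<close> gives disjointness of the balls.\<close>

definition separated :: "nat \<Rightarrow> 'v set \<Rightarrow> bool" where
  "separated r S \<longleftrightarrow> S \<subseteq> V0 \<and> (\<forall>v\<in>S. \<forall>v'\<in>S. \<forall>g\<in>ball r. \<forall>g'\<in>ball r. \<forall>i\<in>I. \<forall>j.
     gact p (g \<otimes>\<^bsub>G\<^esub> s i [^]\<^bsub>G\<^esub> (j::nat)) v = gact p g' v' \<longrightarrow> v = v')"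

definition orbit :: "nat \<Rightarrow> 'v \<Rightarrow> 'v set" where
  "orbit i v = (\<lambda>j. (p i ^^ j) v) ` {..<k}"

lemma orbit_pow: "i \<in> I \<Longrightarrow> v \<in> V0 \<Longrightarrow> (p i ^^ j) v \<in> orbit i v"
proof -
  assume *: "i \<in> I" "v \<in> V0"
  have "(p i ^^ (k * n)) v = v" for n
    by (induction n) (simp_all add: funpow_add is_actD(2)[OF p_act *])
  then have "(p i ^^ (j mod k + k * (j div k))) v = (p i ^^ (j mod k)) v"
    by (simp only: funpow_add comp_apply)
  then show ?thesis using k_gt by (auto simp: orbit_def)
qed

lemma orbit_eq: "i \<in> I \<Longrightarrow> v \<in> V0 \<Longrightarrow> w \<in> orbit i v \<Longrightarrow> orbit i w = orbit i v"
proof -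
  have sub: "orbit i w \<subseteq> orbit i v" if "w \<in> orbit i v" "i \<in> I" "v \<in> V0" for v w
  proof -
    obtain a where "w = (p i ^^ a) v" using \<open>w \<in> orbit i v\<close> by (auto simp: orbit_def)
    then have "(p i ^^ j) w \<in> orbit i v" for j
      using orbit_pow[OF \<open>i \<in> I\<close> \<open>v \<in> V0\<close>, of "j + a"] by (simp add: funpow_add)
    then show ?thesis by (auto simp: orbit_def)
  qed
  assume *: "i \<in> I" "v \<in> V0" "w \<in> orbit i v"
  then obtain a where a: "a < k" "w = (p i ^^ a) v" by (auto simp: orbit_def)
  have w: "w \<in> V0" using * a is_act_pow[OF p_act] by simp
  have "(p i ^^ (k - a + a)) v = v" using a is_actD(2)[OF p_act *(1,2)] by simp
  then have "(p i ^^ (k - a)) w = v" by (simp only: a(2) funpow_add comp_apply)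
  then have "v \<in> orbit i w" using orbit_pow[OF *(1) w] by metis
  then show ?thesis using sub * w by blast
qed

lemma orbit_self: "i \<in> I \<Longrightarrow> v \<in> V0 \<Longrightarrow> v \<in> orbit i v"
  using orbit_pow[of i v 0] by simp

lemma orbit_V0: "i \<in> I \<Longrightarrow> v \<in> V0 \<Longrightarrow> orbit i v \<subseteq> V0"
  using is_act_pow[OF p_act] by (auto simp: orbit_def)

lemma pow_inj: "i \<in> I \<Longrightarrow> v \<in> V0 \<Longrightarrow> inj_on (\<lambda>j. (p i ^^ j) v) {..<k}"
proof (rule inj_onI)
  fix j l assume *: "i \<in> I" "v \<in> V0" "j \<in> {..<k}" "l \<in> {..<k}" "(p i ^^ j) v = (p i ^^ l) v"
  have mem: "s i [^]\<^bsub>G\<^esub> b \<in> ball (Suc R)" for b :: nat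
    using coset_in_ball_Suc[OF one_ball *(1), of b R] *(1) by simp
  have "gact p (s i [^]\<^bsub>G\<^esub> j) v = gact p (s i [^]\<^bsub>G\<^esub> l) v"
    using * by (simp add: gact_pow[OF p_act])
  then have "s i [^]\<^bsub>G\<^esub> j = s i [^]\<^bsub>G\<^esub> l" using inj_onD[OF p_free[OF *(2)]] mem by blast
  then show "j = l" using coset_inj[OF one_closed *(1), of j l] * by simp
qed

lemma card_orbit: "i \<in> I \<Longrightarrow> v \<in> V0 \<Longrightarrow> card (orbit i v) = k"
  unfolding orbit_def using card_image[OF pow_inj] by simp

text \<open>Separation identifies the centres; freeness on the ball of radius \<open>Suc R\<close>
  then identifies the group elements.\<close>

lemma gact_separated:
  assumes "separated r S" "r \<le> R" "v \<in> S" "v' \<in> S" "g \<in> ball r" "g' \<in> ball r" "i \<in> I"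
    and eq: "(p i ^^ j) (gact p g v) = gact p g' v'"
  shows "v = v' \<and> g \<otimes>\<^bsub>G\<^esub> s i [^]\<^bsub>G\<^esub> j = g'"
proof -
  have gg: "g \<in> carrier G" and v: "v \<in> V0" using assms ball_carrier by (auto simp: separated_def)
  have eq': "gact p (g \<otimes>\<^bsub>G\<^esub> s i [^]\<^bsub>G\<^esub> j) v = gact p g' v'"
    using eq gg v assms(7) by (simp add: gact_mult[OF p_act] gact_pow[OF p_act] gact_closed[OF p_act])
  then have vv: "v = v'" using assms(1,3-7) unfolding separated_def by blast
  have "g \<otimes>\<^bsub>G\<^esub> s i [^]\<^bsub>G\<^esub> j \<in> ball (Suc R)" "g' \<in> ball (Suc R)"
    using coset_in_ball_Suc[OF assms(5,7), of j] ball_mono[of "Suc r" "Suc R"] ball_mono[of r "Suc R"] assms by auto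
  then show ?thesis using inj_onD[OF p_free[OF v]] eq' vv by blast
qed

text \<open>Hyperedges over \<open>U\<close> satisfy their checks because each \<open>a u\<close> is
  admissible. The other intact ones form a triangular system with pivots outside \<open>U\<close>,
  so solving it leaves the prescribed pattern untouched.\<close>

lemma code_extend:
  assumes sep: "separated r S" and r: "r \<le> R"
    and a: "\<And>u. u \<in> S \<times> T \<Longrightarrow> a u \<in> balls_code r"
  shows "\<exists>x\<in>code. \<forall>u\<in>S \<times> T. \<forall>g\<in>ball r. x (gact q g u) = a u g"
proof -
  have S: "S \<subseteq> V0" using sep by (simp add: separated_def)
  define U where "U = {gact p g v | g v. g \<in> ball r \<and> v \<in> S}"
  \<comment> \<open>The type is stored with the orbit, so hyperedges of different types count
    separately even if their vertex sets agree.\<close>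
  define J where "J = {(i, orbit i v) | i v. i \<in> I \<and> v \<in> V0 \<and> \<not> orbit i v \<subseteq> U}"
  have finJ: "finite J"
    by (rule finite_subset[of _ "(\<lambda>(i, v). (i, orbit i v)) ` (I \<times> V0)"])
       (auto simp: J_def finite_V0 I_def)
  \<comment> \<open>Two points of a hyperedge in \<open>U\<close> belong to the same ball by
    separation, and a ball with two points of a hyperedge contains all of it.\<close>
  have UE: "orbit i w \<subseteq> U" if h: "i \<in> I" "w \<in> U" "(p i ^^ j) w \<in> U" "0 < j" "j < k" for i w j
  proof -
    obtain g v where g: "g \<in> ball r" "v \<in> S" "w = gact p g v" using h(2) by (auto simp: U_def)
    obtain g' v' where g': "g' \<in> ball r" "v' \<in> S" "(p i ^^ j) w = gact p g' v'"
      using h(3) by (auto simp: U_def)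
    have "v = v' \<and> g \<otimes>\<^bsub>G\<^esub> s i [^]\<^bsub>G\<^esub> j = g'"
      by (rule gact_separated[OF sep r g(2) g'(2) g(1) g'(1) that(1)]) (use g g' in simp)
    then have "g \<otimes>\<^bsub>G\<^esub> s i [^]\<^bsub>G\<^esub> l \<in> ball r" for l :: nat
      using coset_in_ball[OF g(1) that(1) _ that(4,5)] g'(1) by blast
    moreover have "(p i ^^ l) w = gact p (g \<otimes>\<^bsub>G\<^esub> s i [^]\<^bsub>G\<^esub> l) v" for l
      using g ball_carrier S that(1)
      by (simp add: gact_mult[OF p_act] gact_pow[OF p_act] gact_closed[OF p_act] subset_iff)
    ultimately show ?thesis using g(2) by (auto simp: orbit_def U_def)
  qed
  \<comment> \<open>A hyperedge not inside \<open>U\<close> has at most one vertex in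
    \<open>U\<close>, hence at least \<open>k - 1\<close> outside; this is where
    \<open>d < k\<close> enters.\<close>
  have J_deg: "d \<le> card (snd e - U)" if eJ: "e \<in> J" for e
  proof -
    obtain i v where e: "e = (i, orbit i v)" "i \<in> I" "v \<in> V0" "\<not> orbit i v \<subseteq> U"
      using eJ by (auto simp: J_def)
    have "w = w'" if ww: "w \<in> orbit i v \<inter> U" "w' \<in> orbit i v \<inter> U" for w w'
    proof (rule ccontr)
      assume neq: "w \<noteq> w'"
      have o: "orbit i w = orbit i v" using ww e orbit_eq by blast
      then obtain j where j: "j < k" "w' = (p i ^^ j) w" using ww by (auto simp: orbit_def)
      then have "0 < j" using neq by (cases j) auto
      then show False using UE[of i w j] ww j e o by auto
    qed
    then have "orbit i v \<inter> U = {} \<or> (\<exists>w. orbit i v \<inter> U = {w})" by blast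
    then have "card (orbit i v \<inter> U) \<le> 1" by auto
    moreover have "card (orbit i v - U) = card (orbit i v) - card (orbit i v \<inter> U)"
      by (rule card_Diff_subset_Int) (simp add: orbit_def)
    ultimately show ?thesis using card_orbit[OF e(2,3)] d_less_k e by simp
  qed
  \<comment> \<open>A vertex lies on exactly one orbit of each of the \<open>d\<close>
    types.\<close>
  have J_deg': "card {e \<in> J. w \<in> snd e - U} \<le> d" for w
  proof -
    have "{e \<in> J. w \<in> snd e - U} \<subseteq> (\<lambda>i. (i, orbit i w)) ` I"
      using orbit_eq by (auto simp: J_def)
    then have "card {e \<in> J. w \<in> snd e - U} \<le> card I"
      by (rule surj_card_le[rotated]) (simp add: I_def)
    then show ?thesis by (simp add: I_def)
  qed
  have "\<exists>f. inj_on f J \<and> (\<forall>e\<in>J. f e \<in> snd e - U)"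
  proof (rule hall_degree[OF finJ _ _ J_deg J_deg'])
    show "finite (snd e - U)" if "e \<in> J" for e using that by (auto simp: J_def orbit_def)
  qed (use d_ge in auto)
  then obtain f where f: "inj_on f J" "\<And>e. e \<in> J \<Longrightarrow> f e \<in> snd e - U" by blast
  have J_V0: "fst e \<in> I \<and> snd e \<subseteq> V0" if "e \<in> J" for e
    using that by (auto simp: J_def intro: orbit_V0[THEN subsetD])
  have f_V0: "(f e, fst e) \<in> V0 \<times> I" if "e \<in> J" for e
    using f(2)[OF that] J_V0[OF that] by auto
  \<comment> \<open>A hyperedge is determined by its type and any of its vertices, in particular by
    its chosen one.\<close>
  have fI: "e = e'" if "e \<in> J" "e' \<in> J" "f e' \<in> snd e" "fst e' = fst e" for e e'
  proof -
    have orb: "snd e = orbit (fst e) w" if "e \<in> J" "w \<in> snd e" for e w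
      using that orbit_eq by (auto simp: J_def)
    have "snd e' = snd e"
      using orb[OF that(1,3)] orb[OF that(2), of "f e'"] f(2)[OF that(2)] that(4) by simp
    then show ?thesis using that(4) by (simp add: prod_eq_iff)
  qed
  \<comment> \<open>The equations: a hyperedge of the base together with a base counter vector
    \<beta> none of whose entries wraps around when increased.\<close>
  define E where "E = {(e, \<beta>). e \<in> J \<and> \<beta> \<in> T \<and> (\<forall>a\<in>V0 \<times> I. Suc (\<beta> a) < L)}"
  define mem where "mem = (\<lambda>(e, \<beta>). (\<lambda>w. (w, inc (w, fst e) \<beta>)) ` snd e)"
  define piv where "piv = (\<lambda>(e, \<beta>). (f e, inc (f e, fst e) \<beta>))"
  define ht where "ht = (\<lambda>(w::'v, t). \<Sum>e\<in>J. t (f e, fst e) :: nat)"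
  \<comment> \<open>\<open>rep\<close> reads off the centre and the group element of a point over
    \<open>U\<close>; by \<open>uniq\<close> below the choice is forced.\<close>
  define rep where "rep u = (SOME z. fst z \<in> S \<times> T \<and> snd z \<in> ball r \<and> gact q (snd z) (fst z) = u)" for u
  define x0 where "x0 u = a (fst (rep u)) (snd (rep u))" for u
  have ST_V: "u \<in> V" if "u \<in> S \<times> T" for u using that S by (auto simp: V_def)
  have uniq: "u = u' \<and> g = g'"
    if "u \<in> S \<times> T" "u' \<in> S \<times> T" "g \<in> ball r" "g' \<in> ball r" "gact q g u = gact q g' u'" for u u' g g'
  proof -
    have i: "1 \<in> I" using d_ge by (simp add: I_def)
    have "(p 1 ^^ 0) (gact p g (fst u)) = gact p g' (fst u')"
      using that ball_carrier ST_V by (simp flip: fst_gact)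
    then have "fst u = fst u' \<and> g \<otimes>\<^bsub>G\<^esub> s 1 [^]\<^bsub>G\<^esub> (0::nat) = g'"
      by (intro gact_separated[OF sep r _ _ that(3,4) i]) (use that in auto)
    then have "g = g'" using ball_carrier[OF that(3)] by simp
    moreover from this have "u = u'"
      using that ST_V gact_bij[OF q_act ball_carrier[OF that(3)]] by (auto simp: bij_betw_def inj_on_def)
    ultimately show ?thesis by simp
  qed
  have x0: "x0 (gact q g u) = a u g" if "u \<in> S \<times> T" "g \<in> ball r" for u g
  proof -
    let ?P = "\<lambda>z. fst z \<in> S \<times> T \<and> snd z \<in> ball r \<and> gact q (snd z) (fst z) = gact q g u"
    have "?P (u, g)" using that by simp
    then have "?P (rep (gact q g u))" unfolding rep_def by (rule someI)
    then show ?thesis using uniq[of "fst (rep (gact q g u))" u "snd (rep (gact q g u))" g] that by (simp add: x0_def)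
  qed
  have inj_piv: "inj_on piv E"
  proof (rule inj_onI)
    fix z z' assume z: "z \<in> E" "z' \<in> E" "piv z = piv z'"
    obtain e \<beta> e' \<beta>' where zz: "z = (e, \<beta>)" "z' = (e', \<beta>')" by fastforce
    then have "f e = f e'" using z by (simp add: piv_def)
    then have "e = e'" using z f(1) zz by (auto simp: E_def inj_on_def)
    moreover have "inc (f e, fst e) \<beta> = inc (f e, fst e) \<beta>'" using z zz \<open>e = e'\<close> by (simp add: piv_def)
    moreover have "e \<in> J" "\<beta> \<in> T" "\<beta>' \<in> T" using z zz by (auto simp: E_def)
    ultimately have "\<beta> = \<beta>'" using dec_inc[OF f_V0] by metis
    then show "z = z'" using \<open>e = e'\<close> zz by simp
  qed
  have ht: "ht u < ht (piv z)" if h: "z \<in> E" "u \<in> mem z" "u \<noteq> piv z" for z u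
  proof -
    obtain e \<beta> where z: "z = (e, \<beta>)" by fastforce
    have e: "e \<in> J" and \<beta>: "\<And>a. a \<in> V0 \<times> I \<Longrightarrow> Suc (\<beta> a) < L" using h z by (auto simp: E_def)
    obtain w where w: "w \<in> snd e" "u = (w, inc (w, fst e) \<beta>)" using h z by (auto simp: mem_def)
    have wf: "w \<noteq> f e" using h(3) w z by (auto simp: piv_def)
    \<comment> \<open>Increasing the counter of a vertex other than the pivot touches no chosen
      incidence, by \<open>fI\<close>. The pivot increases exactly its own summand of
      \<open>ht\<close>, strictly because there is no wrap-around.\<close>
    have 1: "inc (w, fst e) \<beta> (f e', fst e') = \<beta> (f e', fst e')" if "e' \<in> J" for e'
      using wf w(1) fI[OF e that] by (auto simp: inc_def)
    have 2: "\<beta> a \<le> inc (f e, fst e) \<beta> a" for a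
      using \<beta>[OF f_V0[OF e]] by (auto simp: inc_def)
    have 3: "\<beta> (f e, fst e) < inc (f e, fst e) \<beta> (f e, fst e)"
      using \<beta>[OF f_V0[OF e]] by (auto simp: inc_def)
    have "(\<Sum>e'\<in>J. inc (w, fst e) \<beta> (f e', fst e')) < (\<Sum>e'\<in>J. inc (f e, fst e) \<beta> (f e', fst e'))"
      by (rule sum_strict_mono_ex1[OF finJ]) (use 1 2 3 e in auto)
    then show ?thesis by (simp add: ht_def w(2) z piv_def)
  qed
  obtain x where x: "\<And>u. u \<notin> piv ` E \<Longrightarrow> x u = x0 u" "\<And>z. z \<in> E \<Longrightarrow> (\<Sum>u\<in>mem z. x u) = 0"
  proof (rule triangular_system[of E mem piv ht x0])
    show "finite (mem z)" if "z \<in> E" for z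
      using that J_V0 finite_V0 finite_subset by (fastforce simp: E_def mem_def)
    show "piv z \<in> mem z" if "z \<in> E" for z
      using that f(2) by (fastforce simp: E_def mem_def piv_def)
  qed (use ht inj_piv in auto)
  have pivU: "fst (piv z) \<notin> U" if "z \<in> E" for z using that f(2) by (fastforce simp: E_def piv_def)
  have xU: "x (gact q g u) = a u g" if "u \<in> S \<times> T" "g \<in> ball r" for u g
  proof -
    have "fst u \<in> S" using that by auto
    then have "fst (gact q g u) \<in> U" using that(2) fst_gact[OF ball_carrier[OF that(2)] ST_V[OF that(1)]]
      unfolding U_def by blast
    then have "gact q g u \<notin> piv ` E" using pivU by auto
    then show ?thesis using x(1) x0 that by simp
  qed
  have "restrict x V \<in> code"
    unfolding code_def
  proof (intro CollectI conjI ballI impI)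
    fix u i assume u: "u \<in> V" and i: "i \<in> I" and int: "intact i u"
    let ?v = "fst u" and ?\<beta> = "dec (fst u, i) (snd u)"
    have v: "?v \<in> V0" and \<beta>: "?\<beta> \<in> T" using u i by (auto simp: V_def dec_T)
    have "(\<Sum>j<k. restrict x V ((q i ^^ j) u)) = (\<Sum>j<k. x ((q i ^^ j) u))"
      using is_act_pow[OF q_act i u] by simp
    also have "\<dots> = 0"
    proof (cases "orbit i ?v \<subseteq> U")
      case True
      then have "?v \<in> U" using orbit_self[OF i v] by blast
      then obtain g v' where g: "g \<in> ball r" "v' \<in> S" "?v = gact p g v'" by (auto simp: U_def)
      have gc: "g \<in> carrier G" using g ball_carrier by blast
      \<comment> \<open>Moving back by \<open>g\<close> leads to the centre of the ball containing
        the hyperedge, so that the check becomes one of the pattern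
        \<open>a \<sigma>\<close>.\<close>
      define \<sigma> where "\<sigma> = gact q (inv\<^bsub>G\<^esub> g) u"
      have \<sigma>V: "\<sigma> \<in> V" unfolding \<sigma>_def using gc u gact_closed[OF q_act] by simp
      have g\<sigma>: "gact q g \<sigma> = u" unfolding \<sigma>_def using gact_inv(2)[OF q_act gc u] .
      have "fst \<sigma> = v'" unfolding \<sigma>_def
        using fst_gact[OF inv_closed[OF gc] u] g gact_inv(1)[OF p_act gc] S by auto
      then have \<sigma>: "\<sigma> \<in> S \<times> T" using \<sigma>V g(2) by (auto simp: V_def)
      have mem: "g \<otimes>\<^bsub>G\<^esub> s i [^]\<^bsub>G\<^esub> j \<in> ball r" for j :: nat
      proof -
        have "(p i ^^ j) ?v \<in> U" using True orbit_pow[OF i v] by blast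
        then obtain g' w where g': "g' \<in> ball r" "w \<in> S" "(p i ^^ j) (gact p g v') = gact p g' w"
          using g by (auto simp: U_def)
        show ?thesis using gact_separated[OF sep r g(2) g'(2) g(1) g'(1) i g'(3)] g'(1) by simp
      qed
      have "(q i ^^ j) u = gact q (g \<otimes>\<^bsub>G\<^esub> s i [^]\<^bsub>G\<^esub> j) \<sigma>" for j
        using gc i \<sigma>V g\<sigma> u by (simp add: gact_mult[OF q_act] gact_pow[OF q_act])
      then have "(\<Sum>j<k. x ((q i ^^ j) u)) = (\<Sum>j<k. a \<sigma> (g \<otimes>\<^bsub>G\<^esub> s i [^]\<^bsub>G\<^esub> j))"
        using xU[OF \<sigma> mem] by simp
      then show ?thesis using a[OF \<sigma>] g(1) i mem by (simp add: balls_code_def)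
    next
      case False
      then have z: "((i, orbit i ?v), ?\<beta>) \<in> E"
        using i v \<beta> int by (auto simp: E_def J_def intact_def)
      have "(\<Sum>j<k. x ((q i ^^ j) u)) = (\<Sum>j<k. x ((p i ^^ j) ?v, inc ((p i ^^ j) ?v, i) ?\<beta>))"
        using q_pow[OF u i] by simp
      also have "\<dots> = (\<Sum>w\<in>orbit i ?v. x (w, inc (w, i) ?\<beta>))"
        unfolding orbit_def using pow_inj[OF i v] by (simp add: sum.reindex)
      also have "\<dots> = (\<Sum>w\<in>mem ((i, orbit i ?v), ?\<beta>). x w)"
        unfolding mem_def by (simp add: sum.reindex inj_on_def)
      also have "\<dots> = 0" using x(2)[OF z] .
      finally show ?thesis .
    qed
    finally show "(\<Sum>j<k. restrict x V ((q i ^^ j) u)) = 0" .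
  qed simp
  moreover have "restrict x V (gact q g u) = a u g" if "u \<in> S \<times> T" "g \<in> ball r" for u g
    using xU[OF that] gact_closed[OF q_act ball_carrier[OF that(2)] ST_V[OF that(1)]] by simp
  ultimately show ?thesis by blast
qed

end

section \<open>Shannon entropy on a finite set\<close>

definition ent :: "real \<Rightarrow> real" where
  "ent t = - (t * ln t)"

lemma ent_0 [simp]: "ent 0 = 0" and ent_1 [simp]: "ent 1 = 0"
  by (simp_all add: ent_def)

lemma ent_nonneg: "0 \<le> t \<Longrightarrow> t \<le> 1 \<Longrightarrow> 0 \<le> ent t"
  by (cases "t = 0") (auto simp: ent_def mult_nonneg_nonpos)

lemma ent_le_1: "0 \<le> t \<Longrightarrow> ent t \<le> 1"
proof (cases "t = 0")
  case False
  assume "0 \<le> t"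
  then have t: "0 < t" using False by simp
  have "ln (1 / t) \<le> 1 / t - 1" using t by (intro ln_le_minus_one) simp
  then have "t * ln (1 / t) \<le> t * (1 / t - 1)" using t by simp
  also have "\<dots> \<le> 1" using t by (simp add: field_simps)
  finally show ?thesis using t by (simp add: ent_def ln_div)
qed simp

lemma continuous_on_ent: "continuous_on {0..} ent"
proof -
  have "(ent \<longlongrightarrow> ent t) (at t within {0..})" if "0 \<le> t" for t
  proof (cases "t = 0")
    case True
    have "((\<lambda>t::real. - (t * ln t)) \<longlongrightarrow> 0) (at_right 0)" by real_asymp
    moreover have "at_right (0::real) = at 0 within {0..}"
      by (rule filter_eqI) (auto simp: eventually_at)
    ultimately show ?thesis using True by (simp add: ent_def[abs_def])
  next
    case False
    then have "isCont ent t" using that unfolding ent_def[abs_def] by (intro continuous_intros) auto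
    then show ?thesis 
      using tendsto_within_subset[of ent _ t UNIV "{0..}"] by (simp add: isCont_def)
  qed
  then show ?thesis by (simp add: continuous_on_def)
qed

definition fprob :: "'a set \<Rightarrow> ('a \<Rightarrow> bool) \<Rightarrow> real" where
  "fprob C Q = real (card {x \<in> C. Q x}) / real (card C)"

text \<open>The Shannon entropy of \<open>f\<close> under the uniform distribution on
  \<open>C\<close>, written as mean information content; \<open>fent_eq_sum\<close> gives the usual
  form.\<close>

definition fent :: "'a set \<Rightarrow> ('a \<Rightarrow> 'b) \<Rightarrow> real" where
  "fent C f = (\<Sum>x\<in>C. - ln (fprob C (\<lambda>y. f y = f x))) / real (card C)"

lemma fprob_nonneg: "0 \<le> fprob C Q"
  by (simp add: fprob_def)

lemma fprob_le_1: "finite C \<Longrightarrow> fprob C Q \<le> 1"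
  by (simp add: fprob_def divide_le_eq card_mono card_gt_0_iff)

lemma fprob_mono: "finite C \<Longrightarrow> (\<And>x. x \<in> C \<Longrightarrow> P x \<Longrightarrow> Q x) \<Longrightarrow> fprob C P \<le> fprob C Q"
  unfolding fprob_def by (intro divide_right_mono) (auto intro!: card_mono)

lemma fprob_not: "finite C \<Longrightarrow> C \<noteq> {} \<Longrightarrow> fprob C (\<lambda>x. \<not> Q x) = 1 - fprob C Q"
proof -
  assume C: "finite C" "C \<noteq> {}"
  have "card {x \<in> C. \<not> Q x} = card C - card {x \<in> C. Q x}"
    using C by (subst card_Diff_subset[symmetric]) (auto intro: arg_cong[of _ _ card])
  moreover have "card {x \<in> C. Q x} \<le> card C" using C by (intro card_mono) auto
  ultimately show ?thesis using C by (simp add: fprob_def field_simps of_nat_diff)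
qed

context
  fixes C :: "'a set"
  assumes fin: "finite C" and ne: "C \<noteq> {}"
begin

lemma card_pos: "0 < real (card C)" using fin ne by (simp add: card_gt_0_iff)

lemma fprob_pos: "x \<in> C \<Longrightarrow> 0 < fprob C (\<lambda>y. f y = f x)"
proof -
  assume "x \<in> C"
  then have "{y \<in> C. f y = f x} \<noteq> {}" by blast
  then show ?thesis using fin card_pos by (simp add: fprob_def card_gt_0_iff divide_pos_pos)
qed

lemma sum_fprob_eq:
  "(\<Sum>x\<in>C. h (f x)) = real (card C) * (\<Sum>a\<in>f ` C. fprob C (\<lambda>y. f y = a) * h a)"
proof -
  have "(\<Sum>x\<in>C. h (f x)) = (\<Sum>a\<in>f ` C. \<Sum>x\<in>{x \<in> C. f x = a}. h (f x))"
    by (rule sum.image_gen[OF fin])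
  also have "\<dots> = (\<Sum>a\<in>f ` C. real (card {x \<in> C. f x = a}) * h a)"
    by (intro sum.cong) auto
  also have "\<dots> = real (card C) * (\<Sum>a\<in>f ` C. fprob C (\<lambda>y. f y = a) * h a)"
    using card_pos by (simp add: fprob_def sum_distrib_left)
  finally show ?thesis .
qed

lemma sum_fprob: "(\<Sum>a\<in>f ` C. fprob C (\<lambda>y. f y = a)) = 1"
  using sum_fprob_eq[of "\<lambda>_. 1" f] card_pos by (simp del: of_nat_0_less_iff)

lemma fent_eq_sum:
  assumes "finite K" "f ` C \<subseteq> K"
  shows "fent C f = (\<Sum>a\<in>K. ent (fprob C (\<lambda>y. f y = a)))"
proof -
  have "fent C f = (\<Sum>a\<in>f ` C. ent (fprob C (\<lambda>y. f y = a)))"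
    using sum_fprob_eq[of "\<lambda>a. - ln (fprob C (\<lambda>y. f y = a))" f] card_pos
    by (simp add: fent_def ent_def)
  also have "\<dots> = (\<Sum>a\<in>K. ent (fprob C (\<lambda>y. f y = a)))"
  proof (rule sum.mono_neutral_left[OF assms], rule ballI)
    fix a assume "a \<in> K - f ` C"
    then have "{y \<in> C. f y = a} = {}" by auto
    then show "ent (fprob C (\<lambda>y. f y = a)) = 0" unfolding fprob_def by (simp only: card.empty) simp
  qed
  finally show ?thesis .
qed

lemma fent_le_card:
  assumes "finite K" "f ` C \<subseteq> K"
  shows "fent C f \<le> real (card K)"
  using sum_mono[of K "\<lambda>a. ent (fprob C (\<lambda>y. f y = a))" "\<lambda>_. 1"]
  by (simp add: fent_eq_sum[OF assms] ent_le_1 fprob_nonneg)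

lemma fent_mono:
  assumes "\<And>x y. x \<in> C \<Longrightarrow> y \<in> C \<Longrightarrow> g x = g y \<Longrightarrow> f x = f y"
  shows "fent C f \<le> fent C g"
  unfolding fent_def
proof (intro divide_right_mono sum_mono)
  fix x assume x: "x \<in> C"
  have "fprob C (\<lambda>y. g y = g x) \<le> fprob C (\<lambda>y. f y = f x)"
    using assms x by (intro fprob_mono fin) metis
  then show "- ln (fprob C (\<lambda>y. f y = f x)) \<le> - ln (fprob C (\<lambda>y. g y = g x))"
    using fprob_pos[OF x, of g] by (simp add: ln_mono)
qed simp

text \<open>Subadditivity of entropy, from \<open>ln t \<le> t - 1\<close> applied to the ratio of
  the product law to the joint law: summing over the larger set of all pairs of values gives total
  mass 1.\<close>

lemma fent_pair: "fent C (\<lambda>x. (f x, g x)) \<le> fent C f + fent C g"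
proof -
  let ?p = "\<lambda>a. fprob C (\<lambda>y. f y = a)" and ?q = "\<lambda>b. fprob C (\<lambda>y. g y = b)"
  let ?r = "\<lambda>c. fprob C (\<lambda>y. (f y, g y) = c)"
  let ?h = "\<lambda>c. ?p (fst c) * ?q (snd c) / ?r c"
  have "(\<Sum>x\<in>C. ln (?p (f x)) + ln (?q (g x)) - ln (?r (f x, g x))) \<le> (\<Sum>x\<in>C. ?h (f x, g x) - 1)"
  proof (rule sum_mono)
    fix x assume x: "x \<in> C"
    have pos: "0 < ?p (f x)" "0 < ?q (g x)" "0 < ?r (f x, g x)"
      using fprob_pos[OF x, of f] fprob_pos[OF x, of g] fprob_pos[OF x, of "\<lambda>x. (f x, g x)"] by auto
    have "ln (?h (f x, g x)) \<le> ?h (f x, g x) - 1" using pos by (intro ln_le_minus_one) simp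
    then show "ln (?p (f x)) + ln (?q (g x)) - ln (?r (f x, g x)) \<le> ?h (f x, g x) - 1"
      using pos by (simp add: ln_mult ln_div)
  qed
  also have "\<dots> = (\<Sum>x\<in>C. ?h (f x, g x)) - real (card C)" by (simp add: sum_subtractf)
  also have "(\<Sum>x\<in>C. ?h (f x, g x)) = real (card C) * (\<Sum>c\<in>(\<lambda>x. (f x, g x)) ` C. ?r c * ?h c)"
    by (rule sum_fprob_eq[of ?h "\<lambda>x. (f x, g x)"])
  also have "(\<Sum>c\<in>(\<lambda>x. (f x, g x)) ` C. ?r c * ?h c) \<le> (\<Sum>c\<in>(\<lambda>x. (f x, g x)) ` C. ?p (fst c) * ?q (snd c))"
    by (intro sum_mono) (auto simp: fprob_nonneg)
  also have "\<dots> \<le> (\<Sum>c\<in>f ` C \<times> g ` C. ?p (fst c) * ?q (snd c))"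
    using fin by (intro sum_mono2) (auto simp: fprob_nonneg)
  also have "\<dots> = (\<Sum>a\<in>f ` C. ?p a) * (\<Sum>b\<in>g ` C. ?q b)"
    by (simp add: sum_product sum.cartesian_product case_prod_beta)
  also have "\<dots> = 1" by (simp add: sum_fprob)
  finally have "(\<Sum>x\<in>C. ln (?p (f x)) + ln (?q (g x)) - ln (?r (f x, g x))) \<le> 0"
    using card_pos by simp
  then have "(\<Sum>x\<in>C. - ln (?r (f x, g x))) \<le> (\<Sum>x\<in>C. - ln (?p (f x))) + (\<Sum>x\<in>C. - ln (?q (g x)))"
    by (simp add: sum_subtractf sum.distrib sum_negf)
  then show ?thesis
    unfolding fent_def add_divide_distrib[symmetric] by (intro divide_right_mono) auto
qed

lemma fent_family:
  "finite J \<Longrightarrow> fent C (\<lambda>x. \<lambda>j\<in>J. f j x) \<le> (\<Sum>j\<in>J. fent C (f j))"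
proof (induction J rule: finite_induct)
  case empty
  have "fent C (\<lambda>x. \<lambda>j\<in>{}. f j x) = 0"
    using card_pos by (simp add: fent_def fprob_def restrict_def)
  then show ?case by (simp only: sum.empty)
next
  case (insert j J)
  have "fent C (\<lambda>x. \<lambda>j\<in>insert j J. f j x) \<le> fent C (\<lambda>x. (f j x, \<lambda>j\<in>J. f j x))"
    by (rule fent_mono) (auto simp: restrict_def fun_eq_iff split: if_splits)
  also have "\<dots> \<le> fent C (f j) + fent C (\<lambda>x. \<lambda>j\<in>J. f j x)" by (rule fent_pair)
  also have "\<dots> \<le> fent C (f j) + (\<Sum>j\<in>J. fent C (f j))" using insert.IH by (rule add_left_mono)
  also have "\<dots> = (\<Sum>j\<in>insert j J. fent C (f j))" using insert.hyps by simp
  finally show ?case .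
qed

text \<open>If every fibre has probability at most \<open>\<theta> ^ n\<close>, then every term of
  the mean information content is at least \<open>n\<close> times
  \<open>- ln \<theta>\<close>.\<close>

lemma fent_ge:
  assumes "0 < \<theta>" "\<And>x. x \<in> C \<Longrightarrow> fprob C (\<lambda>y. f y = f x) \<le> \<theta> ^ n"
  shows "real n * - ln \<theta> \<le> fent C f"
proof -
  have "- ln (fprob C (\<lambda>y. f y = f x)) \<ge> real n * - ln \<theta>" if "x \<in> C" for x
  proof -
    have "ln (fprob C (\<lambda>y. f y = f x)) \<le> ln (\<theta> ^ n)"
      using assms(2)[OF that] fprob_pos[OF that, of f] by (simp add: ln_mono)
    then show ?thesis using assms(1) by (simp add: ln_realpow)
  qed
  then have "(\<Sum>x\<in>C. real n * - ln \<theta>) \<le> (\<Sum>x\<in>C. - ln (fprob C (\<lambda>y. f y = f x)))"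
    by (intro sum_mono) simp
  then show ?thesis using card_pos by (simp add: fent_def field_simps)
qed

end

section \<open>Independence in the finite model\<close>

context cyclic_product begin

text \<open>The displacements between two centres that violate separation, closed under inverses so
  that the roles of the centres may be exchanged. Its cardinality bounds the inverse density of a
  separated set.\<close>

definition sepset :: "nat \<Rightarrow> nat word set set" where
  "sepset r = (let K = (\<lambda>(g, i, j, g'). g \<otimes>\<^bsub>G\<^esub> s i [^]\<^bsub>G\<^esub> (j::nat) \<otimes>\<^bsub>G\<^esub> inv\<^bsub>G\<^esub> g') `
     (ball r \<times> I \<times> {..<k} \<times> ball r) in K \<union> (\<lambda>h. inv\<^bsub>G\<^esub> h) ` K)"

lemma finite_sepset: "finite (sepset r)"
  by (auto simp: sepset_def Let_def finite_ball I_def)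

lemma sepsetI:
  assumes "g \<in> ball r" "g' \<in> ball r" "i \<in> I"
  shows "g \<otimes>\<^bsub>G\<^esub> s i [^]\<^bsub>G\<^esub> (j::nat) \<otimes>\<^bsub>G\<^esub> inv\<^bsub>G\<^esub> g' \<in> sepset r"
    "inv\<^bsub>G\<^esub> (g \<otimes>\<^bsub>G\<^esub> s i [^]\<^bsub>G\<^esub> (j::nat) \<otimes>\<^bsub>G\<^esub> inv\<^bsub>G\<^esub> g') \<in> sepset r"
proof -
  have "g \<otimes>\<^bsub>G\<^esub> s i [^]\<^bsub>G\<^esub> (j mod k) \<otimes>\<^bsub>G\<^esub> inv\<^bsub>G\<^esub> g' \<in> (\<lambda>(g, i, j, g'). g \<otimes>\<^bsub>G\<^esub> s i [^]\<^bsub>G\<^esub> (j::nat) \<otimes>\<^bsub>G\<^esub> inv\<^bsub>G\<^esub> g') `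
     (ball r \<times> I \<times> {..<k} \<times> ball r)"
    by (rule image_eqI[of _ _ "(g, i, j mod k, g')"]) (use assms k_gt in auto)
  then show "g \<otimes>\<^bsub>G\<^esub> s i [^]\<^bsub>G\<^esub> (j::nat) \<otimes>\<^bsub>G\<^esub> inv\<^bsub>G\<^esub> g' \<in> sepset r"
    "inv\<^bsub>G\<^esub> (g \<otimes>\<^bsub>G\<^esub> s i [^]\<^bsub>G\<^esub> (j::nat) \<otimes>\<^bsub>G\<^esub> inv\<^bsub>G\<^esub> g') \<in> sepset r"
    unfolding sepset_def Let_def gen_pow_mod[OF assms(3)] by (rule UnI1, rule UnI2[OF imageI])
qed

text \<open>Uniform probability on admissible patterns. It is both the law of a random codeword seen
  from a good vertex (\<open>single_law\<close>) and the projection of Haar measure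
  (\<open>marginal\<close>), which links the model to the system.\<close>

definition bprob :: "nat \<Rightarrow> ((nat word set \<Rightarrow> bit) \<Rightarrow> bool) \<Rightarrow> real" where
  "bprob r Q = fprob (balls_code r) Q"

lemma finite_balls_code: "finite (balls_code r)"
proof (rule finite_subset)
  show "balls_code r \<subseteq> ball r \<rightarrow>\<^sub>E UNIV" by (auto simp: balls_code_def)
  have "(UNIV :: bit set) = {0, 1}" by (auto intro: bit_not_zero_iff[THEN iffD1])
  then have "finite (UNIV :: bit set)" by (metis finite.emptyI finite_insert)
  then show "finite (ball r \<rightarrow>\<^sub>E (UNIV :: bit set))" by (intro finite_PiE finite_ball)
qed

lemma zero_balls_code: "(\<lambda>g\<in>ball r. 0) \<in> balls_code r"
  by (auto simp: balls_code_def)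

lemma balls_code_nonempty: "balls_code r \<noteq> {}"
  using zero_balls_code by blast

end

context finite_model begin

section \<open>Density of separated sets and rarity of bad vertices\<close>

text \<open>For a separated set of maximal cardinality the translates by \<open>sepset r\<close>
  cover \<open>V0\<close>, since an uncovered vertex could be added.\<close>

lemma separated_exists:
  obtains S where "separated r S" "card V0 \<le> card S * card (sepset r)"
proof -
  have fin: "finite {S. separated r S}"
    by (rule finite_subset[of _ "Pow V0"]) (auto simp: separated_def finite_V0)
  have "{} \<in> {S. separated r S}" by (simp add: separated_def)
  then have "{S. separated r S} \<noteq> {}" by blast
  then obtain S where S: "separated r S" "\<And>S'. separated r S' \<Longrightarrow> card S' \<le> card S"
    using finite_imageI[OF fin, of card] Max_in[of "card ` {S. separated r S}"] Max_ge[of "card ` {S. separated r S}"]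
    by (smt (verit, best) image_iff image_is_empty mem_Collect_eq)
  have SV: "S \<subseteq> V0" using S(1) by (simp add: separated_def)
  then have finS: "finite S" using finite_V0 finite_subset by blast
  have "V0 \<subseteq> (\<lambda>(v, h). gact p h v) ` (S \<times> sepset r)"
  proof
    fix v assume v: "v \<in> V0"
    show "v \<in> (\<lambda>(v, h). gact p h v) ` (S \<times> sepset r)"
    proof (rule ccontr)
      assume "\<not> ?thesis"
      then have out: "gact p h w \<noteq> v" if "w \<in> S" "h \<in> sepset r" for w h using that by force
      have cc: "\<And>g. g \<in> ball r \<Longrightarrow> g \<in> carrier G" by (rule ball_carrier)
      have key: "w = v \<and> False" if h: "w \<in> S" "g \<in> ball r" "g' \<in> ball r" "i \<in> I"
        "gact p (g \<otimes>\<^bsub>G\<^esub> s i [^]\<^bsub>G\<^esub> (j::nat)) w = gact p g' v" for w g g' i j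
      proof -
        have "gact p (g \<otimes>\<^bsub>G\<^esub> s i [^]\<^bsub>G\<^esub> j \<otimes>\<^bsub>G\<^esub> inv\<^bsub>G\<^esub> g') w = v"
          using h cc SV v by (simp add: gact_mult[OF p_act, of _ "inv\<^bsub>G\<^esub> g'"] gact_inv[OF p_act] subset_iff)
        then show ?thesis using out[OF h(1) sepsetI(1)[OF h(2,3,4)]] by simp
      qed
      have key': "w = v \<and> False" if h: "w \<in> S" "g \<in> ball r" "g' \<in> ball r" "i \<in> I"
        "gact p (g \<otimes>\<^bsub>G\<^esub> s i [^]\<^bsub>G\<^esub> (j::nat)) v = gact p g' w" for w g g' i j
      proof -
        have c: "g \<otimes>\<^bsub>G\<^esub> s i [^]\<^bsub>G\<^esub> j \<otimes>\<^bsub>G\<^esub> inv\<^bsub>G\<^esub> g' \<in> carrier G" using h cc by simp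
        have "gact p (g \<otimes>\<^bsub>G\<^esub> s i [^]\<^bsub>G\<^esub> j \<otimes>\<^bsub>G\<^esub> inv\<^bsub>G\<^esub> g') v = w"
          using h cc SV v by (simp add: gact_mult[OF p_act, of _ "inv\<^bsub>G\<^esub> g'"] gact_inv[OF p_act] subset_iff)
        then have "gact p (inv\<^bsub>G\<^esub> (g \<otimes>\<^bsub>G\<^esub> s i [^]\<^bsub>G\<^esub> j \<otimes>\<^bsub>G\<^esub> inv\<^bsub>G\<^esub> g')) w = v"
          using gact_inv(1)[OF p_act c v] by simp
        then show ?thesis using out[OF h(1) sepsetI(2)[OF h(2,3,4)]] by simp
      qed
      have vS: "v \<notin> S"
      proof
        assume "v \<in> S"
        moreover have "1 \<in> I" using d_ge by (simp add: I_def)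
        ultimately show False using key[of v "\<one>\<^bsub>G\<^esub>" "\<one>\<^bsub>G\<^esub>" 1 0] by simp
      qed
      have "separated r (insert v S)"
        using S(1) v key key' unfolding separated_def by (metis insert_iff insert_subset)
      then show False using S(2) finS vS by fastforce
    qed
  qed
  then have "card V0 \<le> card (S \<times> sepset r)"
    by (rule surj_card_le[OF finite_cartesian_product[OF finS finite_sepset]])
  then show ?thesis using that[OF S(1)] by (simp add: card_cartesian_product)
qed

lemma finite_T: "finite T"
  unfolding T_def by (intro finite_PiE) (auto simp: finite_V0 I_def)

lemma finite_V: "finite V"
  by (simp add: V_def finite_V0 finite_T)

lemma T_nonempty: "T \<noteq> {}"
  using L_pos by (auto simp: T_def PiE_eq_empty_iff)

text \<open>Overwriting the entry at \<open>a\<close> by an arbitrary value below \<open>L\<close>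
  is injective on the slice, so the slice has density at most \<open>1 / L\<close>.\<close>

lemma card_T_slice:
  assumes a: "a \<in> V0 \<times> I"
  shows "card {\<beta> \<in> T. \<beta> a = L - 1} * L \<le> card T"
proof -
  have "card ({\<beta> \<in> T. \<beta> a = L - 1} \<times> {..<L}) \<le> card T"
  proof (rule card_inj_on_le[of "\<lambda>(\<beta>, c). \<beta>(a := c)"])
    show "inj_on (\<lambda>(\<beta>, c). \<beta>(a := c)) ({\<beta> \<in> T. \<beta> a = L - 1} \<times> {..<L})"
    proof (rule inj_onI, clarify)
      fix \<beta> c \<beta>' c' assume *: "\<beta> a = L - 1" "\<beta>' a = L - 1" "\<beta>(a := c) = \<beta>'(a := c')"
      have "\<beta> x = \<beta>' x" for x using fun_cong[OF *(3), of x] *(1,2) by (cases "x = a") simp_all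
      then show "\<beta> = \<beta>' \<and> c = c'" using fun_cong[OF *(3), of a] by auto
    qed
    show "(\<lambda>(\<beta>, c). \<beta>(a := c)) ` ({\<beta> \<in> T. \<beta> a = L - 1} \<times> {..<L}) \<subseteq> T"
      using a by (auto simp: T_def PiE_def extensional_def)
  qed (rule finite_T)
  then show ?thesis by (simp add: card_cartesian_product)
qed

text \<open>A point is determined by its vertex and the base of its hyperedge, so the base has a
  given entry equal to \<open>L - 1\<close> for at most a fraction \<open>1 / L\<close> of the
  points; then a union bound over the incidences.\<close>

lemma card_broken:
  assumes i: "i \<in> I"
  shows "card {u \<in> V. \<not> intact i u} * L \<le> card V0 * d * card V"
proof -
  let ?B = "\<lambda>a. {u \<in> V. dec (fst u, i) (snd u) a = L - 1}"
  have sub: "{u \<in> V. \<not> intact i u} \<subseteq> (\<Union>a\<in>V0 \<times> I. ?B a)"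
  proof
    fix u assume u: "u \<in> {u \<in> V. \<not> intact i u}"
    then obtain a where a: "a \<in> V0 \<times> I" "\<not> Suc (dec (fst u, i) (snd u) a) < L" by (auto simp: intact_def)
    have "dec (fst u, i) (snd u) \<in> T" using u i by (intro dec_T) (auto simp: V_def)
    then have "dec (fst u, i) (snd u) a < L" using a T_less by blast
    then have "dec (fst u, i) (snd u) a = L - 1" using a(2) by linarith
    then show "u \<in> (\<Union>a\<in>V0 \<times> I. ?B a)" using a(1) u by blast
  qed
  have B: "card (?B a) * L \<le> card V" if a: "a \<in> V0 \<times> I" for a
  proof -
    have "card (?B a) \<le> card (V0 \<times> {\<beta> \<in> T. \<beta> a = L - 1})"
    proof (rule card_inj_on_le[of "\<lambda>u. (fst u, dec (fst u, i) (snd u))"])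
      show "inj_on (\<lambda>u. (fst u, dec (fst u, i) (snd u))) (?B a)"
      proof (rule inj_onI)
        fix u u' assume *: "u \<in> ?B a" "u' \<in> ?B a" "(fst u, dec (fst u, i) (snd u)) = (fst u', dec (fst u', i) (snd u'))"
        then have e: "fst u = fst u'" "dec (fst u, i) (snd u) = dec (fst u', i) (snd u')"
          unfolding prod.inject by blast+
        then have "inc (fst u, i) (dec (fst u, i) (snd u)) = inc (fst u', i) (dec (fst u', i) (snd u'))"
          unfolding e(2) by (simp only: e(1))
        moreover have "(fst u, i) \<in> V0 \<times> I" "snd u \<in> T" "(fst u', i) \<in> V0 \<times> I" "snd u' \<in> T"
          using *(1,2) i by (auto simp: V_def)
        ultimately have "snd u = snd u'" by (simp only: inc_dec)
        then show "u = u'" using e(1) by (simp add: prod_eq_iff)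
      qed
      show "(\<lambda>u. (fst u, dec (fst u, i) (snd u))) ` ?B a \<subseteq> V0 \<times> {\<beta> \<in> T. \<beta> a = L - 1}"
        using i by (auto simp: V_def dec_T)
    qed (simp add: finite_V0 finite_T)
    then have "card (?B a) * L \<le> card V0 * (card {\<beta> \<in> T. \<beta> a = L - 1} * L)"
      by (simp add: card_cartesian_product mult.assoc[symmetric])
    also have "\<dots> \<le> card V0 * card T" using card_T_slice[OF a] by simp
    finally show ?thesis by (simp add: V_def card_cartesian_product)
  qed
  have "card {u \<in> V. \<not> intact i u} \<le> card (\<Union>a\<in>V0 \<times> I. ?B a)"
    using sub finite_V by (intro card_mono finite_subset[OF _ finite_V]) auto
  also have "\<dots> \<le> (\<Sum>a\<in>V0 \<times> I. card (?B a))"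
    by (rule card_UN_le) (simp add: finite_V0 I_def)
  finally have "card {u \<in> V. \<not> intact i u} * L \<le> (\<Sum>a\<in>V0 \<times> I. card (?B a) * L)"
    by (simp add: sum_distrib_right[symmetric])
  also have "\<dots> \<le> (\<Sum>a\<in>V0 \<times> I. card V)" by (intro sum_mono B)
  finally show ?thesis by (simp add: card_cartesian_product I_def mult.assoc)
qed

text \<open>Union bound over the ball and the types, each translation being injective on
  \<open>V\<close>. The bad fraction is at most a constant, depending on \<open>V0\<close> but not
  on \<open>L\<close>, divided by \<open>L\<close>.\<close>

lemma card_bad: "card {u \<in> V. \<not> good r u} * L \<le> card (ball r) * d * card V0 * d * card V"
proof -
  let ?B = "\<lambda>(g, i). {u \<in> V. \<not> intact i (gact q g u)}"
  have B: "card (?B (g, i)) * L \<le> card V0 * d * card V" if "g \<in> ball r" "i \<in> I" for g i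
  proof -
    have g: "g \<in> carrier G" using that ball_carrier by blast
    have "card (?B (g, i)) \<le> card {u \<in> V. \<not> intact i u}"
    proof (rule card_inj_on_le[of "gact q g"])
      show "inj_on (gact q g) (?B (g, i))"
        using gact_bij[OF q_act g] by (auto simp: bij_betw_def inj_on_def)
    qed (auto simp: gact_closed[OF q_act g] finite_V)
    then show ?thesis using card_broken[OF that(2)] by (meson le_trans mult_le_mono1)
  qed
  have "{u \<in> V. \<not> good r u} \<subseteq> (\<Union>z\<in>ball r \<times> I. ?B z)" by (auto simp: good_def)
  then have "card {u \<in> V. \<not> good r u} \<le> card (\<Union>z\<in>ball r \<times> I. ?B z)"
    using finite_V by (intro card_mono finite_subset[OF _ finite_V]) auto
  also have "\<dots> \<le> (\<Sum>z\<in>ball r \<times> I. card (?B z))"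
    by (rule card_UN_le) (simp add: finite_ball I_def)
  finally have "card {u \<in> V. \<not> good r u} * L \<le> (\<Sum>z\<in>ball r \<times> I. card (?B z) * L)"
    by (simp add: sum_distrib_right[symmetric])
  also have "\<dots> \<le> (\<Sum>z\<in>ball r \<times> I. card V0 * d * card V)"
    by (intro sum_mono) (use B in auto)
  finally show ?thesis by (simp add: card_cartesian_product I_def mult.assoc)
qed

section \<open>Exact laws of a uniformly random codeword\<close>

lemma finite_code: "finite code"
proof (rule finite_subset)
  show "code \<subseteq> V \<rightarrow>\<^sub>E UNIV" by (auto simp: code_def)
  have "(UNIV :: bit set) = {0, 1}" by (auto intro: bit_not_zero_iff[THEN iffD1])
  then have "finite (UNIV :: bit set)" by (metis finite.emptyI finite_insert)
  then show "finite (V \<rightarrow>\<^sub>E (UNIV :: bit set))" by (intro finite_PiE finite_V)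
qed

lemma zero_code: "(\<lambda>u\<in>V. 0) \<in> code"
  using is_act_pow[OF q_act] by (auto simp: code_def intro!: sum.neutral)

lemma code_nonempty: "code \<noteq> {}"
  using zero_code by blast

lemma code_add:
  assumes "x \<in> code" "y \<in> code"
  shows "(\<lambda>u\<in>V. x u + y u) \<in> code"
proof -
  have "(\<Sum>j<k. (\<lambda>u\<in>V. x u + y u) ((q i ^^ j) u)) = 0" if "u \<in> V" "i \<in> I" "intact i u" for u i
  proof -
    have "(\<Sum>j<k. (\<lambda>u\<in>V. x u + y u) ((q i ^^ j) u)) = (\<Sum>j<k. x ((q i ^^ j) u) + y ((q i ^^ j) u))"
      by (rule sum.cong[OF HOL.refl], rule restrict_apply', rule is_act_pow[OF q_act that(2,1)])
    also have "\<dots> = (\<Sum>j<k. x ((q i ^^ j) u)) + (\<Sum>j<k. y ((q i ^^ j) u))" by (rule sum.distrib)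
    also have "\<dots> = 0" using assms that by (simp add: code_def)
    finally show ?thesis .
  qed
  then show ?thesis by (auto simp: code_def)
qed

text \<open>The restriction \<rho> to the windows at \<open>Sg\<close> maps \<open>code\<close> onto
  all families of admissible patterns, and by linearity its fibres have equal size. So the windows
  are exactly independent and uniform.\<close>

lemma code_law:
  assumes sep: "separated r S" and r: "r \<le> R" and Sg: "Sg \<subseteq> S \<times> T"
    and good: "\<And>u. u \<in> Sg \<Longrightarrow> good r u"
  shows "fprob code (\<lambda>x. \<forall>u\<in>Sg. Q u (restrict (pull x u) (ball r))) = (\<Prod>u\<in>Sg. bprob r (Q u))"
proof -
  have S: "S \<subseteq> V0" using sep by (simp add: separated_def)
  have SgV: "Sg \<subseteq> V" using Sg S by (auto simp: V_def)
  have finSg: "finite Sg" using SgV finite_V finite_subset by blast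
  define \<rho> where "\<rho> x = (\<lambda>u\<in>Sg. restrict (pull x u) (ball r))" for x
  define Y where "Y = Sg \<rightarrow>\<^sub>E balls_code r"
  have finY: "finite Y" unfolding Y_def by (intro finite_PiE finSg finite_balls_code)
  have \<rho>Y: "\<rho> x \<in> Y" if "x \<in> code" for x
    using pull_code[OF that] SgV good by (auto simp: \<rho>_def Y_def)
  have surj: "\<exists>x\<in>code. \<rho> x = y" if y: "y \<in> Y" for y
  proof -
    \<comment> \<open>Windows outside \<open>Sg\<close> are filled with the zero pattern, because
      \<open>code_extend\<close> prescribes all windows over \<open>S\<close>.\<close>
    define a where "a u = (if u \<in> Sg then y u else (\<lambda>g\<in>ball r. 0))" for u
    have "a u \<in> balls_code r" for u
      using y zero_balls_code by (auto simp: a_def Y_def)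
    then obtain x where x: "x \<in> code" "\<forall>u\<in>S \<times> T. \<forall>g\<in>ball r. x (gact q g u) = a u g"
      using code_extend[OF sep r, of a] by blast
    have "\<rho> x u = y u" if u: "u \<in> Sg" for u
    proof (rule ext)
      fix g
      have "y u \<in> extensional (ball r)" using y u by (auto simp: Y_def balls_code_def PiE_def)
      moreover have "x (gact q g u) = y u g" if "g \<in> ball r"
        using x(2) Sg u that by (auto simp: a_def)
      ultimately show "\<rho> x u g = y u g"
        using u by (cases "g \<in> ball r") (simp_all add: \<rho>_def pull_def ball_carrier extensional_def)
    qed
    then have "\<rho> x = y"
      using y by (intro extensionalityI[of _ Sg]) (auto simp: \<rho>_def Y_def PiE_def)
    then show ?thesis by (rule bexI[OF _ x(1)])
  qed
  have le: "card {x \<in> code. \<rho> x = y} \<le> card {x \<in> code. \<rho> x = y'}" if y: "y \<in> Y" "y' \<in> Y" for y y'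
  proof -
    obtain z where z: "z \<in> code" "\<rho> z = y" using surj[OF y(1)] by blast
    obtain z' where z': "z' \<in> code" "\<rho> z' = y'" using surj[OF y(2)] by blast
    \<comment> \<open>Adding \<open>w\<close> exchanges the patterns \<open>y\<close> and
      \<open>y'\<close> since \<open>z + z = 0\<close>; it therefore embeds one fibre of \<rho> into
      the other.\<close>
    define w where "w = (\<lambda>u\<in>V. z u + z' u)"
    have w: "w \<in> code" unfolding w_def by (rule code_add[OF z(1) z'(1)])
    show ?thesis
    proof (rule card_inj_on_le[of "\<lambda>x. \<lambda>u\<in>V. x u + w u"])
      show "inj_on (\<lambda>x. \<lambda>u\<in>V. x u + w u) {x \<in> code. \<rho> x = y}"
      proof (rule inj_onI)
        fix x x' assume xx: "x \<in> {x \<in> code. \<rho> x = y}" "x' \<in> {x \<in> code. \<rho> x = y}"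
          and eq: "(\<lambda>u\<in>V. x u + w u) = (\<lambda>u\<in>V. x' u + w u)"
        show "x = x'"
        proof
          fix u show "x u = x' u"
          proof (cases "u \<in> V")
            case True
            then have "x u + w u = x' u + w u" using fun_cong[OF eq, of u] by (simp only: restrict_apply')
            then show ?thesis by (simp only: add_right_cancel)
          next
            case False
            have ex: "x \<in> extensional V" "x' \<in> extensional V" using xx by (auto simp: code_def PiE_def)
            show ?thesis by (simp only: extensional_arb[OF ex(1) False] extensional_arb[OF ex(2) False])
          qed
        qed
      qed
      have "\<rho> (\<lambda>u\<in>V. x u + w u) = y'" if x: "x \<in> code" "\<rho> x = y" for x
      proof -
        have e: "\<rho> x = \<rho> z" using x(2) z(2) by (simp only:)
        have "\<rho> (\<lambda>u\<in>V. x u + w u) u g = \<rho> z' u g" for u g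
        proof (cases "u \<in> Sg \<and> g \<in> ball r")
          case True
          have V: "gact q g u \<in> V"
            by (rule gact_closed[OF q_act ball_carrier subsetD[OF SgV]]) (use True in auto)
          have gc: "g \<in> carrier G" using True ball_carrier by blast
          have "x (gact q g u) = z (gact q g u)"
            using fun_cong[OF fun_cong[OF e, of u], of g] True gc by (simp add: \<rho>_def pull_def)
          moreover have "b + (b + c) = c" for b c :: bit by (cases b; cases c) simp_all
          ultimately have "(\<lambda>u\<in>V. x u + w u) (gact q g u) = z' (gact q g u)"
            unfolding w_def restrict_apply'[OF V] by (simp only:)
          then show ?thesis using True gc by (simp only: \<rho>_def pull_def restrict_apply')
        next
          case False
          then show ?thesis by (auto simp: \<rho>_def)
        qed
        then have "\<rho> (\<lambda>u\<in>V. x u + w u) = \<rho> z'" by (intro ext)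
        then show ?thesis using z'(2) by (simp only:)
      qed
      then show "(\<lambda>x. \<lambda>u\<in>V. x u + w u) ` {x \<in> code. \<rho> x = y} \<subseteq> {x \<in> code. \<rho> x = y'}"
        using code_add[OF _ w] by auto
    qed (simp add: finite_code)
  qed
  obtain y0 where y0: "y0 \<in> Y" using \<rho>Y zero_code by blast
  define N where "N = card {x \<in> code. \<rho> x = y0}"
  have N: "card {x \<in> code. \<rho> x = y} = N" if "y \<in> Y" for y
    unfolding N_def using le[OF that y0] le[OF y0 that] by simp
  have count: "card {x \<in> code. \<rho> x \<in> A} = N * card A" if A: "A \<subseteq> Y" for A
  proof -
    have finA: "finite A" using A finY finite_subset by blast
    have "{x \<in> code. \<rho> x \<in> A} = (\<Union>y\<in>A. {x \<in> code. \<rho> x = y})" by auto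
    also have "card \<dots> = (\<Sum>y\<in>A. card {x \<in> code. \<rho> x = y})"
      by (rule card_UN_disjoint) (auto simp: finA finite_code)
    also have "\<dots> = (\<Sum>y\<in>A. N)" using N A by (intro sum.cong) auto
    finally show ?thesis by simp
  qed
  have 1: "{x \<in> code. \<forall>u\<in>Sg. Q u (restrict (pull x u) (ball r))} = {x \<in> code. \<rho> x \<in> (\<Pi>\<^sub>E u\<in>Sg. {a \<in> balls_code r. Q u a})}"
    using \<rho>Y by (auto simp: \<rho>_def Y_def PiE_iff)
  have 2: "{x \<in> code. \<rho> x \<in> Y} = code" using \<rho>Y by auto
  have "N \<noteq> 0" using count[of Y] 2 finite_code code_nonempty by (auto simp: card_eq_0_iff)
  moreover have "(\<Pi>\<^sub>E u\<in>Sg. {a \<in> balls_code r. Q u a}) \<subseteq> Y" by (auto simp: Y_def PiE_iff)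
  ultimately have "fprob code (\<lambda>x. \<forall>u\<in>Sg. Q u (restrict (pull x u) (ball r))) =
      real (card (\<Pi>\<^sub>E u\<in>Sg. {a \<in> balls_code r. Q u a})) / real (card Y)"
    using count[of Y] 2 by (simp add: fprob_def 1 count)
  also have "\<dots> = (\<Prod>u\<in>Sg. bprob r (Q u))"
    by (simp add: card_PiE finSg Y_def bprob_def fprob_def prod_dividef)
  finally show ?thesis .
qed

lemma single_law:
  assumes r: "r \<le> R" and u: "u \<in> V" "good r u"
  shows "fprob code (\<lambda>x. Q (restrict (pull x u) (ball r))) = bprob r Q"
proof -
  have "separated r {fst u}" using u by (auto simp: separated_def V_def)
  then have "fprob code (\<lambda>x. \<forall>u\<in>{u}. Q (restrict (pull x u) (ball r))) = (\<Prod>u\<in>{u}. bprob r Q)"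
    by (rule code_law[OF _ r]) (use u in \<open>auto simp: V_def\<close>)
  then show ?thesis by simp
qed

text \<open>The inverse appears because \<open>gact\<close> is a right action while the shift is a
  left action: moving the viewpoint in the model shifts the configuration seen from it.\<close>

lemma pull_shift:
  assumes "u \<in> V" "g \<in> carrier G"
  shows "pull x (gact q (inv\<^bsub>G\<^esub> g) u) = shift_action d k g (pull x u)"
  using assms by (auto simp: pull_def shift_action_def fun_eq_iff gact_mult[OF q_act])

end

lemma restrict_eq_iff: "restrict f A = restrict g A \<longleftrightarrow> (\<forall>x\<in>A. f x = g x)"
  by (metis restrict_apply' restrict_ext)

context finite_model begin

text \<open>Three random fields on the model are compared: the values \<open>?y\<close> of
  \<open>F\<close> on \<open>Sg\<close>, the labels \<open>?z\<close> on all of \<open>V\<close>,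
  and the errors \<open>?e\<close> on \<open>Sg\<close>. The first has large entropy by independence
  and is a function of the other two, whose entropies are bounded vertex by vertex.\<close>

lemma entropy_inequality:
  fixes F :: "(nat word set \<Rightarrow> bit) \<Rightarrow> bool" and \<phi> :: "(nat word set \<Rightarrow> bit) \<Rightarrow> 'c"
    and \<psi> :: "(nat word set \<Rightarrow> 'c) \<Rightarrow> bool" and W :: "nat word set set"
  defines "\<Theta> \<equiv> \<lambda>x. \<psi> (\<lambda>g\<in>W. \<phi> (shift_action d k g x))"
  assumes sep: "separated r S" and r: "r \<le> R"
    and F: "\<And>x. F (restrict x (ball r)) = F x"
    and \<phi>: "\<And>x. \<phi> (restrict x (ball R)) = \<phi> x" and K: "finite K" "range \<phi> \<subseteq> K"
    and W: "W \<subseteq> carrier G" and \<Theta>: "\<And>x. \<Theta> (restrict x (ball R)) = \<Theta> x"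
    and \<theta>: "bprob r F \<le> \<theta>" "1 - bprob r F \<le> \<theta>" "0 < \<theta>"
  defines "err \<equiv> bprob R (\<lambda>x. F x \<noteq> \<Theta> x)"
  shows "real (card {u \<in> S \<times> T. good R u}) * (- ln \<theta> - (ent err + ent (1 - err))) \<le>
    real (card V) * (\<Sum>a\<in>K. ent (bprob R (\<lambda>x. \<phi> x = a))) + real (card {u \<in> V. \<not> good R u}) * real (card K)"
proof -
  note C = finite_code code_nonempty
  define Sg where "Sg = {u \<in> S \<times> T. good R u}"
  have SV: "S \<times> T \<subseteq> V" using sep by (auto simp: separated_def V_def)
  have SgV: "Sg \<subseteq> V" using SV by (auto simp: Sg_def)
  have finSg: "finite Sg" using SgV finite_V finite_subset by blast
  have good: "good r u" if "good R u" for u using that ball_mono[OF r] by (auto simp: good_def)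
  have rr: "restrict (restrict x (ball R)) (ball r) = restrict x (ball r)" for x :: "nat word set \<Rightarrow> bit"
    using ball_mono[OF r] by (auto simp: restrict_def fun_eq_iff)
  have FR: "F (restrict x (ball R)) = F x" for x
  proof -
    have "F (restrict x (ball R)) = F (restrict (restrict x (ball R)) (ball r))" by (rule F[symmetric])
    also have "\<dots> = F x" by (simp only: rr F)
    finally show ?thesis .
  qed
  let ?y = "\<lambda>x. \<lambda>u\<in>Sg. F (pull x u)"
  let ?z = "\<lambda>x. \<lambda>u\<in>V. \<phi> (pull x u)"
  let ?e = "\<lambda>x. \<lambda>u\<in>Sg. F (pull x u) \<noteq> \<Theta> (pull x u)"
  \<comment> \<open>By independence each value of \<open>?y\<close> has probability at most \<theta>
    to the power \<open>card Sg\<close>.\<close>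
  have "real (card Sg) * - ln \<theta> \<le> fent code ?y"
  proof (rule fent_ge[OF C \<theta>(3)])
    fix x assume x: "x \<in> code"
    have "fprob code (\<lambda>x'. ?y x' = ?y x) =
      fprob code (\<lambda>x'. \<forall>u\<in>Sg. (\<lambda>a. F a = F (pull x u)) (restrict (pull x' u) (ball r)))"
      by (simp only: restrict_eq_iff F)
    also have "\<dots> = (\<Prod>u\<in>Sg. bprob r (\<lambda>a. F a = F (pull x u)))"
      by (rule code_law[OF sep r]) (auto simp: Sg_def good)
    also have "\<dots> \<le> (\<Prod>u\<in>Sg. \<theta>)"
    proof (rule prod_mono)
      fix u
      have "bprob r (\<lambda>a. \<not> F a) = 1 - bprob r F"
        unfolding bprob_def by (rule fprob_not[OF finite_balls_code balls_code_nonempty])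
      then have "bprob r (\<lambda>a. F a = F (pull x u)) \<le> \<theta>"
        using \<theta>(1,2) by (cases "F (pull x u)") simp_all
      then show "0 \<le> bprob r (\<lambda>a. F a = F (pull x u)) \<and> bprob r (\<lambda>a. F a = F (pull x u)) \<le> \<theta>"
        by (simp add: bprob_def fprob_nonneg)
    qed
    finally show "fprob code (\<lambda>x'. ?y x' = ?y x) \<le> \<theta> ^ card Sg" by simp
  qed
  \<comment> \<open>The labels near \<open>u\<close> determine \<Theta> by
    \<open>pull_shift\<close>, and the error bit tells whether \<open>F\<close> agrees with
    it.\<close>
  also have "fent code ?y \<le> fent code (\<lambda>x. (?z x, ?e x))"
  proof (rule fent_mono[OF C])
    fix x x' assume eq: "(?z x, ?e x) = (?z x', ?e x')"
    have \<phi>eq: "\<phi> (pull x u) = \<phi> (pull x' u)" if "u \<in> V" for u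
      using eq that by (simp only: prod.inject restrict_eq_iff)
    have "F (pull x u) = F (pull x' u)" if u: "u \<in> Sg" for u
    proof -
      have uV: "u \<in> V" using u SgV by blast
      have "\<phi> (shift_action d k g (pull x u)) = \<phi> (shift_action d k g (pull x' u))" if "g \<in> W" for g
      proof -
        have g: "g \<in> carrier G" using that W by blast
        have "gact q (inv\<^bsub>G\<^esub> g) u \<in> V" using g uV by (intro gact_closed[OF q_act]) auto
        then show ?thesis using \<phi>eq pull_shift[OF uV g] by metis
      qed
      then have "(\<lambda>g\<in>W. \<phi> (shift_action d k g (pull x u))) = (\<lambda>g\<in>W. \<phi> (shift_action d k g (pull x' u)))"
        unfolding restrict_eq_iff by blast
      then have "\<Theta> (pull x u) = \<Theta> (pull x' u)" by (simp only: \<Theta>_def)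
      moreover have "(F (pull x u) \<noteq> \<Theta> (pull x u)) = (F (pull x' u) \<noteq> \<Theta> (pull x' u))"
        using eq u by (simp only: prod.inject restrict_eq_iff)
      ultimately show ?thesis by blast
    qed
    then show "?y x = ?y x'" unfolding restrict_eq_iff by blast
  qed
  also have "\<dots> \<le> fent code ?z + fent code ?e" by (rule fent_pair[OF C])
  also have "fent code ?z \<le> (\<Sum>u\<in>V. fent code (\<lambda>x. \<phi> (pull x u)))"
    by (rule fent_family[OF C finite_V])
  \<comment> \<open>At a good vertex the label has the law given by \<open>bprob R\<close>; at a bad
    one only the crude bound by \<open>card K\<close> is available.\<close>
  also have "\<dots> \<le> (\<Sum>u\<in>V. (\<Sum>a\<in>K. ent (bprob R (\<lambda>x. \<phi> x = a))) + (if good R u then 0 else real (card K)))"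
  proof (rule sum_mono)
    fix u assume u: "u \<in> V"
    have sub: "(\<lambda>x. \<phi> (pull x u)) ` code \<subseteq> K" using K by auto
    have nn: "0 \<le> (\<Sum>a\<in>K. ent (bprob R (\<lambda>x. \<phi> x = a)))"
      by (intro sum_nonneg ent_nonneg) (auto simp: bprob_def fprob_nonneg fprob_le_1 finite_balls_code)
    show "fent code (\<lambda>x. \<phi> (pull x u)) \<le> (\<Sum>a\<in>K. ent (bprob R (\<lambda>x. \<phi> x = a))) + (if good R u then 0 else real (card K))"
    proof (cases "good R u")
      case True
      have "fprob code (\<lambda>x. \<phi> (pull x u) = a) = bprob R (\<lambda>x. \<phi> x = a)" for a
        using single_law[OF order_refl u True, of "\<lambda>x. \<phi> x = a"] by (simp add: \<phi>)
      then show ?thesis using True by (simp add: fent_eq_sum[OF C K(1) sub])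
    next
      case False
      then show ?thesis using fent_le_card[OF C K(1) sub] nn by simp
    qed
  qed
  also have "\<dots> = real (card V) * (\<Sum>a\<in>K. ent (bprob R (\<lambda>x. \<phi> x = a))) + real (card {u \<in> V. \<not> good R u}) * real (card K)"
    using finite_V by (simp add: sum.distrib sum.If_cases Collect_neg_eq Diff_eq[symmetric] Int_def)
  also have "fent code ?e \<le> (\<Sum>u\<in>Sg. fent code (\<lambda>x. F (pull x u) \<noteq> \<Theta> (pull x u)))"
    by (rule fent_family[OF C finSg])
  also have "\<dots> = (\<Sum>u\<in>Sg. ent err + ent (1 - err))"
  proof (rule sum.cong)
    fix u assume u: "u \<in> Sg"
    have e: "fprob code (\<lambda>x. F (pull x u) \<noteq> \<Theta> (pull x u)) = err"
      using single_law[of R u "\<lambda>x. F x \<noteq> \<Theta> x"] u SgV by (auto simp: err_def Sg_def FR \<Theta>)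
    have "fprob code (\<lambda>x. \<not> (F (pull x u) \<noteq> \<Theta> (pull x u))) = 1 - err"
      by (subst fprob_not[OF C]) (simp only: e)
    then show "fent code (\<lambda>x. F (pull x u) \<noteq> \<Theta> (pull x u)) = ent err + ent (1 - err)"
      using e by (subst fent_eq_sum[OF C finite subset_UNIV]) (simp add: UNIV_bool)
  qed simp
  finally show ?thesis
    by (simp add: Sg_def algebra_simps)
qed

end

section \<open>Haar measure and approximation by cylinders\<close>

text \<open>A countable union is first truncated to a finite one up to \<open>e / 2\<close>, and the
  finitely many sets are then approximated with total error \<open>e / 2\<close>.\<close>

lemma (in prob_space) approx_sigma_algebra:
  assumes alg: "algebra (space M) \<A>" and sub: "\<A> \<subseteq> sets M"
  shows "sigma_algebra (space M) {A \<in> sets M. \<forall>e>0. \<exists>B\<in>\<A>. measure M (sym_diff A B) < e}"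
    (is "sigma_algebra _ ?C")
proof -
  interpret \<A>: algebra "space M" \<A> by (rule alg)
  show ?thesis
    unfolding sigma_algebra_iff2
  proof (intro conjI ballI allI impI)
    show "?C \<subseteq> Pow (space M)" using sets.sets_into_space by auto
    show "{} \<in> ?C" by (auto intro!: bexI[of _ "{}"])
  next
    fix A assume A: "A \<in> ?C"
    show "space M - A \<in> ?C"
    proof (intro CollectI conjI allI impI)
      show "space M - A \<in> sets M" using A by auto
      fix e :: real assume "0 < e"
      then obtain B where B: "B \<in> \<A>" "measure M (sym_diff A B) < e" using A by blast
      have "A \<subseteq> space M" "B \<subseteq> space M" using A B sub sets.sets_into_space by auto
      then have "sym_diff (space M - A) (space M - B) = sym_diff A B" by blast
      then show "\<exists>B\<in>\<A>. measure M (sym_diff (space M - A) B) < e"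
        using B by (intro bexI[of _ "space M - B"]) auto
    qed
  next
    fix A :: "nat \<Rightarrow> _" assume "range A \<subseteq> ?C"
    then have A: "\<And>n. A n \<in> sets M" "\<And>n e. 0 < e \<Longrightarrow> \<exists>B\<in>\<A>. measure M (sym_diff (A n) B) < e" by auto
    show "(\<Union>n. A n) \<in> ?C"
    proof (intro CollectI conjI allI impI)
      show "(\<Union>n. A n) \<in> sets M" using A by blast
      fix e :: real assume e: "0 < e"
      let ?U = "\<lambda>N. \<Union>n<N. A n"
      have "(\<lambda>N. measure M (?U N)) \<longlonglongrightarrow> measure M (\<Union>N. ?U N)"
        using A(1) by (intro finite_Lim_measure_incseq) (auto simp: incseq_def intro: order_less_le_trans)
      moreover have "(\<Union>N. ?U N) = (\<Union>n. A n)" by auto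
      ultimately have "\<forall>\<^sub>F N in sequentially. dist (measure M (?U N)) (measure M (\<Union>n. A n)) < e / 2"
        using e tendstoD[of _ "measure M (\<Union>n. A n)" sequentially "e / 2"] by simp
      then obtain N where "dist (measure M (?U N)) (measure M (\<Union>n. A n)) < e / 2"
        by (auto simp: eventually_sequentially)
      moreover have U: "?U N \<in> sets M" using A(1) by blast
      moreover have "measure M ((\<Union>n. A n) - ?U N) = measure M (\<Union>n. A n) - measure M (?U N)"
        using A(1) U by (intro finite_measure_Diff) auto
      ultimately have N: "measure M ((\<Union>n. A n) - ?U N) < e / 2" unfolding dist_real_def by linarith
      \<comment> \<open>The denominator uses \<open>N + 1\<close> instead of \<open>N\<close> so
        that it is positive also when \<open>N = 0\<close>.\<close>
      have "\<forall>n. \<exists>B\<in>\<A>. measure M (sym_diff (A n) B) < e / (2 * (real N + 1))"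
        using A(2) e by simp
      then obtain B where B: "\<And>n. B n \<in> \<A>" "\<And>n. measure M (sym_diff (A n) (B n)) < e / (2 * (real N + 1))"
        by metis
      have Bs: "B n \<in> sets M" for n using B(1) sub by blast
      have BU: "(\<Union>n<N. B n) \<in> \<A>" using B(1) by auto
      have "measure M (sym_diff (\<Union>n. A n) (\<Union>n<N. B n)) \<le>
        measure M (((\<Union>n. A n) - ?U N) \<union> (\<Union>n<N. sym_diff (A n) (B n)))"
        using A(1) Bs by (intro finite_measure_mono) auto
      also have "\<dots> \<le> measure M ((\<Union>n. A n) - ?U N) + measure M (\<Union>n<N. sym_diff (A n) (B n))"
        using A(1) Bs by (intro measure_Un_le) auto
      also have "measure M (\<Union>n<N. sym_diff (A n) (B n)) \<le> (\<Sum>n<N. measure M (sym_diff (A n) (B n)))"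
        using A(1) Bs by (intro measure_UNION_le) auto
      also have "\<dots> \<le> (\<Sum>n<N. e / (2 * (real N + 1)))" using B(2) by (intro sum_mono) (simp add: less_imp_le)
      also have "\<dots> \<le> e / 2" using e by (simp add: field_simps)
      finally have "measure M (sym_diff (\<Union>n. A n) (\<Union>n<N. B n)) < e" using N by simp
      then show "\<exists>B\<in>\<A>. measure M (sym_diff (\<Union>n. A n) B) < e" using BU by blast
    qed
  qed
qed

context cyclic_product begin

definition cyl :: "nat \<Rightarrow> ((nat word set \<Rightarrow> bit) \<Rightarrow> 'c) \<Rightarrow> bool" where
  "cyl r f \<longleftrightarrow> (\<forall>x. f (restrict x (ball r)) = f x)"

lemma cyl_mono: "cyl r f \<Longrightarrow> r \<le> r' \<Longrightarrow> cyl r' f"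
proof -
  assume f: "cyl r f" and r: "r \<le> r'"
  have "restrict (restrict x (ball r')) (ball r) = restrict x (ball r)" for x :: "nat word set \<Rightarrow> bit"
    using ball_mono[OF r] by (auto simp: restrict_def fun_eq_iff)
  then show "cyl r' f" using f unfolding cyl_def by metis
qed

lemma cyl_comp2: "cyl r f \<Longrightarrow> cyl r g \<Longrightarrow> cyl r (\<lambda>x. h (f x) (g x))"
  by (simp add: cyl_def)

lemma cyl_comp: "cyl r f \<Longrightarrow> cyl r (\<lambda>x. h (f x))"
  by (simp add: cyl_def)

lemma Xset_add: "x \<in> Xset d k \<Longrightarrow> y \<in> Xset d k \<Longrightarrow> (\<lambda>g\<in>carrier G. x g + y g) \<in> Xset d k"
  unfolding Xset_alt by (auto simp: sum.distrib simp del: add_bit_eq_xor)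

end

section \<open>Haar measure on cylinder events\<close>

locale haar_code = cyclic_product d k for d k +
  fixes m :: "(nat word set \<Rightarrow> bit) measure"
  assumes haar: "haar_prob_measure d k m"
begin

abbreviation "X \<equiv> Xset d k"
abbreviation "tr \<equiv> shift_action d k"

sublocale prob_space m
  using haar by (simp add: haar_prob_measure_def)

lemma sets_m: "sets m = sets (restrict_space (Pi\<^sub>M (carrier G) (\<lambda>_. count_space UNIV)) X)"
  using haar by (simp add: haar_prob_measure_def)

lemma space_m [simp]: "space m = X"
  by (simp add: sets_eq_imp_space_eq[OF sets_m] space_restrict_space space_PiM) (auto simp: Xset_def)

lemma coordinate_measurable:
  assumes "sets N = sets m" "g \<in> carrier G"
  shows "(\<lambda>x. x g) \<in> measurable N (count_space UNIV)"
proof -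
  have "(\<lambda>x. x g) \<in> measurable (restrict_space (Pi\<^sub>M (carrier G) (\<lambda>_. count_space UNIV)) X) (count_space UNIV)"
    using assms(2) by (intro measurable_restrict_space1 measurable_component_singleton)
  then show ?thesis using assms(1) sets_m by (simp cong: measurable_cong_sets)
qed

lemma measurable_into:
  assumes "sets N = sets m"
    and "\<And>g. g \<in> carrier G \<Longrightarrow> h g \<in> measurable M (count_space UNIV)"
    and "\<And>x. x \<in> space M \<Longrightarrow> (\<lambda>g\<in>carrier G. h g x) \<in> X"
  shows "(\<lambda>x. \<lambda>g\<in>carrier G. h g x) \<in> measurable M N"
proof -
  have "(\<lambda>x. \<lambda>g\<in>carrier G. h g x) \<in> measurable M (restrict_space (Pi\<^sub>M (carrier G) (\<lambda>_. count_space UNIV)) X)"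
    using assms(2,3) by (intro measurable_restrict_space2 measurable_restrict) auto
  then show ?thesis using assms(1) sets_m by (simp cong: measurable_cong_sets)
qed

lemma cyl_sets:
  assumes N: "sets N = sets m" and Q: "cyl r Q"
  shows "{x \<in> X. Q x} \<in> sets N"
proof -
  have spN: "space N = X" using sets_eq_imp_space_eq[OF N] by simp
  define A where "A = {a \<in> balls_code r. Q a}"
  have "{x \<in> X. Q x} = (\<Union>a\<in>A. {x \<in> space N. \<forall>g\<in>ball r. x g = a g})"
  proof (intro equalityI subsetI)
    fix x assume x: "x \<in> {x \<in> X. Q x}"
    then have "restrict x (ball r) \<in> A" using restrict_Xset Q by (auto simp: A_def cyl_def)
    then show "x \<in> (\<Union>a\<in>A. {x \<in> space N. \<forall>g\<in>ball r. x g = a g})" using x spN by (intro UN_I) auto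
  next
    fix x assume "x \<in> (\<Union>a\<in>A. {x \<in> space N. \<forall>g\<in>ball r. x g = a g})"
    then obtain a where a: "a \<in> A" "x \<in> X" "\<forall>g\<in>ball r. x g = a g" using spN by auto
    then have "restrict x (ball r) = restrict a (ball r)" by (auto simp: restrict_def fun_eq_iff)
    then have "Q x = Q a" using Q unfolding cyl_def by metis
    then show "x \<in> {x \<in> X. Q x}" using a by (auto simp: A_def)
  qed
  moreover have "{x \<in> space N. \<forall>g\<in>ball r. x g = a g} \<in> sets N" for a
  proof (rule sets.sets_Collect_finite_All[OF _ finite_ball])
    fix g assume "g \<in> ball r"
    then have "(\<lambda>x. x g) \<in> measurable N (count_space UNIV)"
      using coordinate_measurable[OF N] ball_carrier by blast
    from measurable_sets[OF this, of "{a g}"] show "{x \<in> space N. x g = a g} \<in> sets N"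
      by (simp add: vimage_def Int_def conj_commute)
  qed
  moreover have "finite A" unfolding A_def using finite_balls_code by simp
  ultimately show ?thesis by auto
qed

lemma translate_measurable: "y \<in> X \<Longrightarrow> (\<lambda>x. \<lambda>g\<in>carrier G. y g + x g) \<in> measurable m m"
proof (rule measurable_into)
  fix g assume "g \<in> carrier G"
  have "(\<lambda>b. y g + b) \<in> measurable (count_space UNIV) (count_space UNIV)"
    by (simp only: measurable_count_space_eq1) auto
  from measurable_compose[OF coordinate_measurable[OF HOL.refl \<open>g \<in> carrier G\<close>] this]
  show "(\<lambda>x. y g + x g) \<in> measurable m (count_space UNIV)" .
qed (use Xset_add in auto)

text \<open>Translation by the sum of extensions of \<open>a\<close> and \<open>b\<close> carries
  the cylinder of \<open>a\<close> to that of \<open>b\<close>. By invariance all admissible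
  patterns are equally likely, and they exhaust \<open>X\<close>.\<close>

lemma marginal:
  assumes Q: "cyl r Q"
  shows "measure m {x \<in> X. Q x} = bprob r Q"
proof -
  let ?c = "\<lambda>a. {x \<in> X. restrict x (ball r) = a}"
  have c: "cyl r (\<lambda>x. restrict x (ball r) = a)" for a
    by (auto simp: cyl_def restrict_def fun_eq_iff)
  have c_sets: "?c a \<in> sets m" for a by (rule cyl_sets[OF HOL.refl c])
  have le: "measure m (?c a) = measure m (?c b)" if a: "a \<in> balls_code r" and b: "b \<in> balls_code r" for a b
  proof -
    obtain xa where xa: "xa \<in> X" "restrict xa (ball r) = a" using balls_code_extend[OF a] by blast
    obtain xb where xb: "xb \<in> X" "restrict xb (ball r) = b" using balls_code_extend[OF b] by blast
    define y where "y = (\<lambda>g\<in>carrier G. xa g + xb g)"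
    define \<tau> where "\<tau> x = (\<lambda>g\<in>carrier G. y g + x g)" for x
    have y: "y \<in> X" unfolding y_def by (rule Xset_add[OF xa(1) xb(1)])
    have meas: "\<tau> \<in> measurable m m" unfolding \<tau>_def by (rule translate_measurable[OF y])
    have bb: "p + q + p = q" for p q :: bit by (cases p; cases q) simp_all
    have bb': "p + q + r = q \<longleftrightarrow> r = p" for p q r :: bit by (cases p; cases q; cases r) simp_all
    have "\<tau> -` ?c b \<inter> X = ?c a"
    proof -
      have "restrict (\<tau> x) (ball r) = b \<longleftrightarrow> restrict x (ball r) = a" for x
      proof -
        have "restrict (\<tau> x) (ball r) = restrict xb (ball r) \<longleftrightarrow> (\<forall>g\<in>ball r. xa g + xb g + x g = xb g)"
          using ball_carrier by (auto simp: restrict_def fun_eq_iff \<tau>_def y_def simp del: plus_bit_def)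
        also have "\<dots> \<longleftrightarrow> (\<forall>g\<in>ball r. x g = xa g)" by (simp only: bb')
        also have "\<dots> \<longleftrightarrow> restrict x (ball r) = restrict xa (ball r)"
          by (auto simp: restrict_def fun_eq_iff)
        finally show ?thesis by (simp only: xa xb)
      qed
      moreover have "\<tau> x \<in> X" if "x \<in> X" for x using measurable_space[OF meas] that by simp
      ultimately show ?thesis by auto
    qed
    moreover have "distr m m \<tau> = m"
      using haar y unfolding haar_prob_measure_def \<tau>_def by blast
    ultimately show ?thesis
      using measure_distr[OF meas c_sets[of b]] by simp
  qed
  define p where "p = measure m (?c (\<lambda>g\<in>ball r. 0))"
  have p: "measure m (?c a) = p" if "a \<in> balls_code r" for a
    unfolding p_def by (rule le[OF that zero_balls_code])
  have count: "measure m {x \<in> X. Q x} = real (card {a \<in> balls_code r. Q a}) * p" if Q: "cyl r Q" for Q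
  proof -
    have "{x \<in> X. Q x} = (\<Union>a\<in>{a \<in> balls_code r. Q a}. ?c a)"
      using Q restrict_Xset by (auto simp: cyl_def)
    also have "measure m \<dots> = (\<Sum>a\<in>{a \<in> balls_code r. Q a}. measure m (?c a))"
      by (rule finite_measure_finite_Union) (auto simp: finite_balls_code disjoint_family_on_def intro: c_sets)
    also have "\<dots> = (\<Sum>a\<in>{a \<in> balls_code r. Q a}. p)" by (intro sum.cong) (auto simp: p)
    finally show ?thesis by simp
  qed
  have "real (card (balls_code r)) * p = 1"
    using count[of "\<lambda>_. True"] prob_space by (simp add: cyl_def)
  moreover have "card (balls_code r) \<noteq> 0" using finite_balls_code balls_code_nonempty by simp
  ultimately have "p = 1 / real (card (balls_code r))" by (simp add: field_simps)
  then show ?thesis using count[OF Q] by (simp add: bprob_def fprob_def)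
qed

definition cylinders :: "(nat word set \<Rightarrow> bit) set set" where
  "cylinders = {{x \<in> X. Q x} | Q. \<exists>r. cyl r Q}"

lemma cylindersI: "cyl r Q \<Longrightarrow> {x \<in> X. Q x} \<in> cylinders"
  unfolding cylinders_def by blast

lemma restrict_X: "x \<in> X \<Longrightarrow> restrict x (carrier G) = x"
  unfolding Xset_def by (intro PiE_restrict) blast

lemma cylindersE:
  assumes "A \<in> cylinders"
  obtains Q r where "A = {x \<in> X. Q x}" "cyl r Q"
  using assms unfolding cylinders_def by (elim CollectE exE conjE)

lemma cylinders_algebra: "algebra X cylinders"
  unfolding algebra_iff_Int
proof (intro conjI ballI)
  show "cylinders \<subseteq> Pow X" by (auto simp: cylinders_def)
  show "{} \<in> cylinders" using cylindersI[of 0 "\<lambda>_. False"] by (simp add: cyl_def)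
next
  fix A assume "A \<in> cylinders"
  then obtain Q r where Q: "A = {x \<in> X. Q x}" "cyl r Q" by (rule cylindersE)
  have "X - A = {x \<in> X. \<not> Q x}" using Q(1) by blast
  then show "X - A \<in> cylinders" using cylindersI[OF cyl_comp[OF Q(2), of Not]] by (simp only:)
next
  fix A B assume A: "A \<in> cylinders" and B: "B \<in> cylinders"
  obtain Q r where Q: "A = {x \<in> X. Q x}" "cyl r Q" using A by (rule cylindersE)
  obtain Q' r' where Q': "B = {x \<in> X. Q' x}" "cyl r' Q'" using B by (rule cylindersE)
  have "cyl (max r r') Q" "cyl (max r r') Q'" using cyl_mono[OF Q(2)] cyl_mono[OF Q'(2)] by simp_all
  then have "cyl (max r r') (\<lambda>x. Q x \<and> Q' x)" by (rule cyl_comp2)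
  moreover have "A \<inter> B = {x \<in> X. Q x \<and> Q' x}" using Q(1) Q'(1) by blast
  ultimately show "A \<inter> B \<in> cylinders" using cylindersI by (simp only:)
qed

lemma cylinders_sets: "cylinders \<subseteq> sets m"
proof
  fix A assume "A \<in> cylinders"
  then obtain Q r where "A = {x \<in> X. Q x}" "cyl r Q" by (rule cylindersE)
  then show "A \<in> sets m" using cyl_sets[OF HOL.refl] by (simp only:)
qed

lemma sets_m_cylinders: "sets m = sigma_sets X cylinders"
proof
  show "sigma_sets X cylinders \<subseteq> sets m"
    using sets.sigma_sets_subset[OF cylinders_sets] by simp
  define N where "N = sigma X cylinders"
  have cyl_Pow: "cylinders \<subseteq> Pow X" by (auto simp: cylinders_def)
  have spN: "space N = X" and setsN: "sets N = sigma_sets X cylinders"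
    unfolding N_def by (simp_all only: space_measure_of[OF cyl_Pow] sets_measure_of[OF cyl_Pow])
  have "(\<lambda>x. \<lambda>g\<in>carrier G. x g) \<in> measurable N m"
  proof (rule measurable_into[OF HOL.refl])
    fix g assume g: "g \<in> carrier G"
    show "(\<lambda>x. x g) \<in> measurable N (count_space UNIV)"
    proof (rule measurableI)
      fix B :: "bit set"
      have "cyl (length (nf g)) (\<lambda>x. x g \<in> B)" using g by (simp add: cyl_def ball_def)
      then have "{x \<in> X. x g \<in> B} \<in> cylinders" by (rule cylindersI)
      moreover have "(\<lambda>x. x g) -` B \<inter> space N = {x \<in> X. x g \<in> B}" by (auto simp: spN)
      ultimately show "(\<lambda>x. x g) -` B \<inter> space N \<in> sets N" by (simp add: setsN)
    qed simp
  next
    fix x assume "x \<in> space N"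
    then have x: "x \<in> X" by (simp add: spN)
    then show "restrict x (carrier G) \<in> X" by (simp only: restrict_X)
  qed
  then have id: "(\<lambda>x. x) \<in> measurable N m"
  proof (subst measurable_cong)
    fix x assume "x \<in> space N"
    then show "x = restrict x (carrier G)" unfolding spN by (simp only: restrict_X)
  qed
  show "sets m \<subseteq> sigma_sets X cylinders"
  proof
    fix A assume A: "A \<in> sets m"
    then have "A \<subseteq> X" using sets.sets_into_space[OF A] by simp
    then show "A \<in> sigma_sets X cylinders" using measurable_sets[OF id A] by (simp add: spN setsN Int_absorb2)
  qed
qed

lemma cylinder_approx:
  assumes "A \<in> sets m" "0 < e"
  obtains Q r where "cyl r Q" "measure m (sym_diff A {x \<in> X. Q x}) < e"
proof -
  have "sigma_algebra X {A \<in> sets m. \<forall>e>0. \<exists>B\<in>cylinders. measure m (sym_diff A B) < e}" (is "sigma_algebra X ?C")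
    using approx_sigma_algebra[OF _ cylinders_sets] cylinders_algebra by simp
  moreover have "cylinders \<subseteq> ?C"
  proof (intro subsetI CollectI conjI allI impI)
    fix B assume B: "B \<in> cylinders"
    then show "B \<in> sets m" by (rule subsetD[OF cylinders_sets])
    show "\<exists>B'\<in>cylinders. measure m (sym_diff B B') < e" if "0 < e" for e :: real
      by (rule bexI[OF _ B]) (use that in simp)
  qed
  ultimately have "sigma_sets X cylinders \<subseteq> ?C" by (rule sigma_algebra.sigma_sets_subset)
  then have "A \<in> ?C" using assms(1) sets_m_cylinders by (rule_tac subsetD) simp_all
  then have "\<exists>B\<in>cylinders. measure m (sym_diff A B) < e" using assms(2) by simp
  then obtain B where B: "B \<in> cylinders" "measure m (sym_diff A B) < e" by (elim bexE)
  obtain Q r where "B = {x \<in> X. Q x}" "cyl r Q" using B(1) by (rule cylindersE)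
  then show ?thesis using that B(2) by simp
qed

end

text \<open>\<open>marginal\<close> gives any Haar measure the same values on cylinders, a
  generating system stable under intersection.\<close>

lemma (in haar_code) haar_unique:
  assumes "haar_prob_measure d k m'"
  shows "m' = m"
proof -
  interpret m': haar_code d k m' by unfold_locales (rule assms)
  show ?thesis
  proof (rule measure_eqI_generator_eq[of cylinders X _ _ "\<lambda>_. X"])
    show "Int_stable cylinders"
      using cylinders_algebra by (auto simp: Int_stable_def algebra_iff_Int)
    show "cylinders \<subseteq> Pow X" by (auto simp: cylinders_def)
    show "emeasure m' A = emeasure m A" if "A \<in> cylinders" for A
      using that marginal m'.marginal
      by (auto simp: cylinders_def emeasure_eq_measure m'.emeasure_eq_measure)
    show "sets m' = sigma_sets X cylinders"
      using m'.sets_m_cylinders by (simp add: m'.cylinders_def cylinders_def)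
    show "sets m = sigma_sets X cylinders" by (rule sets_m_cylinders)
    have "{x \<in> X. True} \<in> cylinders" unfolding cylinders_def by (intro CollectI exI[of _ "\<lambda>_. True"]) (auto simp: cyl_def)
    then show "range (\<lambda>_. X) \<subseteq> cylinders" by auto
    show "emeasure m' X \<noteq> \<infinity>" using m'.emeasure_finite by simp
  qed auto
qed

section \<open>Invariance of Haar measure under the shift\<close>

context haar_code begin

lemma shift_X: "g \<in> carrier G \<Longrightarrow> x \<in> X \<Longrightarrow> tr g x \<in> X"
proof -
  assume g: "g \<in> carrier G" and x: "x \<in> X"
  have "(\<Sum>j<k. tr g x (h \<otimes>\<^bsub>G\<^esub> s i [^]\<^bsub>G\<^esub> j)) = 0" if "h \<in> carrier G" "i \<in> I" for h i
  proof -
    have "(\<Sum>j<k. tr g x (h \<otimes>\<^bsub>G\<^esub> s i [^]\<^bsub>G\<^esub> j)) = (\<Sum>j<k. x ((inv\<^bsub>G\<^esub> g \<otimes>\<^bsub>G\<^esub> h) \<otimes>\<^bsub>G\<^esub> s i [^]\<^bsub>G\<^esub> j))"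
      using that g by (intro sum.cong) (auto simp: shift_action_def m_assoc)
    then show ?thesis using x g that by (simp add: Xset_alt)
  qed
  then show ?thesis by (auto simp: Xset_alt shift_action_def)
qed

lemma shift_shift:
  "g \<in> carrier G \<Longrightarrow> h \<in> carrier G \<Longrightarrow> tr h (tr g x) = tr (h \<otimes>\<^bsub>G\<^esub> g) x"
  by (auto simp: shift_action_def fun_eq_iff inv_mult_group m_assoc)

lemma shift_one: "x \<in> X \<Longrightarrow> tr \<one>\<^bsub>G\<^esub> x = x"
  by (auto simp: shift_action_def fun_eq_iff Xset_def PiE_def extensional_def)

lemma shift_measurable: "g \<in> carrier G \<Longrightarrow> tr g \<in> measurable m m"
  unfolding shift_action_def
proof (rule measurable_into[OF HOL.refl])
  fix x assume "g \<in> carrier G" "x \<in> space m"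
  then show "(\<lambda>h\<in>carrier G. x (inv\<^bsub>G\<^esub> g \<otimes>\<^bsub>G\<^esub> h)) \<in> X"
    using shift_X[of g x] by (simp add: shift_action_def)
qed (auto intro: coordinate_measurable[OF HOL.refl])

text \<open>The shift intertwines translation by \<open>y'\<close> with translation by
  \<open>y\<close>, where \<open>y'\<close> is \<open>y\<close> shifted back. Hence the image
  measure is again a Haar measure, and uniqueness applies.\<close>

lemma shift_invariant:
  assumes g: "g \<in> carrier G"
  shows "distr m m (tr g) = m"
proof (rule haar_unique)
  have sm: "tr g \<in> measurable m m" by (rule shift_measurable[OF g])
  show "haar_prob_measure d k (distr m m (tr g))"
    unfolding haar_prob_measure_def
  proof (intro conjI ballI)
    show "prob_space (distr m m (tr g))" by (rule prob_space_distr[OF sm])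
    show "sets (distr m m (tr g)) = sets (restrict_space (Pi\<^sub>M (carrier G) (\<lambda>_. count_space UNIV)) X)"
      by (simp add: sets_m)
    fix y assume y: "y \<in> X"
    let ?\<tau> = "\<lambda>y x. \<lambda>h\<in>carrier G. y h + x h"
    define y' where "y' = tr (inv\<^bsub>G\<^esub> g) y"
    have y': "y' \<in> X" unfolding y'_def using g y by (intro shift_X) auto
    have tm: "?\<tau> y \<in> measurable m m" "?\<tau> y' \<in> measurable m m" using translate_measurable y y' by auto
    have "distr (distr m m (tr g)) (distr m m (tr g)) (?\<tau> y) = distr (distr m m (tr g)) m (?\<tau> y)"
      by (rule distr_cong) auto
    also have "\<dots> = distr m m (?\<tau> y \<circ> tr g)" by (rule distr_distr[OF tm(1) sm])
    also have "\<dots> = distr m m (tr g \<circ> ?\<tau> y')"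
    proof (rule distr_cong)
      fix x assume "x \<in> space m"
      have "y h + tr g x h = tr g (?\<tau> y' x) h" if h: "h \<in> carrier G" for h
      proof -
        have "y' (inv\<^bsub>G\<^esub> g \<otimes>\<^bsub>G\<^esub> h) = y h"
          using g h by (simp add: y'_def shift_action_def m_assoc[symmetric])
        moreover have "inv\<^bsub>G\<^esub> g \<otimes>\<^bsub>G\<^esub> h \<in> carrier G" using g h by simp
        ultimately show ?thesis using h by (simp only: shift_action_def restrict_apply')
      qed
      then show "(?\<tau> y \<circ> tr g) x = (tr g \<circ> ?\<tau> y') x"
        by (simp add: fun_eq_iff restrict_def) (simp add: shift_action_def)
    qed auto
    also have "\<dots> = distr (distr m m (?\<tau> y')) m (tr g)" by (rule distr_distr[OF sm tm(2), symmetric])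
    also have "distr m m (?\<tau> y') = m" using haar y' unfolding haar_prob_measure_def by blast
    finally show "distr (distr m m (tr g)) (distr m m (tr g)) (?\<tau> y) = distr m m (tr g)" .
  qed
qed

lemma measure_shift:
  assumes "g \<in> carrier G" "A \<in> sets m"
  shows "measure m (tr g -` A \<inter> X) = measure m A"
  using measure_distr[OF shift_measurable[OF assms(1)] assms(2)] shift_invariant[OF assms(1)] by simp

section \<open>Approximation of generated sets by finite windows\<close>

text \<open>A semantic description of membership in the algebra generated by the
  \<open>W\<close>-translates of \<open>P\<close>, which avoids explicit Boolean
  combinations.\<close>

definition determined :: "nat word set set \<Rightarrow> (nat word set \<Rightarrow> bit) set set \<Rightarrow> (nat word set \<Rightarrow> bit) set \<Rightarrow> bool" where
  "determined W P B \<longleftrightarrow> (\<forall>x\<in>X. \<forall>y\<in>X.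
     (\<forall>g\<in>W. \<forall>C\<in>P. tr g x \<in> C \<longleftrightarrow> tr g y \<in> C) \<longrightarrow> (x \<in> B \<longleftrightarrow> y \<in> B))"

lemma determinedI:
  "(\<And>x y. x \<in> X \<Longrightarrow> y \<in> X \<Longrightarrow> \<forall>g\<in>W. \<forall>C\<in>P. tr g x \<in> C \<longleftrightarrow> tr g y \<in> C \<Longrightarrow> x \<in> B \<longleftrightarrow> y \<in> B) \<Longrightarrow>
    determined W P B"
  unfolding determined_def by (intro ballI impI)

lemma determinedD:
  "determined W P B \<Longrightarrow> x \<in> X \<Longrightarrow> y \<in> X \<Longrightarrow>
    \<forall>g\<in>W. \<forall>C\<in>P. tr g x \<in> C \<longleftrightarrow> tr g y \<in> C \<Longrightarrow> x \<in> B \<longleftrightarrow> y \<in> B"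
  by (rule determined_def[THEN iffD1, THEN bspec, THEN bspec, THEN mp])

lemma determined_compl:
  assumes "determined W P B"
  shows "determined W P (X - B)"
proof (rule determinedI)
  fix x y assume xy: "x \<in> X" "y \<in> X" and eq: "\<forall>g\<in>W. \<forall>C\<in>P. tr g x \<in> C \<longleftrightarrow> tr g y \<in> C"
  show "x \<in> X - B \<longleftrightarrow> y \<in> X - B" using determinedD[OF assms xy eq] xy by simp
qed

lemma determined_Int:
  assumes B: "determined W P B" and B': "determined W' P' B'"
  shows "determined (W \<union> W') (P \<union> P') (B \<inter> B')"
proof (rule determinedI)
  fix x y assume xy: "x \<in> X" "y \<in> X" and eq: "\<forall>g\<in>W \<union> W'. \<forall>C\<in>P \<union> P'. tr g x \<in> C \<longleftrightarrow> tr g y \<in> C"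
  have "x \<in> B \<longleftrightarrow> y \<in> B" by (rule determinedD[OF B xy]) (use eq in simp)
  moreover have "x \<in> B' \<longleftrightarrow> y \<in> B'" by (rule determinedD[OF B' xy]) (use eq in simp)
  ultimately show "x \<in> B \<inter> B' \<longleftrightarrow> y \<in> B \<inter> B'" by simp
qed

definition finitely_determined :: "(nat word set \<Rightarrow> bit) set set \<Rightarrow> (nat word set \<Rightarrow> bit) set set" where
  "finitely_determined P = {B \<in> sets m. \<exists>W P'. finite W \<and> W \<subseteq> carrier G \<and> finite P' \<and> P' \<subseteq> P \<and>
     determined W P' B}"

lemma finitely_determinedI:
  "B \<in> sets m \<Longrightarrow> finite W \<Longrightarrow> W \<subseteq> carrier G \<Longrightarrow> finite P' \<Longrightarrow> P' \<subseteq> P \<Longrightarrow> determined W P' B \<Longrightarrow>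
    B \<in> finitely_determined P"
  unfolding finitely_determined_def by (intro CollectI conjI exI)

lemma finitely_determinedE:
  assumes "B \<in> finitely_determined P"
  obtains W P' where "B \<in> sets m" "finite W" "W \<subseteq> carrier G" "finite P'" "P' \<subseteq> P" "determined W P' B"
  using assms unfolding finitely_determined_def by (elim CollectE conjE exE)

lemma finitely_determined_algebra: "algebra X (finitely_determined P)"
  unfolding algebra_iff_Int
proof (intro conjI ballI)
  show "finitely_determined P \<subseteq> Pow X"
  proof (rule subsetI, rule PowI)
    fix B assume "B \<in> finitely_determined P"
    then have "B \<in> sets m" by (rule finitely_determinedE)
    then show "B \<subseteq> X" using sets.sets_into_space[of B m] by simp
  qed
  show "{} \<in> finitely_determined P"
    by (rule finitely_determinedI[of _ "{}" "{}"]) (auto simp: determined_def)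
next
  fix A assume "A \<in> finitely_determined P"
  then obtain W P' where W: "A \<in> sets m" "finite W" "W \<subseteq> carrier G" "finite P'" "P' \<subseteq> P" "determined W P' A"
    by (rule finitely_determinedE)
  show "X - A \<in> finitely_determined P"
  proof (rule finitely_determinedI[OF _ W(2-5)])
    show "X - A \<in> sets m" using sets.compl_sets[OF W(1)] by simp
    show "determined W P' (X - A)" by (rule determined_compl[OF W(6)])
  qed
next
  fix A B assume A: "A \<in> finitely_determined P" and B: "B \<in> finitely_determined P"
  obtain W P1 where W: "A \<in> sets m" "finite W" "W \<subseteq> carrier G" "finite P1" "P1 \<subseteq> P" "determined W P1 A"
    using A by (rule finitely_determinedE)
  obtain W' P1' where W': "B \<in> sets m" "finite W'" "W' \<subseteq> carrier G" "finite P1'" "P1' \<subseteq> P" "determined W' P1' B"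
    using B by (rule finitely_determinedE)
  show "A \<inter> B \<in> finitely_determined P"
  proof (rule finitely_determinedI)
    show "determined (W \<union> W') (P1 \<union> P1') (A \<inter> B)" by (rule determined_Int[OF W(6) W'(6)])
    show "A \<inter> B \<in> sets m" using W(1) W'(1) by (rule sets.Int)
  qed (use W(2-5) W'(2-5) in simp_all)
qed

text \<open>The sets approximable by finitely determined ones form an invariant \<sigma>-algebra
  containing \<open>P\<close>, so they include the generated one. Shift invariance of
  \<open>m\<close> keeps the error unchanged under translation.\<close>

lemma generated_approx:
  assumes P: "P \<subseteq> sets m" and A: "A \<in> generated_subalgebra G m tr P" and e: "0 < e"
  obtains B where "B \<in> finitely_determined P" "measure m (sym_diff A B) < e"
proof -
  let ?C = "{A \<in> sets m. \<forall>e>0. \<exists>B\<in>finitely_determined P. measure m (sym_diff A B) < e}"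
  have fd_sets: "finitely_determined P \<subseteq> sets m" by (auto simp: finitely_determined_def)
  have "sigma_algebra X ?C"
    using approx_sigma_algebra[OF _ fd_sets] finitely_determined_algebra by simp
  moreover have "tr g -` A \<inter> X \<in> ?C" if g: "g \<in> carrier G" and A: "A \<in> ?C" for g A
  proof (intro CollectI conjI allI impI)
    have pre: "tr g -` B \<inter> X \<in> sets m" if "B \<in> sets m" for B
      using measurable_sets[OF shift_measurable[OF g] that] by simp
    show "tr g -` A \<inter> X \<in> sets m" by (rule pre) (use A in simp)
    fix e :: real assume "0 < e"
    with A have "\<exists>B\<in>finitely_determined P. measure m (sym_diff A B) < e" by simp
    then obtain B where B: "B \<in> finitely_determined P" "measure m (sym_diff A B) < e" by (elim bexE)
    obtain W P' where W: "B \<in> sets m" "finite W" "W \<subseteq> carrier G" "finite P'" "P' \<subseteq> P" "determined W P' B"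
      using B(1) by (rule finitely_determinedE)
    have "tr g -` B \<inter> X \<in> finitely_determined P"
    \<comment> \<open>Observing \<open>tr g x\<close> through \<open>W\<close> is observing
      \<open>x\<close> through the right translate of \<open>W\<close> by \<open>g\<close>.\<close>
    proof (rule finitely_determinedI[of _ "(\<lambda>h. h \<otimes>\<^bsub>G\<^esub> g) ` W" P'])
      show "determined ((\<lambda>h. h \<otimes>\<^bsub>G\<^esub> g) ` W) P' (tr g -` B \<inter> X)"
      proof (rule determinedI)
        fix x y assume xy: "x \<in> X" "y \<in> X"
          and eq: "\<forall>h\<in>(\<lambda>h. h \<otimes>\<^bsub>G\<^esub> g) ` W. \<forall>C\<in>P'. tr h x \<in> C \<longleftrightarrow> tr h y \<in> C"
        have "tr g x \<in> B \<longleftrightarrow> tr g y \<in> B"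
        proof (rule determinedD[OF W(6) shift_X[OF g xy(1)] shift_X[OF g xy(2)]], intro ballI)
          fix h C assume h: "h \<in> W" "C \<in> P'"
          then have "tr (h \<otimes>\<^bsub>G\<^esub> g) x \<in> C \<longleftrightarrow> tr (h \<otimes>\<^bsub>G\<^esub> g) y \<in> C" using eq by blast
          then show "tr h (tr g x) \<in> C \<longleftrightarrow> tr h (tr g y) \<in> C"
            using shift_shift[OF g subsetD[OF W(3) h(1)]] by (simp only:)
        qed
        then show "x \<in> tr g -` B \<inter> X \<longleftrightarrow> y \<in> tr g -` B \<inter> X" using xy by simp
      qed
      show "tr g -` B \<inter> X \<in> sets m" by (rule pre[OF W(1)])
      show "(\<lambda>h. h \<otimes>\<^bsub>G\<^esub> g) ` W \<subseteq> carrier G" using W(3) g by auto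
    qed (use W(2,4,5) in simp_all)
    moreover have "measure m (sym_diff (tr g -` A \<inter> X) (tr g -` B \<inter> X)) < e"
    proof -
      have "sym_diff (tr g -` A \<inter> X) (tr g -` B \<inter> X) = tr g -` (sym_diff A B) \<inter> X" by blast
      moreover have "measure m (tr g -` (sym_diff A B) \<inter> X) = measure m (sym_diff A B)"
        using A W(1) by (intro measure_shift[OF g]) auto
      ultimately show ?thesis using B(2) by (simp only:)
    qed
    ultimately show "\<exists>B\<in>finitely_determined P. measure m (sym_diff (tr g -` A \<inter> X) B) < e"
      by (rule bexI[rotated])
  qed
  ultimately have inv: "invariant_subalgebra G m tr ?C"
    unfolding invariant_subalgebra_def space_m
  proof (intro conjI ballI)
    show "?C \<subseteq> sets m" by (rule subsetI) (simp only: mem_Collect_eq)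
  qed
  have Pfd: "C \<in> finitely_determined P" if "C \<in> P" for C
    by (rule finitely_determinedI[of _ "{\<one>\<^bsub>G\<^esub>}" "{C}"]) 
       (use that P in \<open>auto simp: shift_one intro: determinedI\<close>)
  have fdC: "B \<in> ?C" if "B \<in> finitely_determined P" for B
  proof (intro CollectI conjI allI impI)
    show "B \<in> sets m" using that fd_sets by (rule subsetD[rotated])
    show "\<exists>B'\<in>finitely_determined P. measure m (sym_diff B B') < e" if "0 < e" for e :: real
      by (rule bexI[OF _ \<open>B \<in> finitely_determined P\<close>]) (use \<open>0 < e\<close> in simp)
  qed
  have "P \<subseteq> ?C" by (rule subsetI) (rule fdC[OF Pfd])
  then have "generated_subalgebra G m tr P \<subseteq> ?C"
    unfolding generated_subalgebra_def by (intro Inter_lower CollectI conjI inv)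
  then have "A \<in> ?C" using A by (rule subsetD)
  then have "\<exists>B\<in>finitely_determined P. measure m (sym_diff A B) < e" using e by simp
  then show ?thesis using that by (elim bexE)
qed

end

section \<open>Lower bounds on Rokhlin entropy\<close>

context cyclic_product begin

lemma one_sepset: "\<one>\<^bsub>G\<^esub> \<in> sepset r"
proof -
  have "1 \<in> I" using d_ge by (simp add: I_def)
  then show ?thesis using sepsetI(1)[OF one_ball one_ball, where j = 0 and r = r] by simp
qed

text \<open>The bound on the entropy of \<open>\<phi>\<close> depends on \<open>F\<close> only, and not on \<open>\<phi>\<close> or \<open>W\<close>:
  this is the uniformity needed for outer Rokhlin entropy.\<close>

lemma entropy_lower_bound:
  fixes F :: "(nat word set \<Rightarrow> bit) \<Rightarrow> bool" and \<phi> :: "(nat word set \<Rightarrow> bit) \<Rightarrow> 'c"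
    and \<psi> :: "(nat word set \<Rightarrow> 'c) \<Rightarrow> bool" and W :: "nat word set set"
  defines "\<Theta> \<equiv> \<lambda>x. \<psi> (\<lambda>g\<in>W. \<phi> (shift_action d k g x))"
  assumes F: "cyl r F" and r: "r \<le> R" and \<phi>: "cyl R \<phi>" and K: "finite K" "range \<phi> \<subseteq> K"
    and W: "W \<subseteq> carrier G" and \<Theta>: "cyl R \<Theta>"
    and \<theta>: "bprob r F \<le> \<theta>" "1 - bprob r F \<le> \<theta>" "0 < \<theta>"
  defines "err \<equiv> bprob R (\<lambda>x. F x \<noteq> \<Theta> x)"
  assumes \<kappa>: "0 \<le> - ln \<theta> - (ent err + ent (1 - err))"
  shows "- ln \<theta> - (ent err + ent (1 - err)) \<le>
    real (card (sepset r)) * (\<Sum>a\<in>K. ent (bprob R (\<lambda>x. \<phi> x = a)))"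
proof (rule ccontr)
  define \<kappa>' where "\<kappa>' = - ln \<theta> - (ent err + ent (1 - err))"
  define H where "H = (\<Sum>a\<in>K. ent (bprob R (\<lambda>x. \<phi> x = a)))"
  define c where "c = real (card (sepset r))"
  have c: "0 < c" using finite_sepset one_sepset[of r] by (auto simp: c_def card_gt_0_iff)
  assume "\<not> ?thesis"
  then have gap: "c * H < \<kappa>'" by (simp add: \<kappa>'_def H_def c_def)
  have \<kappa>0: "0 \<le> \<kappa>'" using \<kappa> by (simp add: \<kappa>'_def)
  obtain V0 :: "((nat \<times> nat) list \<Rightarrow> (nat \<times> nat) list) set" and p
    where V0: "finite V0" "V0 \<noteq> {}" "is_act p V0" "\<And>v. v \<in> V0 \<Longrightarrow> inj_on (\<lambda>g. gact p g v) (ball (Suc R))"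
    using free_model_exists[of "Suc R"] by blast
  \<comment> \<open>\<open>V0\<close> is fixed before \<open>L\<close>, so \<open>B\<close> does not
    depend on \<open>L\<close>; by \<open>card_bad\<close> the fraction of bad vertices is at most
    \<open>B / L\<close>.\<close>
  define B where "B = real (card (ball R) * d * card V0 * d)"
  have bound: "real L * (\<kappa>' - c * H) \<le> c * B * (\<kappa>' + real (card K))" if L: "0 < L" for L :: nat
  proof -
    interpret fm: finite_model d k V0 p L R
      by unfold_locales (use V0 L in auto)
    obtain S where S: "fm.separated r S" "card V0 \<le> card S * card (sepset r)"
      by (rule fm.separated_exists)
    define n where "n = real (card fm.V)"
    define b where "b = real (card {u \<in> fm.V. \<not> fm.good R u})"
    define sg where "sg = real (card {u \<in> S \<times> fm.T. fm.good R u})"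
    have n: "0 < n" using fm.finite_V V0 fm.T_nonempty by (auto simp: n_def fm.V_def card_gt_0_iff)
    have SV: "S \<times> fm.T \<subseteq> fm.V" using S(1) by (auto simp: fm.separated_def fm.V_def)
    have "card (S \<times> fm.T) \<le> card ({u \<in> S \<times> fm.T. fm.good R u} \<union> {u \<in> fm.V. \<not> fm.good R u})"
      using SV fm.finite_V by (intro card_mono) (auto intro: finite_subset[of _ fm.V])
    also have "\<dots> \<le> card {u \<in> S \<times> fm.T. fm.good R u} + card {u \<in> fm.V. \<not> fm.good R u}"
      by (rule card_Un_le)
    finally have "real (card (S \<times> fm.T)) \<le> sg + b" by (simp add: sg_def b_def)
    moreover have "n \<le> c * real (card (S \<times> fm.T))"
    proof -
      have "card fm.V \<le> card (sepset r) * card (S \<times> fm.T)"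
        using mult_le_mono1[OF S(2), of "card fm.T"] by (simp add: fm.V_def card_cartesian_product mult_ac)
      then show ?thesis unfolding n_def c_def of_nat_mult[symmetric] of_nat_le_iff .
    qed
    ultimately have sg: "n \<le> c * (sg + b)"
      using mult_left_mono[of "real (card (S \<times> fm.T))" "sg + b" c] c by linarith
    have "card {u \<in> fm.V. \<not> fm.good R u} * L \<le> card (ball R) * d * card V0 * d * card fm.V"
      by (rule fm.card_bad)
    then have bL: "b * real L \<le> B * n" unfolding b_def B_def n_def of_nat_mult[symmetric] of_nat_le_iff .
    have main: "sg * \<kappa>' \<le> n * H + b * real (card K)"
      unfolding sg_def \<kappa>'_def n_def H_def b_def err_def \<Theta>_def
      by (rule fm.entropy_inequality[OF S(1) r _ _ K W _ \<theta>])
         (use F \<phi> \<Theta> in \<open>simp_all only: cyl_def \<Theta>_def\<close>)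
    have "n * \<kappa>' \<le> c * (sg + b) * \<kappa>'" using sg \<kappa>0 by (intro mult_right_mono)
    also have "\<dots> = c * (sg * \<kappa>') + c * b * \<kappa>'" by (simp add: algebra_simps)
    also have "\<dots> \<le> c * (n * H + b * real (card K)) + c * b * \<kappa>'" using main c by simp
    finally have "n * (\<kappa>' - c * H) \<le> c * (\<kappa>' + real (card K)) * b" by (simp add: algebra_simps)
    then have "real L * (n * (\<kappa>' - c * H)) \<le> real L * (c * (\<kappa>' + real (card K)) * b)"
      by (rule mult_left_mono) simp
    also have "\<dots> = c * (\<kappa>' + real (card K)) * (b * real L)" by (simp only: mult_ac)
    also have "\<dots> \<le> c * (\<kappa>' + real (card K)) * (B * n)"
      using bL c \<kappa>0 by (intro mult_left_mono) auto
    finally have "n * (real L * (\<kappa>' - c * H)) \<le> n * (c * B * (\<kappa>' + real (card K)))" by (simp add: mult_ac)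
    then show ?thesis using n by simp
  qed
  \<comment> \<open>As \<open>L\<close> grows the bad vertices become negligible, so a positive gap
    between \<kappa>' and \<open>c * H\<close> is impossible.\<close>
  obtain L :: nat where "c * B * (\<kappa>' + real (card K)) / (\<kappa>' - c * H) < real L"
    using reals_Archimedean2 by blast
  then have "c * B * (\<kappa>' + real (card K)) < real L * (\<kappa>' - c * H)"
    using gap by (simp add: divide_less_eq)
  moreover have "0 \<le> c * B * (\<kappa>' + real (card K))" using c \<kappa>0 by (simp add: B_def)
  ultimately show False using bound[of L] gap by (cases "L = 0") auto
qed

text \<open>A shift moves the window to a translate of the ball, which is finite and therefore lies
  in a larger ball about the identity.\<close>

lemma cyl_shift:
  assumes f: "cyl r f" and g: "g \<in> carrier G"
  shows "\<exists>R. cyl R (\<lambda>x. f (shift_action d k g x))"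
proof -
  have "finite ((\<lambda>h. inv\<^bsub>G\<^esub> g \<otimes>\<^bsub>G\<^esub> h) ` ball r)" "(\<lambda>h. inv\<^bsub>G\<^esub> g \<otimes>\<^bsub>G\<^esub> h) ` ball r \<subseteq> carrier G"
    using g ball_carrier by (auto simp: finite_ball)
  then obtain R where R: "(\<lambda>h. inv\<^bsub>G\<^esub> g \<otimes>\<^bsub>G\<^esub> h) ` ball r \<subseteq> ball R" by (rule finite_subset_ball)
  have "f (shift_action d k g (restrict x (ball R))) = f (shift_action d k g x)" for x
  proof -
    have "restrict (shift_action d k g (restrict x (ball R))) (ball r) = restrict (shift_action d k g x) (ball r)"
      using R ball_carrier by (intro restrict_ext) (auto simp: shift_action_def)
    then show ?thesis using f unfolding cyl_def by metis
  qed
  then show ?thesis unfolding cyl_def by blast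
qed

lemma finite_cyl:
  assumes "finite J" "\<And>j. j \<in> J \<Longrightarrow> \<exists>r. cyl r (f j)"
  shows "\<exists>R\<ge>R0. \<forall>j\<in>J. cyl R (f j)"
  using assms
proof (induction J rule: finite_induct)
  case (insert j J)
  obtain R r where R: "R0 \<le> R" "\<forall>j\<in>J. cyl R (f j)" "cyl r (f j)" using insert by blast
  show ?case
  proof (intro exI conjI ballI)
    show "R0 \<le> max R r" using R by simp
    show "cyl (max R r) (f j')" if "j' \<in> insert j J" for j'
      using that R cyl_mono[of _ _ "max R r"] by (metis insert_iff max.cobounded1 max.cobounded2)
  qed
qed auto

end

lemma ent_small:
  assumes "0 < e"
  obtains t where "0 < t" "\<And>s. 0 \<le> s \<Longrightarrow> s \<le> 1 \<Longrightarrow> s < t \<Longrightarrow> ent s + ent (1 - s) < e"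
proof -
  have "continuous_on {0..1} (\<lambda>s. ent s + ent (1 - s))"
    by (intro continuous_on_add continuous_on_compose2[OF continuous_on_ent] continuous_intros) auto
  then obtain t where t: "0 < t" "\<And>s. s \<in> {0..1} \<Longrightarrow> dist s 0 < t \<Longrightarrow> dist (ent s + ent (1 - s)) (ent 0 + ent (1 - 0)) < e"
    unfolding continuous_on_iff using assms by (metis atLeastAtMost_iff order_refl zero_le_one)
  show ?thesis
    by (rule that[OF t(1)]) (use t(2) in \<open>force simp: dist_real_def\<close>)
qed

lemma ent_uniform:
  assumes "0 < e"
  obtains t where "0 < t" "\<And>s s'. s \<in> {0..1} \<Longrightarrow> s' \<in> {0..1} \<Longrightarrow> \<bar>s - s'\<bar> < t \<Longrightarrow> ent s < ent s' + e"
proof -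
  have "uniformly_continuous_on {0..1} ent"
    by (intro compact_uniformly_continuous continuous_on_subset[OF continuous_on_ent]) auto
  then obtain t where t: "0 < t" "\<And>s s'. s \<in> {0..1} \<Longrightarrow> s' \<in> {0..1} \<Longrightarrow> dist s' s < t \<Longrightarrow> dist (ent s') (ent s) < e"
    unfolding uniformly_continuous_on_def using assms by metis
  show ?thesis
  proof (rule that[OF t(1)])
    fix s s' :: real assume "s \<in> {0..1}" "s' \<in> {0..1}" "\<bar>s - s'\<bar> < t"
    then show "ent s < ent s' + e" using t(2)[of s' s] by (auto simp: dist_real_def)
  qed
qed

context haar_code begin

lemma measure_diff_le:
  assumes "E \<in> sets m" "E' \<in> sets m" "N \<in> sets m" "sym_diff E E' \<subseteq> N"
  shows "\<bar>measure m E - measure m E'\<bar> \<le> measure m N"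
proof -
  have "measure m E \<le> measure m (E' \<union> N)" "measure m E' \<le> measure m (E \<union> N)"
    using assms by (auto intro!: finite_measure_mono)
  moreover have "measure m (E' \<union> N) \<le> measure m E' + measure m N" "measure m (E \<union> N) \<le> measure m E + measure m N"
    using assms by (auto intro!: measure_Un_le)
  ultimately show ?thesis by linarith
qed

lemma sum_ent_le_shannon:
  assumes "finite P'" "P' \<subseteq> P" "shannon_entropy m P < ennreal c"
  shows "(\<Sum>C\<in>P'. ent (measure m C)) \<le> c"
proof -
  have "(\<Sum>C\<in>P'. ennreal (ent (measure m C))) \<le> shannon_entropy m P"
    unfolding shannon_entropy_def ent_def
    by (subst nonneg_infsum_complete) (use assms in \<open>auto intro!: SUP_upper\<close>)
  then have "ennreal (\<Sum>C\<in>P'. ent (measure m C)) < ennreal c"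
    using assms(3) by (simp add: sum_ennreal ent_nonneg)
  then show ?thesis
    by (metis ennreal_less_iff ent_nonneg less_imp_le measure_nonneg prob_le_1 sum_nonneg)
qed

text \<open>Continuity from below along an enumeration of \<open>P\<close>; the prescribed finite
  part \<open>P1\<close> is adjoined because it is still needed to decide a determined set.\<close>

lemma partition_exhaust:
  assumes P: "countable_partition m P" and P1: "finite P1" "P1 \<subseteq> P" and e: "0 < e"
  obtains P' where "finite P'" "P1 \<subseteq> P'" "P' \<subseteq> P" "measure m (X - \<Union>P') < e"
proof -
  have cP: "countable P" "P \<subseteq> sets m" "\<Union>P = X"
    using P by (auto simp: countable_partition_def partition_on_def)
  have "X \<noteq> {}" using not_empty by simp
  then have neP: "P \<noteq> {}" using cP by auto
  let ?U = "\<lambda>N. \<Union>n<N. from_nat_into P n"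
  have from_P: "from_nat_into P n \<in> P" for n by (rule from_nat_into[OF neP])
  have "(\<lambda>N. measure m (?U N)) \<longlonglongrightarrow> measure m (\<Union>N. ?U N)"
    using from_P cP(2) by (intro finite_Lim_measure_incseq) (auto simp: incseq_def intro: order_less_le_trans)
  moreover have "(\<Union>N. ?U N) = X"
  proof -
    have "(\<Union>N. ?U N) = \<Union>(range (from_nat_into P))" by auto
    then show ?thesis using range_from_nat_into[OF neP cP(1)] cP(3) by simp
  qed
  ultimately have "(\<lambda>N. measure m (?U N)) \<longlonglongrightarrow> 1" using prob_space by simp
  then have "\<forall>\<^sub>F N in sequentially. dist (measure m (?U N)) 1 < e" using e by (rule tendstoD)
  then obtain N where N: "dist (measure m (?U N)) 1 < e" by (auto simp: eventually_sequentially)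
  define P' where "P' = P1 \<union> from_nat_into P ` {..<N}"
  have fin: "finite P'" using P1 by (simp add: P'_def)
  have P'P: "P' \<subseteq> P" using P1 from_P by (auto simp: P'_def)
  have U: "?U N \<in> sets m" "\<Union>P' \<in> sets m"
    using from_P cP(2) fin P'P by (auto intro!: sets.finite_Union)
  have "measure m (?U N) \<le> measure m (\<Union>P')" using U by (intro finite_measure_mono) (auto simp: P'_def)
  moreover have "measure m (X - \<Union>P') = 1 - measure m (\<Union>P')" using prob_compl[OF U(2)] by simp
  ultimately have "measure m (X - \<Union>P') < e" using N by (simp add: dist_real_def)
  then show ?thesis using that[OF fin _ P'P] by (auto simp: P'_def)
qed

text \<open>Disjointness leaves only singletons and the empty set as nonempty label events, the
  empty label marking the part not covered by \<open>P'\<close>.\<close>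

lemma sum_ent_labels:
  assumes P: "countable_partition m P" and P': "finite P'" "P' \<subseteq> P"
  shows "(\<Sum>a\<in>Pow P'. ent (measure m {x \<in> X. {C \<in> P'. x \<in> C} = a})) =
    (\<Sum>C\<in>P'. ent (measure m C)) + ent (measure m (X - \<Union>P'))"
proof -
  let ?E = "\<lambda>a. {x \<in> X. {C \<in> P'. x \<in> C} = a}"
  have cP: "\<Union>P = X" "disjoint P" using P by (auto simp: countable_partition_def partition_on_def)
  have same: "C = C'" if "C \<in> P'" "C' \<in> P'" "x \<in> C" "x \<in> C'" for C C' x
    using cP(2) that P' unfolding disjoint_def by blast
  have E1: "?E {C} = C" if "C \<in> P'" for C using that same cP(1) P' by fastforce
  have E0: "?E {} = X - \<Union>P'" by auto
  have E2: "?E a = {}" if "a \<notin> insert {} ((\<lambda>C. {C}) ` P')" for a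
  proof (rule ccontr)
    assume "?E a \<noteq> {}"
    then obtain x where x: "{C \<in> P'. x \<in> C} = a" by blast
    with that obtain C where "C \<in> a" by blast
    then have "a = {C}" using x same by blast
    then show False using that x \<open>C \<in> a\<close> by blast
  qed
  have "(\<Sum>a\<in>Pow P'. ent (measure m (?E a))) = (\<Sum>a\<in>insert {} ((\<lambda>C. {C}) ` P'). ent (measure m (?E a)))"
  proof (rule sum.mono_neutral_right)
    show "\<forall>a\<in>Pow P' - insert {} ((\<lambda>C. {C}) ` P'). ent (measure m (?E a)) = 0"
    proof
      fix a assume "a \<in> Pow P' - insert {} ((\<lambda>C. {C}) ` P')"
      then have "?E a = {}" by (intro E2) blast
      then show "ent (measure m (?E a)) = 0" by (simp only: measure_empty ent_0)
    qed
  qed (use P' in auto)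
  also have "\<dots> = ent (measure m (?E {})) + (\<Sum>a\<in>(\<lambda>C. {C}) ` P'. ent (measure m (?E a)))"
    using P' by (intro sum.insert) auto
  also have "(\<Sum>a\<in>(\<lambda>C. {C}) ` P'. ent (measure m (?E a))) = (\<Sum>C\<in>P'. ent (measure m C))"
  proof (subst sum.reindex)
    show "sum ((\<lambda>a. ent (measure m (?E a))) \<circ> (\<lambda>C. {C})) P' = (\<Sum>C\<in>P'. ent (measure m C))"
      by (rule sum.cong[OF HOL.refl]) (simp only: comp_apply E1)
  qed simp
  finally show ?thesis unfolding E0 by (simp only: add.commute)
qed

text \<open>\<open>F\<close>, its radius \<open>r\<close> and then \<open>c\<close> are chosen from
  \<open>A\<close> alone, before \<open>P\<close> is given. If the entropy of \<open>P\<close> were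
  below \<open>c\<close>, a finite part of \<open>P\<close>, approximated by cylinder labels, would
  predict \<open>F\<close> too well for \<open>entropy_lower_bound\<close>.\<close>

lemma shannon_lower_bound:
  assumes A: "A \<in> sets m" and pos: "0 < measure m A" and lt: "measure m A < 1"
  shows "\<exists>c>0. \<forall>P B. countable_partition m P \<longrightarrow> B \<in> generated_subalgebra G m tr P \<longrightarrow>
    sym_diff A B \<in> null_sets m \<longrightarrow> ennreal c \<le> shannon_entropy m P"
proof -
  define mx where "mx = max (measure m A) (1 - measure m A)"
  \<comment> \<open>The midpoint between \<open>mx\<close> and 1 leaves room
    \<open>(1 - mx) / 2\<close> for replacing \<open>A\<close> by the cylinder event
    \<open>F\<close>.\<close>
  define \<theta> where "\<theta> = (mx + 1) / 2"
  have mx: "0 < mx" "mx < 1" using pos lt by (auto simp: mx_def)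
  have \<theta>: "0 < \<theta>" "\<theta> < 1" using mx by (auto simp: \<theta>_def)
  define lam where "lam = - ln \<theta>"
  have lam: "0 < lam" using \<theta> by (simp add: lam_def)
  obtain t where t: "0 < t" "\<And>s. 0 \<le> s \<Longrightarrow> s \<le> 1 \<Longrightarrow> s < t \<Longrightarrow> ent s + ent (1 - s) < lam / 2"
    using ent_small[of "lam / 2"] lam by auto
  \<comment> \<open>The first bound keeps both probabilities of \<open>F\<close> below \<theta>; the
    second makes three errors of size \<eta> add up to less than \<open>t\<close>.\<close>
  define \<eta> where "\<eta> = min ((1 - mx) / 2) (t / 4)"
  have \<eta>: "0 < \<eta>" "\<eta> \<le> (1 - mx) / 2" "\<eta> \<le> t / 4"
  proof -
    show "0 < \<eta>" using mx t(1) by (simp add: \<eta>_def)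
    show "\<eta> \<le> (1 - mx) / 2" unfolding \<eta>_def by (rule min.cobounded1)
    show "\<eta> \<le> t / 4" unfolding \<eta>_def by (rule min.cobounded2)
  qed
  obtain F r where F: "cyl r F" "measure m (sym_diff A {x \<in> X. F x}) < \<eta>"
    by (rule cylinder_approx[OF A \<eta>(1)])
  have F_sets: "{x \<in> X. F x} \<in> sets m" by (rule cyl_sets[OF HOL.refl F(1)])
  have "\<bar>measure m A - measure m {x \<in> X. F x}\<bar> \<le> measure m (sym_diff A {x \<in> X. F x})"
    using A F_sets by (intro measure_diff_le) auto
  then have F_\<theta>: "bprob r F \<le> \<theta>" "1 - bprob r F \<le> \<theta>"
    using F(2) \<eta>(2) marginal[OF F(1)] by (auto simp: \<theta>_def mx_def field_simps)
  define Ns where "Ns = real (card (sepset r))"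
  have Ns: "0 < Ns" using finite_sepset one_sepset[of r] by (auto simp: Ns_def card_gt_0_iff)
  \<comment> \<open>With this value \<open>Ns * (2 * c)\<close> equals \<open>lam / 2\<close>, which
    gives the final contradiction.\<close>
  define c where "c = lam / (4 * Ns)"
  have c: "0 < c" using lam Ns by (simp add: c_def)
  have "ennreal c \<le> shannon_entropy m P"
    if P: "countable_partition m P" and B: "B \<in> generated_subalgebra G m tr P" and null: "sym_diff A B \<in> null_sets m" for P B
  proof (rule ccontr)
    assume "\<not> ?thesis"
    then have small: "shannon_entropy m P < ennreal c" by simp
    have P_sets: "P \<subseteq> sets m" using P by (simp add: countable_partition_def)
    obtain D where D: "D \<in> finitely_determined P" "measure m (sym_diff B D) < \<eta>"
      by (rule generated_approx[OF P_sets B \<eta>(1)])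
    obtain W P1 where W: "D \<in> sets m" "finite W" "W \<subseteq> carrier G" "finite P1" "P1 \<subseteq> P" "determined W P1 D"
      using D(1) by (rule finitely_determinedE)
    obtain t1 where t1: "0 < t1" "\<And>s. 0 \<le> s \<Longrightarrow> s \<le> 1 \<Longrightarrow> s < t1 \<Longrightarrow> ent s + ent (1 - s) < c / 4"
      using ent_small[of "c / 4"] c by auto
    obtain P' where P': "finite P'" "P1 \<subseteq> P'" "P' \<subseteq> P" "measure m (X - \<Union>P') < t1"
      by (rule partition_exhaust[OF P W(4,5) t1(1)])
    have "ent (measure m (X - \<Union>P')) + ent (1 - measure m (X - \<Union>P')) < c / 4" using P'(4) by (intro t1(2)) auto
    then have rest: "ent (measure m (X - \<Union>P')) < c / 4"
      using ent_nonneg[of "1 - measure m (X - \<Union>P')"] by simp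
    \<comment> \<open>\<open>\<phi>0\<close> is the exact finite label; below, \<open>\<phi>\<close>
      is its cylinder version, and the two agree off a set \<open>Z\<close> of measure less than
      \<delta>.\<close>
    define \<phi>0 where "\<phi>0 x = {C \<in> P'. x \<in> C}" for x
    define K where "K = Pow P'"
    have K: "finite K" "0 < real (card K)" using P'(1) by (auto simp: K_def card_gt_0_iff)
    obtain t2 where t2: "0 < t2" "\<And>s s'. s \<in> {0..1} \<Longrightarrow> s' \<in> {0..1} \<Longrightarrow> \<bar>s - s'\<bar> < t2 \<Longrightarrow> ent s < ent s' + c / (4 * real (card K))"
      using ent_uniform[of "c / (4 * real (card K))"] c K(2) by auto
    \<comment> \<open>The bound by \<open>t2\<close> controls the change of label entropies; the
      other makes the translates of \<open>Z\<close> over \<open>W\<close> cost at most \<eta>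
      altogether.\<close>
    define \<delta> where "\<delta> = min t2 (\<eta> / (real (card W) + 1))"
    have \<delta>: "0 < \<delta>" "\<delta> \<le> t2" "real (card W) * \<delta> \<le> \<eta>"
    proof -
      show "0 < \<delta>" "\<delta> \<le> t2" using t2(1) \<eta>(1) by (auto simp: \<delta>_def)
      have "real (card W) * \<delta> \<le> real (card W) * (\<eta> / (real (card W) + 1))"
        by (intro mult_left_mono) (auto simp: \<delta>_def)
      also have "\<dots> \<le> \<eta>" using \<eta>(1) by (simp add: field_simps)
      finally show "real (card W) * \<delta> \<le> \<eta>" .
    qed
    have P'_sets: "C \<in> sets m" if "C \<in> P'" for C using that P'(3) P_sets by blast
    have pos: "0 < \<delta> / (real (card P') + 1)" using \<delta>(1) by (intro divide_pos_pos) simp_all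
    have "\<forall>C\<in>P'. \<exists>Q. (\<exists>r. cyl r Q) \<and> measure m (sym_diff C {x \<in> X. Q x}) < \<delta> / (real (card P') + 1)"
    proof
      fix C assume "C \<in> P'"
      obtain Q r where "cyl r Q" "measure m (sym_diff C {x \<in> X. Q x}) < \<delta> / (real (card P') + 1)"
        by (rule cylinder_approx[OF P'_sets[OF \<open>C \<in> P'\<close>] pos])
      then show "\<exists>Q. (\<exists>r. cyl r Q) \<and> measure m (sym_diff C {x \<in> X. Q x}) < \<delta> / (real (card P') + 1)"
        by (intro exI conjI)
    qed
    from bchoice[OF this] obtain Q where Q': "\<forall>C\<in>P'. (\<exists>r. cyl r (Q C)) \<and>
      measure m (sym_diff C {x \<in> X. Q C x}) < \<delta> / (real (card P') + 1)" by (elim exE)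
    have Q: "\<exists>r. cyl r (Q C)" "measure m (sym_diff C {x \<in> X. Q C x}) < \<delta> / (real (card P') + 1)" if "C \<in> P'" for C
      using bspec[OF Q' that] by simp_all
    have "\<exists>r1\<ge>0. \<forall>C\<in>P'. cyl r1 (Q C)" by (rule finite_cyl[OF P'(1)]) (rule Q(1))
    then obtain r1 where r1: "\<forall>C\<in>P'. cyl r1 (Q C)" by (elim exE conjE)
    define \<phi> where "\<phi> x = {C \<in> P'. Q C x}" for x
    have \<phi>_cyl: "cyl r1 \<phi>" using r1 by (auto simp: cyl_def \<phi>_def)
    define Z where "Z = (\<Union>C\<in>P'. sym_diff C {x \<in> X. Q C x})"
    have Q_sets: "{x \<in> X. Q C x} \<in> sets m" if "C \<in> P'" for C 
    proof -
      from Q(1)[OF that] obtain r' where "cyl r' (Q C)" by (elim exE)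
      then show ?thesis by (rule cyl_sets[OF HOL.refl])
    qed
    have Z_sets: "Z \<in> sets m" unfolding Z_def
      using P'(1) P'_sets Q_sets by (intro sets.finite_UN) auto
    have Z_eq: "\<phi> x = \<phi>0 x" if "x \<in> X" "x \<notin> Z" for x using that by (auto simp: \<phi>_def \<phi>0_def Z_def)
    have "measure m Z \<le> (\<Sum>C\<in>P'. measure m (sym_diff C {x \<in> X. Q C x}))"
      unfolding Z_def using P'(1) P'_sets Q_sets by (intro measure_UNION_le) auto
    also have "\<dots> \<le> (\<Sum>C\<in>P'. \<delta> / (real (card P') + 1))" using Q(2) by (intro sum_mono) (simp add: less_imp_le)
    also have "\<dots> < \<delta>" using \<delta>(1) by (simp add: field_simps)
    finally have Z: "measure m Z < \<delta>" .
    \<comment> \<open>The decoder accepts an approximate label pattern on \<open>W\<close> if some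
      point of \<open>D\<close> shows it exactly. Where the labels are correct this decides
      \<open>D\<close>, because \<open>D\<close> is determined.\<close>
    define \<Theta> where "\<Theta> x = (\<exists>x'\<in>X. (\<lambda>g\<in>W. \<phi>0 (tr g x')) = (\<lambda>g\<in>W. \<phi> (tr g x)) \<and> x' \<in> D)" for x
    have "\<exists>R\<ge>max r r1. \<forall>g\<in>W. cyl R (\<lambda>x. \<phi> (tr g x))"
      by (rule finite_cyl[OF W(2)]) (rule cyl_shift[OF \<phi>_cyl subsetD[OF W(3)]])
    then obtain R where R: "max r r1 \<le> R" "\<forall>g\<in>W. cyl R (\<lambda>x. \<phi> (tr g x))" by (elim exE conjE)
    have \<Theta>_cyl: "cyl R \<Theta>"
    proof -
      have "(\<lambda>g\<in>W. \<phi> (tr g (restrict x (ball R)))) = (\<lambda>g\<in>W. \<phi> (tr g x))" for x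
        using R(2) by (intro restrict_ext) (simp add: cyl_def)
      then show ?thesis by (simp only: cyl_def \<Theta>_def simp_thms)
    qed
    have \<Theta>_eq: "\<Theta> x \<longleftrightarrow> x \<in> D" if x: "x \<in> X" "\<And>g. g \<in> W \<Longrightarrow> tr g x \<notin> Z" for x
    proof -
      have eq: "(\<lambda>g\<in>W. \<phi> (tr g x)) = (\<lambda>g\<in>W. \<phi>0 (tr g x))"
        by (rule restrict_ext) (rule Z_eq[OF shift_X[OF subsetD[OF W(3)] x(1)] x(2)])
      have "x' \<in> D \<longleftrightarrow> x \<in> D" if x': "x' \<in> X" "(\<lambda>g\<in>W. \<phi>0 (tr g x')) = (\<lambda>g\<in>W. \<phi>0 (tr g x))" for x'
      proof (rule determinedD[OF W(6) x'(1) x(1)], intro ballI)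
        fix g C assume g: "g \<in> W" "C \<in> P1"
        then have "\<phi>0 (tr g x') = \<phi>0 (tr g x)" using x'(2) by (simp only: restrict_eq_iff)
        then show "tr g x' \<in> C \<longleftrightarrow> tr g x \<in> C" using g(2) P'(2) unfolding \<phi>0_def by blast
      qed
      then show ?thesis unfolding \<Theta>_def eq using x(1) by blast
    qed
    define err where "err = bprob R (\<lambda>x. F x \<noteq> \<Theta> x)"
    have err: "err < t"
    proof -
      let ?S = "\<Union>g\<in>W. tr g -` Z \<inter> X"
      have pre: "tr g -` Z \<inter> X \<in> sets m" if "g \<in> W" for g
        using measurable_sets[OF shift_measurable Z_sets] that W(3) by auto
      have S_sets: "?S \<in> sets m" using W(2) pre by (intro sets.finite_UN) auto
      have "measure m ?S \<le> (\<Sum>g\<in>W. measure m (tr g -` Z \<inter> X))"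
        using W(2) pre by (intro measure_UNION_le) auto
      also have "\<dots> = real (card W) * measure m Z" using measure_shift[OF _ Z_sets] W(3) by (simp add: subset_iff)
      also have "\<dots> \<le> real (card W) * \<delta>" using Z by (intro mult_left_mono) auto
      finally have S: "measure m ?S \<le> \<eta>" using \<delta>(3) by linarith
      have B_sets: "sym_diff A B \<in> sets m" using null by auto
      have AB: "measure m (sym_diff A B) = 0" using null by (simp add: measure_eq_emeasure_eq_ennreal null_setsD1)
      have BX: "B \<in> sets m"
      proof -
        have "sigma_algebra X (sets m)" using sets.sigma_algebra_axioms[of m] by simp
        then have "invariant_subalgebra G m tr (sets m)"
          using measurable_sets[OF shift_measurable] by (simp add: invariant_subalgebra_def)
        then have "generated_subalgebra G m tr P \<subseteq> sets m"
          unfolding generated_subalgebra_def by (intro Inter_lower CollectI conjI P_sets)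
        then show ?thesis using B by (rule subsetD)
      qed
      have "cyl R F" by (rule cyl_mono[OF F(1)]) (use R(1) in simp)
      then have "cyl R (\<lambda>x. F x \<noteq> \<Theta> x)" using \<Theta>_cyl by (rule cyl_comp2)
      then have "err = measure m {x \<in> X. F x \<noteq> \<Theta> x}" unfolding err_def by (rule marginal[symmetric])
      moreover
      let ?E1 = "sym_diff A {x \<in> X. F x}" and ?E2 = "sym_diff A B" and ?E3 = "sym_diff B D"
      have E: "?E1 \<in> sets m" "?E2 \<in> sets m" "?E3 \<in> sets m" using A F_sets BX W(1) by auto
      \<comment> \<open>An error comes from replacing \<open>A\<close> by \<open>F\<close>, from the
        null set between \<open>A\<close> and \<open>B\<close>, from replacing \<open>B\<close> by
        \<open>D\<close>, or from a wrong label in the window.\<close>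
      have "{x \<in> X. F x \<noteq> \<Theta> x} \<subseteq> ?E1 \<union> (?E2 \<union> (?E3 \<union> ?S))"
      proof (rule subsetI, rule ccontr)
        fix x assume x: "x \<in> {x \<in> X. F x \<noteq> \<Theta> x}" and out: "x \<notin> ?E1 \<union> (?E2 \<union> (?E3 \<union> ?S))"
        have xX: "x \<in> X" using x by simp
        from out have out': "x \<notin> ?E1" "x \<notin> ?E2" "x \<notin> ?E3" "x \<notin> ?S" 
          by (simp_all only: Un_iff de_Morgan_disj simp_thms not_False_eq_True)
        have "tr g x \<notin> Z" if "g \<in> W" for g
        proof
          assume "tr g x \<in> Z"
          then have "x \<in> ?S" using xX that by (intro UN_I[of g]) simp_all
          then show False using out'(4) by (rule notE[rotated])
        qed
        with xX have \<Theta>D: "\<Theta> x \<longleftrightarrow> x \<in> D" by (rule \<Theta>_eq)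
        have "x \<in> A \<longleftrightarrow> F x" using out'(1) xX by blast
        moreover have "x \<in> A \<longleftrightarrow> x \<in> B" using out'(2) by blast
        moreover have "x \<in> B \<longleftrightarrow> x \<in> D" using out'(3) by blast
        moreover have "F x \<noteq> \<Theta> x" using x by (simp only: mem_Collect_eq simp_thms)
        ultimately show False using \<Theta>D by blast
      qed
      then have "measure m {x \<in> X. F x \<noteq> \<Theta> x} \<le> measure m (?E1 \<union> (?E2 \<union> (?E3 \<union> ?S)))"
        by (rule finite_measure_mono) (intro sets.Un E S_sets)
      moreover have "measure m (?E1 \<union> (?E2 \<union> (?E3 \<union> ?S))) \<le> measure m ?E1 + measure m (?E2 \<union> (?E3 \<union> ?S))"
        by (intro measure_Un_le sets.Un E S_sets)
      moreover have "measure m (?E2 \<union> (?E3 \<union> ?S)) \<le> measure m ?E2 + measure m (?E3 \<union> ?S)"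
        by (intro measure_Un_le sets.Un E S_sets)
      moreover have "measure m (?E3 \<union> ?S) \<le> measure m ?E3 + measure m ?S"
        by (intro measure_Un_le E S_sets)
      ultimately show ?thesis using F(2) AB D(2) S \<eta>(3) t(1) by linarith
    qed
    have err01: "0 \<le> err" "err \<le> 1"
      unfolding err_def bprob_def by (rule fprob_nonneg, rule fprob_le_1[OF finite_balls_code])
    have e2: "ent err + ent (1 - err) < lam / 2" by (rule t(2)[OF err01 err])
    have "- ln \<theta> - (ent err + ent (1 - err)) \<le>
      real (card (sepset r)) * (\<Sum>a\<in>K. ent (bprob R (\<lambda>x. \<phi> x = a)))"
      unfolding err_def \<Theta>_def
    proof (rule entropy_lower_bound[where \<psi> = "\<lambda>w. \<exists>x'\<in>X. (\<lambda>g\<in>W. \<phi>0 (tr g x')) = w \<and> x' \<in> D"])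
      show "cyl R \<phi>" using cyl_mono[OF \<phi>_cyl] R(1) by simp
      show "range \<phi> \<subseteq> K" by (auto simp: \<phi>_def K_def)
      show "cyl R (\<lambda>x. \<exists>x'\<in>X. (\<lambda>g\<in>W. \<phi>0 (tr g x')) = (\<lambda>g\<in>W. \<phi> (tr g x)) \<and> x' \<in> D)"
        using \<Theta>_cyl unfolding \<Theta>_def .
      show "0 \<le> - ln \<theta> - (ent (bprob R (\<lambda>x. F x \<noteq> (\<exists>x'\<in>X. (\<lambda>g\<in>W. \<phi>0 (tr g x')) = (\<lambda>g\<in>W. \<phi> (tr g x)) \<and> x' \<in> D))) +
        ent (1 - bprob R (\<lambda>x. F x \<noteq> (\<exists>x'\<in>X. (\<lambda>g\<in>W. \<phi>0 (tr g x')) = (\<lambda>g\<in>W. \<phi> (tr g x)) \<and> x' \<in> D))))"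
        using e2 lam unfolding err_def \<Theta>_def lam_def by linarith
    qed (use F(1) R(1) K(1) W(3) F_\<theta> \<theta> in auto)
    then have main: "lam / 2 \<le> Ns * (\<Sum>a\<in>K. ent (bprob R (\<lambda>x. \<phi> x = a)))"
      using e2 unfolding lam_def Ns_def by linarith
    \<comment> \<open>Passing from approximate to exact labels costs at most
      \<open>c / (4 * card K)\<close> per label, hence \<open>c / 4\<close> in total.\<close>
    have "(\<Sum>a\<in>K. ent (bprob R (\<lambda>x. \<phi> x = a))) \<le>
      (\<Sum>a\<in>K. ent (measure m {x \<in> X. \<phi>0 x = a}) + c / (4 * real (card K)))"
    proof (rule sum_mono)
      fix a assume "a \<in> K"
      have "cyl R \<phi>" using cyl_mono[OF \<phi>_cyl] R(1) by simp
      then have "cyl R (\<lambda>x. \<phi> x = a)" by (rule cyl_comp[where h = "\<lambda>b. b = a"])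
      then have m1: "bprob R (\<lambda>x. \<phi> x = a) = measure m {x \<in> X. \<phi> x = a}" and s1: "{x \<in> X. \<phi> x = a} \<in> sets m"
        by (rule marginal[symmetric], rule cyl_sets[OF HOL.refl])
      have "{x \<in> X. \<phi>0 x = a} = {x \<in> space m. \<forall>C\<in>P'. x \<in> C \<longleftrightarrow> C \<in> a}" using \<open>a \<in> K\<close>
        by (auto simp: \<phi>0_def K_def)
      also have "\<dots> \<in> sets m"
      proof (rule sets.sets_Collect_finite_All[OF _ P'(1)])
        fix C assume "C \<in> P'"
        then have "C \<in> sets m" "X - C \<in> sets m" using P'_sets sets.compl_sets[of C m] by auto
        moreover have "{x \<in> space m. x \<in> C \<longleftrightarrow> C \<in> a} = (if C \<in> a then C else X - C)"
          using sets.sets_into_space[OF \<open>C \<in> sets m\<close>] by auto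
        ultimately show "{x \<in> space m. x \<in> C \<longleftrightarrow> C \<in> a} \<in> sets m" by simp
      qed
      finally have s0: "{x \<in> X. \<phi>0 x = a} \<in> sets m" .
      have "\<bar>measure m {x \<in> X. \<phi> x = a} - measure m {x \<in> X. \<phi>0 x = a}\<bar> \<le> measure m Z"
        using Z_eq by (intro measure_diff_le s1 s0 Z_sets) blast
      then have "\<bar>measure m {x \<in> X. \<phi> x = a} - measure m {x \<in> X. \<phi>0 x = a}\<bar> < t2" using Z \<delta>(2) by linarith
      then have "ent (measure m {x \<in> X. \<phi> x = a}) < ent (measure m {x \<in> X. \<phi>0 x = a}) + c / (4 * real (card K))"
        by (intro t2(2)) auto
      then show "ent (bprob R (\<lambda>x. \<phi> x = a)) \<le> ent (measure m {x \<in> X. \<phi>0 x = a}) + c / (4 * real (card K))"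
        unfolding m1 by (rule less_imp_le)
    qed
    also have "\<dots> = (\<Sum>a\<in>K. ent (measure m {x \<in> X. \<phi>0 x = a})) + c / 4"
      using K(2) by (simp add: sum.distrib)
    also have "(\<Sum>a\<in>K. ent (measure m {x \<in> X. \<phi>0 x = a})) = (\<Sum>C\<in>P'. ent (measure m C)) + ent (measure m (X - \<Union>P'))"
      unfolding K_def \<phi>0_def by (rule sum_ent_labels[OF P P'(1,3)])
    also have "(\<Sum>C\<in>P'. ent (measure m C)) \<le> c" by (rule sum_ent_le_shannon[OF P'(1,3) small])
    \<comment> \<open>The contributions are at most \<open>c\<close> from \<open>P'\<close>, less
      than \<open>c / 4\<close> from the uncovered part, and \<open>c / 4\<close> from the
      labels.\<close>
    finally have "(\<Sum>a\<in>K. ent (bprob R (\<lambda>x. \<phi> x = a))) < 2 * c" using rest c by simp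
    then have "Ns * (\<Sum>a\<in>K. ent (bprob R (\<lambda>x. \<phi> x = a))) < Ns * (2 * c)" using Ns by simp
    also have "\<dots> = lam / 2" using Ns by (simp add: c_def)
    finally show False using main by simp
  qed
  with c show ?thesis by (intro exI[of _ c] conjI allI impI)
qed

section \<open>Triviality of the Pinsker factor and positivity for all factors\<close>

lemma invariant_trivial: "invariant_subalgebra G m tr {{}, X}"
  using shift_X sets.top[of m] by (auto simp: invariant_subalgebra_def sigma_algebra_trivial)

lemma null_or_full:
  assumes "A \<in> sets m" "\<not> (emeasure m A = 0 \<or> emeasure m A = 1)"
  shows "0 < measure m A" "measure m A < 1"
proof -
  have "measure m A \<noteq> 0" "measure m A \<noteq> 1" using assms(2) by (auto simp: emeasure_eq_measure)
  then show "0 < measure m A" "measure m A < 1"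
    using measure_nonneg[of m A] prob_le_1[of A] by linarith+
qed

text \<open>A set of measure strictly between 0 and 1 in \<open>F\<close> would bound the entropy of
  every admissible partition below by the same positive \<open>c\<close>.\<close>

lemma zero_outer_entropy_trivial:
  assumes F: "F \<subseteq> sets m" and zero: "outer_rokhlin_entropy G m tr F = 0"
  shows "trivial_factor m F"
  unfolding trivial_factor_def
proof (rule ballI, rule ccontr)
  fix A assume A: "A \<in> F" and nontriv: "\<not> (emeasure m A = 0 \<or> emeasure m A = 1)"
  have As: "A \<in> sets m" using A F by blast
  obtain c where c: "0 < c" "\<forall>P B. countable_partition m P \<longrightarrow> B \<in> generated_subalgebra G m tr P \<longrightarrow>
    sym_diff A B \<in> null_sets m \<longrightarrow> ennreal c \<le> shannon_entropy m P"
    using shannon_lower_bound[OF As null_or_full[OF As nontriv]] by (elim exE conjE)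
  have "ennreal c \<le> outer_rokhlin_entropy G m tr F"
    unfolding outer_rokhlin_entropy_def
  proof (rule Inf_greatest)
    fix h assume "h \<in> {shannon_entropy m P | P. countable_partition m P \<and> subset_mod_null m F (generated_subalgebra G m tr P)}"
    then obtain P where P: "h = shannon_entropy m P" "countable_partition m P"
      "subset_mod_null m F (generated_subalgebra G m tr P)" by blast
    obtain B where B: "B \<in> generated_subalgebra G m tr P" "sym_diff A B \<in> null_sets m"
      using bspec[OF P(3)[unfolded subset_mod_null_def] A] by (elim bexE)
    show "ennreal c \<le> h" unfolding P(1) by (rule c(2)[rule_format, OF P(2) B])
  qed
  then show False using zero c(1) by simp
qed

text \<open>The one-set partition has entropy zero, and any \<open>F\<close> of zero outer entropy
  consists of null and full sets, so it is contained in the two-set algebra modulo null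
  sets.\<close>

lemma pinsker_trivial: "outer_rokhlin_pinsker G m tr {{}, X}"
  unfolding outer_rokhlin_pinsker_def
proof (intro conjI allI impI)
  show "invariant_subalgebra G m tr {{}, X}" by (rule invariant_trivial)
  have ne: "X \<noteq> {}" using not_empty by simp
  have part: "countable_partition m {X}"
    using sets.top[of m] ne by (simp add: countable_partition_def partition_on_space)
  have "A \<in> generated_subalgebra G m tr {X}" if "A \<in> {{}, X}" for A
    using that by (auto simp: generated_subalgebra_def invariant_subalgebra_def sigma_algebra_iff2)
  then have "\<exists>B\<in>generated_subalgebra G m tr {X}. sym_diff A B \<in> null_sets m" if "A \<in> {{}, X}" for A
    using that by (intro bexI[of _ A]) simp_all
  then have "subset_mod_null m {{}, X} (generated_subalgebra G m tr {X})"
    unfolding subset_mod_null_def by (intro ballI)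
  moreover have "shannon_entropy m {X} = 0" using prob_space by (simp add: shannon_entropy_def)
  ultimately have "0 \<in> {shannon_entropy m P | P. countable_partition m P \<and>
      subset_mod_null m {{}, X} (generated_subalgebra G m tr P)}"
    using part by (intro CollectI exI[of _ "{X}"]) simp
  then have "outer_rokhlin_entropy G m tr {{}, X} \<le> 0"
    unfolding outer_rokhlin_entropy_def by (rule Inf_lower)
  then show "outer_rokhlin_entropy G m tr {{}, X} = 0" by simp
  fix F assume F: "invariant_subalgebra G m tr F \<and> outer_rokhlin_entropy G m tr F = 0"
  then have Fs: "F \<subseteq> sets m" by (simp add: invariant_subalgebra_def)
  have triv: "trivial_factor m F" using zero_outer_entropy_trivial[OF Fs] F by simp
  show "subset_mod_null m F {{}, X}"
    unfolding subset_mod_null_def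
  proof
    fix A assume A: "A \<in> F"
    have As: "A \<in> sets m" using A Fs by blast
    then have AX: "A \<subseteq> X" using sets.sets_into_space[OF As] by simp
    consider "emeasure m A = 0" | "emeasure m A = 1" using triv A by (auto simp: trivial_factor_def)
    then show "\<exists>B\<in>{{}, X}. sym_diff A B \<in> null_sets m"
    proof cases
      case 1
      then show ?thesis using As by (intro bexI[of _ "{}"]) (auto simp: null_sets_def)
    next
      case 2
      have "emeasure m (X - A) = 0"
        using 2 As emeasure_compl[of A m] emeasure_space_1 by simp
      moreover have "sym_diff A X = X - A" using AX by blast
      moreover have "X - A \<in> sets m" using sets.compl_sets[OF As] by simp
      ultimately show ?thesis by (intro bexI[of _ X]) (auto simp: null_sets_def)
    qed
  qed
qed

text \<open>A generating partition of the factor is also a partition of the whole system with the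
  same entropy, and what it generates there includes what it generates in the factor. So
  \<open>shannon_lower_bound\<close> applies to any nontrivial set of the factor.\<close>

lemma factor_entropy_pos:
  assumes F: "invariant_subalgebra G m tr F" and nontriv: "\<not> trivial_factor m F"
  shows "0 < rokhlin_entropy G (factor_measure m F) tr"
proof -
  let ?M = "factor_measure m F"
  note fm = space_factor_measure[OF F] sets_factor_measure[OF F] emeasure_factor_measure[OF F]
  have Fs: "F \<subseteq> sets m" using F by (simp add: invariant_subalgebra_def)
  obtain A where A: "A \<in> F" "\<not> (emeasure m A = 0 \<or> emeasure m A = 1)"
    using nontriv by (auto simp: trivial_factor_def)
  have As: "A \<in> sets m" using A Fs by blast
  obtain c where c: "0 < c" "\<forall>P B. countable_partition m P \<longrightarrow> B \<in> generated_subalgebra G m tr P \<longrightarrow>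
    sym_diff A B \<in> null_sets m \<longrightarrow> ennreal c \<le> shannon_entropy m P"
    using shannon_lower_bound[OF As null_or_full[OF As A(2)]] by (elim exE conjE)
  have "ennreal c \<le> rokhlin_entropy G ?M tr"
    unfolding rokhlin_entropy_def
  proof (rule Inf_greatest)
    fix h assume "h \<in> {shannon_entropy ?M P | P. countable_partition ?M P \<and>
            subset_mod_null ?M (sets ?M) (generated_subalgebra G ?M tr P)}"
    then obtain P where P: "h = shannon_entropy ?M P" "countable_partition ?M P"
      "subset_mod_null ?M (sets ?M) (generated_subalgebra G ?M tr P)" by blast
    have PF: "P \<subseteq> F" using P(2) by (simp add: countable_partition_def fm)
    have Pm: "countable_partition m P" using P(2) Fs by (auto simp: countable_partition_def fm)
    have "measure ?M C = measure m C" if "C \<in> P" for C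
      using that PF fm(3) by (auto simp: measure_def)
    then have h: "h = shannon_entropy m P"
      unfolding P(1) shannon_entropy_def by (intro infsum_cong) simp
    have "generated_subalgebra G ?M tr P \<subseteq> F'" if F': "invariant_subalgebra G m tr F'" "P \<subseteq> F'" for F'
    proof -
      \<comment> \<open>Intersecting with \<open>F\<close> turns an invariant subalgebra of the
        whole system into one of the factor.\<close>
      have "invariant_subalgebra G ?M tr (F' \<inter> F)"
        using F'(1) F unfolding invariant_subalgebra_def fm(1,2) sigma_algebra_iff2 by auto
      then have "generated_subalgebra G ?M tr P \<subseteq> F' \<inter> F"
        unfolding generated_subalgebra_def using F'(2) PF by (intro Inter_lower) simp
      then show ?thesis by (rule order_trans) simp
    qed
    then have gen: "generated_subalgebra G ?M tr P \<subseteq> generated_subalgebra G m tr P"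
      unfolding generated_subalgebra_def[of G m tr P] by (intro Inter_greatest) (elim CollectE conjE)
    obtain B where B: "B \<in> generated_subalgebra G ?M tr P" "sym_diff A B \<in> null_sets ?M"
      using bspec[OF P(3)[unfolded subset_mod_null_def fm(2)] A(1)] by (elim bexE)
    have "sym_diff A B \<in> F" "emeasure ?M (sym_diff A B) = 0" using B(2) fm(2) by (auto simp: null_sets_def)
    then have "sym_diff A B \<in> null_sets m" using Fs fm(3)[of "sym_diff A B"] by (intro null_setsI) auto
    then show "ennreal c \<le> h" unfolding h by (rule c(2)[rule_format, OF Pm subsetD[OF gen B(1)]])
  qed
  moreover have "0 < ennreal c" using c(1) by simp
  ultimately show ?thesis by (rule less_le_trans[rotated])
qed

end

theorem corollary1p1:
  fixes d k :: nat and m :: "(nat word set \<Rightarrow> bit) measure"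
  assumes "3 \<le> d" and "d < k"
    and "haar_prob_measure d k m"
  shows "(\<exists>F. outer_rokhlin_pinsker (Gam d k) m (shift_action d k) F) \<and>
         (\<forall>F. outer_rokhlin_pinsker (Gam d k) m (shift_action d k) F \<longrightarrow> trivial_factor m F) \<and>
         completely_positive_rokhlin_entropy (Gam d k) m (shift_action d k)"
proof -
  interpret haar_code d k m using assms by unfold_locales
  show ?thesis
  proof (intro conjI allI impI)
    show "\<exists>F. outer_rokhlin_pinsker G m tr F" by (intro exI) (rule pinsker_trivial)
    show "trivial_factor m F" if "outer_rokhlin_pinsker G m tr F" for F
      using that by (intro zero_outer_entropy_trivial) (simp_all add: outer_rokhlin_pinsker_def invariant_subalgebra_def)
    show "completely_positive_rokhlin_entropy G m tr"
      unfolding completely_positive_rokhlin_entropy_def by (intro allI impI factor_entropy_pos) simp_all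
  qed
qed

end
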